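(* Let $\epsilon>0$ and $p\in(0,1)$, and set $\nu=2$, $$T=\left\lceil \log_{\nu}\left(\max\left(\frac{L_x}{\mu_x},\frac{L_y}{\mu_y},\frac{L_{xy}^2}{\mu_x\mu_y}\right)\right)\right\rceil,\qquad \delta=\frac{\epsilon}{4+4T},\qquad \lambda_x^i=\mu_x\nu^i,\quad \lambda_y^i=\mu_y\nu^i\quad (i=0,1,\dots,T).$$ Then the point $(x_{T+1}^c,y_{T+1}^c)=\text{BoostSAA-C}(\delta,p,T)$ satisfies $$\mathbb P\left(\Delta_\Phi(x_{T+1}^c,y_{T+1}^c)\le\epsilon\right)\ge 1-p.$$
   Context: $\|\cdot\|$ is the Euclidean norm. Constrained setting: $\mathcal X\subset\mathbb R^{d_x}$, $\mathcal Y\subset\mathbb R^{d_y}$ are compact convex sets, $\xi\sim\mathcal P$ is a random variable, $\Phi(x,y)=\mathbb E[\Phi_\xi(x,y)]$. The duality gap is $\Delta_\Phi(\hat x,\hat y):=\max_{y\in\mathcal Y}\Phi(\hat x,y)-\min_{x\in\mathcal X}\Phi(x,\hat y)$. Assumption (SC-SC): there are $\mu_x,\mu_y>0$ such that for almost every $\xi$, $\Phi_\xi(\cdot,y)$ is $\mu_x$-strongly convex on $\mathcal X$ for every $y\in\mathcal Y$ and $\Phi_\xi(x,\cdot)$ is $\mu_y$-strongly concave on $\mathcal Y$ for every $x\in\mathcal X$. Assumption (smoothness): there are $L_x,L_y,L_{xy}>0$ such that for all $x_1,x_2\in\mathcal X$, $y_1,y_2\in\mathcal Y$: $\|\nabla_x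 \Phi(x_1,y_1)-\nabla_x\Phi(x_2,y_1)\|\le L_x\|x_1-x_2\|$, $\|\nabla_y \Phi(x_1,y_1)-\nabla_y\Phi(x_1,y_2)\|\le L_y\|y_1-y_2\|$, $\|\nabla_x \Phi(x_1,y_1)-\nabla_x\Phi(x_1,y_2)\|\le L_{xy}\|y_1-y_2\|$, $\|\nabla_y \Phi(x_1,y_1)-\nabla_y\Phi(x_2,y_1)\|\le L_{xy}\|x_1-x_2\|$. Assumption (Lipschitz): there are $\ell_x,\ell_y>0$ such that for almost every $\xi$, $\Phi_\xi(\cdot,y)$ is $\ell_x$-Lipschitz on $\mathcal X$ for every $y\in\mathcal Y$ and $\Phi_\xi(x,\cdot)$ is $\ell_y$-Lipschitz on $\mathcal Y$ for every $x\in\mathcal X$. Stochastic gradients: $G_x(x,y,\xi):=\nabla_x\Phi_\xi(x,y)$, $G_y(x,y,\xi):=\nabla_y\Phi_\xi(x,y)$, which are unbiased for $\nabla_x\Phi,\nabla_y\Phi$ with variances $\mathbb E\|G_x-\nabla_x\Phi\|^2\le\sigma_x^2:=4\ell_x^2$, $\mathbb E\|G_y-\nabla_y\Phi\|^2\le\sigma_y^2:=4\ell_y^2$ (using $\|\nabla_x\Phi_\xi\|\le\ell_x$, $\|\nabla_y\Phi_\xi\|\le\ell_y$ on $\mathcal X\times\mathcal Y$). Convention $\lambda_x^{-1}=\lambda_y^{-1}=0$. Perturbed objectives: $\Phi_x^T(x,y):=\Phi(x,y)+\frac{\lambda_x^T}{2}\|x-x_T^c\|^2$, $\Phi_y^T(x,y):=\Phi(x,y)-\frac{\lambda_y^T}{2}\|y-y_T^c\|^2$.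 Extract$(\{z_j\}_{j=1}^m,\rho)$ for a pseudometric $\rho$: for each $j$ let $r_j=\min\{r\ge0:|\{k:\rho(z_j,z_k)\le r\}|>m/2\}$; let $\hat r$ be the $\lceil m/2\rceil$-th smallest of $r_1,\dots,r_m$; return $\{k:r_k\le\hat r\}$. SAA$(n,\lambda_x,\lambda_y,x^c,y^c)$: draw fresh i.i.d. $\xi_1,\dots,\xi_n\sim\mathcal P$ and return the saddle point $(\hat x,\hat y)$ of $\min_{x\in\mathcal X}\max_{y\in\mathcal Y} \frac1n\sum_{i=1}^n\Phi_{\xi_i}(x,y)+\frac{\lambda_x}{2}\|x-x^c\|^2-\frac{\lambda_y}{2}\|y-y^c\|^2$ (a center is irrelevant, "null", if its coefficient is $0$). RobustSAA$(n,m,\lambda_x,\lambda_y,x^c,y^c)$: call SAA$(n,\lambda_x,\lambda_y,x^c,y^c)$ independently $m$ times to get $(\hat x_j,\hat y_j)_{j=1}^m$; with $\rho$ the Euclidean distance pick arbitrary $k_1\in\text{Extract}(\{\hat x_j\},\rho)$, $k_2\in\text{Extract}(\{\hat y_j\},\rho)$; return $(\hat x_{k_1},\hat y_{k_2})$. SAA oracle for the last round: $\mathcal M^w(\Phi_x^T,\eta):=\text{SAA}(n,\lambda_x^T,0,x_T^c,\text{null})$ with $n=\left\lceil\frac{2}{\eta}\left(\frac{\ell_x^2}{\mu_x+\lambda_x^T}+\frac{\ell_y^2}{\mu_y}\right)\right\rceil$; $\mathcal M^w(\Phi_y^T,\eta):=\text{SAA}(n,0,\lambda_y^T,\text{null},y_T^c)$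 with $n=\left\lceil\frac{2}{\eta}\left(\frac{\ell_x^2}{\mu_x}+\frac{\ell_y^2}{\mu_y+\lambda_y^T}\right)\right\rceil$. Gradient$(x,y,\delta_G,m,\text{Flag})$: let $(G,\sigma)=(G_x,\sigma_x)$ if Flag $=1$, $(G_y,\sigma_y)$ if Flag $=0$; $n=\lceil 3\sigma^2/\delta_G^2\rceil$; for $j=1,\dots,m$ draw fresh i.i.d. $\xi_1,\dots,\xi_n$ and form $\frac1n\sum_{i=1}^n G(x,y,\xi_i)$; apply Extract (Euclidean distance) to these $m$ vectors and return one with arbitrary extracted index. FunctionGap$(\mathcal M^w,\eta,m,\text{Flag})$, $m$ odd: (1) If Flag $=1$ set $\Phi_T=\Phi_x^T$, $\delta_G=(L_x+\lambda_x^T)\sqrt{\eta/(\mu_x+\lambda_x^T)}$; if Flag $=0$ set $\Phi_T=\Phi_y^T$, $\delta_G=(L_y+\lambda_y^T)\sqrt{\eta/(\mu_y+\lambda_y^T)}$. (2) Independently generate $(\hat x_j,\hat y_j)$, $j=1,\dots,m$, by calling $\mathcal M^w(\Phi_T,\eta/3)$. (3) With $\rho_1$ the Euclidean distance compute $\mathcal I_1=\text{Extract}(\{\hat x_j\},\rho_1)$, $\mathcal I_2=\text{Extract}(\{\hat y_j\},\rho_1)$, pick arbitrary $k_1\in\mathcal I_1$, $k_2\in\mathcal I_2$, set $x_G=\hat x_{k_1}$, $y_G=\hat y_{k_2}$. (4) If Flag $=1$: $v=\text{Gradient}(x_G,y_G,\delta_G,m,1)+\lambda_x^T(x_G-x_T^c)$,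 $\rho_2(x_1,x_2)=|\langle v,x_1-x_2\rangle|$, $\mathcal I_3=\text{Extract}(\{\hat x_j\},\rho_2)$, return $\hat x_{k_3}$ for arbitrary $k_3\in\mathcal I_1\cap\mathcal I_3$. If Flag $=0$: $v=\text{Gradient}(x_G,y_G,\delta_G,m,0)-\lambda_y^T(y_G-y_T^c)$, $\rho_2(y_1,y_2)=|\langle v,y_1-y_2\rangle|$, $\mathcal I_3=\text{Extract}(\{\hat y_j\},\rho_2)$, return $\hat y_{k_3}$ for arbitrary $k_3\in\mathcal I_2\cap\mathcal I_3$. Constants: $M_x^T:=3+(18\sqrt2+45)\frac{L_x+\lambda_x^T}{\mu_x+\lambda_x^T}+\frac{36L_{xy}}{\sqrt{(\mu_x+\lambda_x^T)\mu_y}}+\frac{9L_{xy}^2}{(\mu_x+\lambda_x^T)\mu_y}$, $M_y^T:=3+(18\sqrt2+45)\frac{L_y+\lambda_y^T}{\mu_y+\lambda_y^T}+\frac{36L_{xy}}{\sqrt{\mu_x(\mu_y+\lambda_y^T)}}+\frac{9L_{xy}^2}{\mu_x(\mu_y+\lambda_y^T)}$. BoostSAA-C$(\delta,p,T)$: let $m$ be whichever of $\lceil18\ln(\frac{2T+6}{p})\rceil$, $\lceil18\ln(\frac{2T+6}{p})\rceil+1$ is odd; $x_{-1}^c=y_{-1}^c=0$ (irrelevant). For $i=0,\dots,T$: $n_x^{i-1}=\left\lceil\frac{54}{\delta}\left(\frac{\ell_x^2}{\mu_x+\lambda_x^{i-1}}+\frac{\ell_y^2}{\mu_y}\right)\right\rceil$,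 $n_y^{i-1}=\left\lceil\frac{54}{\delta}\left(\frac{\ell_x^2}{\mu_x}+\frac{\ell_y^2}{\mu_y+\lambda_y^{i-1}}\right)\right\rceil$; $x_i^c$ = $x$-component of RobustSAA$(n_x^{i-1},m,\lambda_x^{i-1},0,x_{i-1}^c,\text{null})$; $y_i^c$ = $y$-component of RobustSAA$(n_y^{i-1},m,0,\lambda_y^{i-1},\text{null},y_{i-1}^c)$. Return $x_{T+1}^c=\text{FunctionGap}(\mathcal M^w,\delta/M_x^T,m,1)$ and $y_{T+1}^c=\text{FunctionGap}(\mathcal M^w,\delta/M_y^T,m,0)$. All calls use fresh independent samples. *)

theory Defs
  imports "HOL-Probability.Probability"
begin

section \<open>Minimax notions\<close>

definition strongly_convex_on :: "real \<Rightarrow> 'a::real_normed_vector set \<Rightarrow> ('a \<Rightarrow> real) \<Rightarrow> bool" where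
  "strongly_convex_on \<mu> S f \<longleftrightarrow>
     (\<forall>u\<in>S. \<forall>v\<in>S. \<forall>t\<in>{0..1}.
        f (t *\<^sub>R u + (1 - t) *\<^sub>R v)
          \<le> t * f u + (1 - t) * f v - \<mu> / 2 * t * (1 - t) * (norm (u - v))\<^sup>2)"

definition strongly_concave_on :: "real \<Rightarrow> 'a::real_normed_vector set \<Rightarrow> ('a \<Rightarrow> real) \<Rightarrow> bool" where
  "strongly_concave_on \<mu> S f \<longleftrightarrow> strongly_convex_on \<mu> S (\<lambda>u. - f u)"

definition expected_objective :: "'c measure \<Rightarrow> ('c \<Rightarrow> 'a \<Rightarrow> 'b \<Rightarrow> real) \<Rightarrow> 'a \<Rightarrow> 'b \<Rightarrow> real" where
  "expected_objective P \<Phi> x y = (\<integral>\<xi>. \<Phi> \<xi> x y \<partial>P)"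

definition duality_gap :: "'a set \<Rightarrow> 'b set \<Rightarrow> ('a \<Rightarrow> 'b \<Rightarrow> real) \<Rightarrow> 'a \<Rightarrow> 'b \<Rightarrow> real" where
  "duality_gap X Y f x y = (SUP y'\<in>Y. f x y') - (INF x'\<in>X. f x' y)"

definition saddle_point :: "'a set \<Rightarrow> 'b set \<Rightarrow> ('a \<Rightarrow> 'b \<Rightarrow> real) \<Rightarrow> 'a \<Rightarrow> 'b \<Rightarrow> bool" where
  "saddle_point X Y f x y \<longleftrightarrow>
     x \<in> X \<and> y \<in> Y \<and> (\<forall>x'\<in>X. f x y \<le> f x' y) \<and> (\<forall>y'\<in>Y. f x y' \<le> f x y)"

text \<open>A differentiable function on a convex set may only be differentiable relative to that set,
  so gradients are taken with respect to the derivative within \<open>S\<close>; every gradient in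
  the ambient space is one.\<close>

definition has_gradient_within :: "('a::real_inner \<Rightarrow> real) \<Rightarrow> 'a \<Rightarrow> 'a \<Rightarrow> 'a set \<Rightarrow> bool" where
  "has_gradient_within f g x S \<longleftrightarrow> (f has_derivative (\<lambda>h. g \<bullet> h)) (at x within S)"


section \<open>The procedures, for given samples\<close>

text \<open>Each procedure is rendered as the set of results it can return on the given sample points;
  the set reflects the arbitrary choices of indices. Indices run from \<open>0\<close> to \<open>m - 1\<close>.\<close>

definition extract_radius :: "nat \<Rightarrow> ('z \<Rightarrow> 'z \<Rightarrow> real) \<Rightarrow> (nat \<Rightarrow> 'z) \<Rightarrow> nat \<Rightarrow> real" where
  "extract_radius m \<rho> z j = (LEAST r. 0 \<le> r \<and> real (card {k. k < m \<and> \<rho> (z j) (z k) \<le> r}) > real m / 2)"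

definition extract_idx :: "nat \<Rightarrow> ('z \<Rightarrow> 'z \<Rightarrow> real) \<Rightarrow> (nat \<Rightarrow> 'z) \<Rightarrow> nat set" where
  "extract_idx m \<rho> z =
     (let r = extract_radius m \<rho> z;
          rhat = sort (map r [0..<m]) ! (nat \<lceil>real m / 2\<rceil> - 1)
      in {k. k < m \<and> r k \<le> rhat})"

definition saa_objective ::
  "('c \<Rightarrow> 'a \<Rightarrow> 'b \<Rightarrow> real) \<Rightarrow> nat \<Rightarrow> real \<Rightarrow> real \<Rightarrow> 'a::euclidean_space \<Rightarrow> 'b::euclidean_space
     \<Rightarrow> (nat \<Rightarrow> 'c) \<Rightarrow> 'a \<Rightarrow> 'b \<Rightarrow> real" where
  "saa_objective \<Phi> n lamx lamy cx cy s x y =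
     (\<Sum>i<n. \<Phi> (s i) x y) / real n + lamx / 2 * (norm (x - cx))\<^sup>2 - lamy / 2 * (norm (y - cy))\<^sup>2"

definition saa ::
  "'a set \<Rightarrow> 'b set \<Rightarrow> ('c \<Rightarrow> 'a \<Rightarrow> 'b \<Rightarrow> real) \<Rightarrow> nat \<Rightarrow> real \<Rightarrow> real
     \<Rightarrow> 'a::euclidean_space \<Rightarrow> 'b::euclidean_space \<Rightarrow> (nat \<Rightarrow> 'c) \<Rightarrow> ('a \<times> 'b) set" where
  "saa X Y \<Phi> n lamx lamy cx cy s = {(x, y). saddle_point X Y (saa_objective \<Phi> n lamx lamy cx cy s) x y}"

definition robust_saa ::
  "'a set \<Rightarrow> 'b set \<Rightarrow> ('c \<Rightarrow> 'a \<Rightarrow> 'b \<Rightarrow> real) \<Rightarrow> nat \<Rightarrow> nat \<Rightarrow> real \<Rightarrow> real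
     \<Rightarrow> 'a::euclidean_space \<Rightarrow> 'b::euclidean_space \<Rightarrow> (nat \<Rightarrow> nat \<Rightarrow> 'c) \<Rightarrow> ('a \<times> 'b) set" where
  "robust_saa X Y \<Phi> n m lamx lamy cx cy s =
     {(xh k1, yh k2) | xh yh k1 k2.
        (\<forall>j<m. (xh j, yh j) \<in> saa X Y \<Phi> n lamx lamy cx cy (s j)) \<and>
        k1 \<in> extract_idx m dist xh \<and> k2 \<in> extract_idx m dist yh}"

text \<open>The calls \<open>M\<^sup>w\<close> of the last round. An irrelevant centre (one with coefficient \<open>0\<close>) is passed as
  \<open>0\<close>.\<close>

definition weak_saa_x ::
  "'a set \<Rightarrow> 'b set \<Rightarrow> ('c \<Rightarrow> 'a \<Rightarrow> 'b \<Rightarrow> real) \<Rightarrow> real \<Rightarrow> real \<Rightarrow> real \<Rightarrow> real \<Rightarrow> real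
     \<Rightarrow> 'a::euclidean_space \<Rightarrow> real \<Rightarrow> (nat \<Rightarrow> 'c) \<Rightarrow> ('a \<times> 'b::euclidean_space) set" where
  "weak_saa_x X Y \<Phi> \<mu>x \<mu>y Kx Ky lamx cx \<eta> s =
     saa X Y \<Phi> (nat \<lceil>2 / \<eta> * (Kx\<^sup>2 / (\<mu>x + lamx) + Ky\<^sup>2 / \<mu>y)\<rceil>) lamx 0 cx 0 s"

definition weak_saa_y ::
  "'a set \<Rightarrow> 'b set \<Rightarrow> ('c \<Rightarrow> 'a \<Rightarrow> 'b \<Rightarrow> real) \<Rightarrow> real \<Rightarrow> real \<Rightarrow> real \<Rightarrow> real \<Rightarrow> real
     \<Rightarrow> 'b::euclidean_space \<Rightarrow> real \<Rightarrow> (nat \<Rightarrow> 'c) \<Rightarrow> ('a::euclidean_space \<times> 'b) set" where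
  "weak_saa_y X Y \<Phi> \<mu>x \<mu>y Kx Ky lamy cy \<eta> s =
     saa X Y \<Phi> (nat \<lceil>2 / \<eta> * (Kx\<^sup>2 / \<mu>x + Ky\<^sup>2 / (\<mu>y + lamy))\<rceil>) 0 lamy 0 cy s"

definition gradient ::
  "('c \<Rightarrow> 'a \<Rightarrow> 'b \<Rightarrow> 'v::euclidean_space) \<Rightarrow> real \<Rightarrow> real \<Rightarrow> nat \<Rightarrow> 'a \<Rightarrow> 'b
     \<Rightarrow> (nat \<Rightarrow> nat \<Rightarrow> 'c) \<Rightarrow> 'v set" where
  "gradient G \<sigma> \<delta>G m x y s =
     (let n = nat \<lceil>3 * \<sigma>\<^sup>2 / \<delta>G\<^sup>2\<rceil>;
          g = (\<lambda>j. (1 / real n) *\<^sub>R (\<Sum>i<n. G (s j i) x y))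
      in {g k | k. k \<in> extract_idx m dist g})"

text \<open>\<open>function_gap_x\<close> (flag 1) and \<open>function_gap_y\<close> (flag 0) use the sample points \<open>s\<close> for
  the SAA calls and \<open>sG\<close> for the gradient estimate. \<open>Kx\<close>, \<open>Ky\<close> are the Lipschitz constants of the
  sampled objective, and \<open>2 * Kx\<close>, \<open>2 * Ky\<close> bound the standard deviations of the stochastic
  gradients. The intermediate point \<open>(xG, yG)\<close> is an argument and not an existential inside,
  because it has to be fixed before \<open>sG\<close> is drawn.\<close>

definition function_gap_x ::
  "'a set \<Rightarrow> 'b set \<Rightarrow> ('c \<Rightarrow> 'a \<Rightarrow> 'b \<Rightarrow> real) \<Rightarrow> ('c \<Rightarrow> 'a \<Rightarrow> 'b \<Rightarrow> 'a)
     \<Rightarrow> real \<Rightarrow> real \<Rightarrow> real \<Rightarrow> real \<Rightarrow> real \<Rightarrow> real \<Rightarrow> 'a::euclidean_space \<Rightarrow> real \<Rightarrow> nat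
     \<Rightarrow> (nat \<Rightarrow> nat \<Rightarrow> 'c) \<Rightarrow> (nat \<Rightarrow> nat \<Rightarrow> 'c) \<Rightarrow> 'a \<Rightarrow> 'b::euclidean_space \<Rightarrow> 'a set" where
  "function_gap_x X Y \<Phi> Gx \<mu>x \<mu>y Lx Kx Ky lamx cx \<eta> m s sG xG yG =
     {xh k3 | xh yh k1 k2 g k3.
        (\<forall>j<m. (xh j, yh j) \<in> weak_saa_x X Y \<Phi> \<mu>x \<mu>y Kx Ky lamx cx (\<eta> / 3) (s j)) \<and>
        k1 \<in> extract_idx m dist xh \<and> xG = xh k1 \<and>
        k2 \<in> extract_idx m dist yh \<and> yG = yh k2 \<and>
        g \<in> gradient Gx (2 * Kx) ((Lx + lamx) * sqrt (\<eta> / (\<mu>x + lamx))) m xG yG sG \<and>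
        (let v = g + lamx *\<^sub>R (xG - cx)
         in k3 \<in> extract_idx m dist xh \<inter> extract_idx m (\<lambda>x1 x2. \<bar>v \<bullet> (x1 - x2)\<bar>) xh)}"

definition function_gap_y ::
  "'a set \<Rightarrow> 'b set \<Rightarrow> ('c \<Rightarrow> 'a \<Rightarrow> 'b \<Rightarrow> real) \<Rightarrow> ('c \<Rightarrow> 'a \<Rightarrow> 'b \<Rightarrow> 'b)
     \<Rightarrow> real \<Rightarrow> real \<Rightarrow> real \<Rightarrow> real \<Rightarrow> real \<Rightarrow> real \<Rightarrow> 'b::euclidean_space \<Rightarrow> real \<Rightarrow> nat
     \<Rightarrow> (nat \<Rightarrow> nat \<Rightarrow> 'c) \<Rightarrow> (nat \<Rightarrow> nat \<Rightarrow> 'c) \<Rightarrow> 'a::euclidean_space \<Rightarrow> 'b \<Rightarrow> 'b set" where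
  "function_gap_y X Y \<Phi> Gy \<mu>x \<mu>y Ly Kx Ky lamy cy \<eta> m s sG xG yG =
     {yh k3 | xh yh k1 k2 g k3.
        (\<forall>j<m. (xh j, yh j) \<in> weak_saa_y X Y \<Phi> \<mu>x \<mu>y Kx Ky lamy cy (\<eta> / 3) (s j)) \<and>
        k1 \<in> extract_idx m dist xh \<and> xG = xh k1 \<and>
        k2 \<in> extract_idx m dist yh \<and> yG = yh k2 \<and>
        g \<in> gradient Gy (2 * Ky) ((Ly + lamy) * sqrt (\<eta> / (\<mu>y + lamy))) m xG yG sG \<and>
        (let v = g - lamy *\<^sub>R (yG - cy)
         in k3 \<in> extract_idx m dist yh \<inter> extract_idx m (\<lambda>y1 y2. \<bar>v \<bullet> (y1 - y2)\<bar>) yh)}"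


section \<open>BoostSAA-C as a random process\<close>

text \<open>\<open>\<xi> r (b, j, k)\<close> is the \<open>k\<close>-th draw of the \<open>j\<close>-th repetition in round \<open>r\<close>, with \<open>b\<close> true
  for the calls that compute an \<open>x\<close> and false for those that compute a \<open>y\<close>. The \<open>\<sigma>\<close>-algebra
  \<open>F r\<close> is the information available before round \<open>r\<close>; it may be larger than what the earlier
  samples generate, so that choices can also be randomized. The last two conditions make the
  samples of all rounds jointly independent.\<close>

definition fresh_samples ::
  "'w measure \<Rightarrow> (nat \<Rightarrow> 'w measure) \<Rightarrow> 'c measure \<Rightarrow> (nat \<Rightarrow> bool \<times> nat \<times> nat \<Rightarrow> 'w \<Rightarrow> 'c) \<Rightarrow> bool" where
  "fresh_samples M F P \<xi> \<longleftrightarrow>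
     filtration (space M) F \<and> (\<forall>r. sets (F r) \<subseteq> sets M) \<and>
     (\<forall>r. prob_space.indep_vars M (\<lambda>_. P) (\<xi> r) UNIV) \<and>
     (\<forall>r i. distr M P (\<xi> r i) = P) \<and>
     (\<forall>r i. \<xi> r i \<in> F (Suc r) \<rightarrow>\<^sub>M P) \<and>
     (\<forall>r. prob_space.indep_set M (sets (F r))
            (sets (vimage_algebra (space M) (\<lambda>\<omega> i. \<xi> r i \<omega>) (Pi\<^sub>M UNIV (\<lambda>_. P)))))"

text \<open>Value at index \<open>i - 1\<close>, with \<open>z\<close> playing the role of the value at \<open>-1\<close>.\<close>

definition prev :: "'z \<Rightarrow> (nat \<Rightarrow> 'z) \<Rightarrow> nat \<Rightarrow> 'z" where
  "prev z f i = (case i of 0 \<Rightarrow> z | Suc k \<Rightarrow> f k)"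

definition boost_reps :: "real \<Rightarrow> nat \<Rightarrow> nat" where
  "boost_reps p T = (let m = nat \<lceil>18 * ln ((2 * real T + 6) / p)\<rceil> in if odd m then m else m + 1)"

text \<open>The constants \<open>M\<^sub>x\<^sup>T\<close> and \<open>M\<^sub>y\<^sup>T\<close>; the latter is obtained by exchanging the roles of \<open>x\<close> and \<open>y\<close>.\<close>

definition gap_const :: "real \<Rightarrow> real \<Rightarrow> real \<Rightarrow> real \<Rightarrow> real \<Rightarrow> real" where
  "gap_const L Lxy \<mu> \<mu>' lam =
     3 + (18 * sqrt 2 + 45) * ((L + lam) / (\<mu> + lam))
       + 36 * Lxy / sqrt ((\<mu> + lam) * \<mu>') + 9 * Lxy\<^sup>2 / ((\<mu> + lam) * \<mu>')"

text \<open>\<open>xc i\<close> and \<open>yc i\<close> are the centres computed in round \<open>i \<le> T\<close>, and \<open>xc (T + 1)\<close>, \<open>yc (T + 1)\<close> the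
  output. The SAA calls of \<open>function_gap_x\<close> and \<open>function_gap_y\<close> are round \<open>T + 1\<close>, their
  gradient estimates round \<open>T + 2\<close>. Arbitrary choices may depend on everything known so far, but
  not on samples drawn later; this is what measurability with respect to \<open>F\<close> expresses. The
  relations are required almost surely because empirical saddle points need only exist almost
  surely.\<close>

definition boost_saa_c ::
  "'w measure \<Rightarrow> (nat \<Rightarrow> 'w measure) \<Rightarrow> (nat \<Rightarrow> bool \<times> nat \<times> nat \<Rightarrow> 'w \<Rightarrow> 'c)
     \<Rightarrow> 'a::euclidean_space set \<Rightarrow> 'b::euclidean_space set
     \<Rightarrow> ('c \<Rightarrow> 'a \<Rightarrow> 'b \<Rightarrow> real) \<Rightarrow> ('c \<Rightarrow> 'a \<Rightarrow> 'b \<Rightarrow> 'a) \<Rightarrow> ('c \<Rightarrow> 'a \<Rightarrow> 'b \<Rightarrow> 'b)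
     \<Rightarrow> real \<Rightarrow> real \<Rightarrow> real \<Rightarrow> real \<Rightarrow> real \<Rightarrow> real \<Rightarrow> real
     \<Rightarrow> (nat \<Rightarrow> real) \<Rightarrow> (nat \<Rightarrow> real) \<Rightarrow> real \<Rightarrow> real \<Rightarrow> nat
     \<Rightarrow> (nat \<Rightarrow> 'w \<Rightarrow> 'a) \<Rightarrow> (nat \<Rightarrow> 'w \<Rightarrow> 'b) \<Rightarrow> bool" where
  "boost_saa_c M F \<xi> X Y \<Phi> Gx Gy \<mu>x \<mu>y Lx Ly Lxy Kx Ky lamx lamy \<delta> p T xc yc \<longleftrightarrow>
     (let m = boost_reps p T;
          nx = (\<lambda>i. nat \<lceil>54 / \<delta> * (Kx\<^sup>2 / (\<mu>x + prev 0 lamx i) + Ky\<^sup>2 / \<mu>y)\<rceil>);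
          ny = (\<lambda>i. nat \<lceil>54 / \<delta> * (Kx\<^sup>2 / \<mu>x + Ky\<^sup>2 / (\<mu>y + prev 0 lamy i))\<rceil>);
          Mx = gap_const Lx Lxy \<mu>x \<mu>y (lamx T);
          My = gap_const Ly Lxy \<mu>y \<mu>x (lamy T);
          s = (\<lambda>r b \<omega> j k. \<xi> r (b, j, k) \<omega>)
      in
        (\<forall>i\<le>T. xc i \<in> F (Suc i) \<rightarrow>\<^sub>M restrict_space borel X \<and>
           (AE \<omega> in M. xc i \<omega> \<in> fst `
              robust_saa X Y \<Phi> (nx i) m (prev 0 lamx i) 0 (prev 0 (\<lambda>k. xc k \<omega>) i) 0 (s i True \<omega>))) \<and>
        (\<forall>i\<le>T. yc i \<in> F (Suc i) \<rightarrow>\<^sub>M restrict_space borel Y \<and>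
           (AE \<omega> in M. yc i \<omega> \<in> snd `
              robust_saa X Y \<Phi> (ny i) m 0 (prev 0 lamy i) 0 (prev 0 (\<lambda>k. yc k \<omega>) i) (s i False \<omega>))) \<and>
        xc (T + 1) \<in> M \<rightarrow>\<^sub>M restrict_space borel X \<and>
        (\<exists>xG \<in> F (T + 2) \<rightarrow>\<^sub>M restrict_space borel X. \<exists>yG \<in> F (T + 2) \<rightarrow>\<^sub>M restrict_space borel Y.
           AE \<omega> in M. xc (T + 1) \<omega> \<in>
              function_gap_x X Y \<Phi> Gx \<mu>x \<mu>y Lx Kx Ky (lamx T) (xc T \<omega>) (\<delta> / Mx) m
                (s (T + 1) True \<omega>) (s (T + 2) True \<omega>) (xG \<omega>) (yG \<omega>)) \<and>
        yc (T + 1) \<in> M \<rightarrow>\<^sub>M restrict_space borel Y \<and>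
        (\<exists>xG \<in> F (T + 2) \<rightarrow>\<^sub>M restrict_space borel X. \<exists>yG \<in> F (T + 2) \<rightarrow>\<^sub>M restrict_space borel Y.
           AE \<omega> in M. yc (T + 1) \<omega> \<in>
              function_gap_y X Y \<Phi> Gy \<mu>x \<mu>y Ly Kx Ky (lamy T) (yc T \<omega>) (\<delta> / My) m
                (s (T + 1) False \<omega>) (s (T + 2) False \<omega>) (xG \<omega>) (yG \<omega>)))"

end

theory Submission
  imports Defs
begin

text \<open>The two players are treated separately, the \<open>y\<close>-side by exchanging them and negating the
  objective. Replacing one of \<open>n\<close> samples moves an empirical saddle point by \<open>O(1 / n)\<close>, so its
  expected gap \<open>\<Phi>(x, v) - \<Phi>(u, y)\<close> against the true regularised saddle point \<open>(u, v)\<close> is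
  \<open>O(1 / n)\<close> too. By Markov's inequality one call is good with probability \<open>2/3\<close>, by Hoeffding's a
  majority of \<open>m\<close> calls is good except with probability \<open>exp (- m / 18)\<close>, and Extract then returns a
  point within three times the radius of the good ones. Since centres and intermediate points are
  independent of the fresh samples, these bounds hold conditionally on them by Fubini's theorem;
  this needs the saddle points to be measurable in centre and samples jointly.

  On the good event, let \<open>V\<^sub>i\<close> be the saddle value of the objective with the \<open>i\<close>-th proximal term and
  \<open>u\<^sub>i\<close> its \<open>x\<close>-component. Comparing consecutive objectives at \<open>u\<^sub>i\<close> gives
  \<open>V\<^sub>i\<^sub>+\<^sub>1 \<le> V\<^sub>i + \<lambda>\<^sup>i / 2 \<parallel>u\<^sub>i - x\<^sub>i\<parallel>\<^sup>2\<close>. As \<open>\<lambda>\<^sup>i\<close> only doubles, each increment is at most \<open>2 \<delta>\<close>, and the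
  function-gap selection of the last round loses another \<open>\<delta>\<close>. Either side thus contributes
  \<open>2 \<delta> (T + 1)\<close> to the duality gap.\<close>

section \<open>Robust selection\<close>

text \<open>One call is compared only with the fixed saddle point (u, v), while the duality gap
  takes a maximum over all y. Selection by distance gives closeness to u, and turning closeness into
  a bound on values costs a condition number; the growing proximal weights make this cost (L + lam)
  / (\<mu> + lam) instead of L / \<mu> by the time it is paid. The constants form one chain. If the
  expected gap of a call is at most e, then 3 * e is the Markov threshold, so (\<mu> + lam) / 2
  times the squared distance to u is at most 3 * e for a good call. Extract triples the distance,
  which gives 27 * e. Hence e = \<delta> / 27, and the bound 2 / n * C on the expected gap, where C
  is \<open>Kx\<^sup>2 / (\<mu> + lam) + Ky\<^sup>2 / \<nu>\<close>, leads to the factor 54 in the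
  sample sizes. A side uses T + 3 batches, each failing with probability at most p / (2 * T + 6), so
  it fails with probability at most p / 2; the two sides are joined by a union bound.\<close>

lemma sort_nth_le_if_card:
  fixes f :: "nat \<Rightarrow> real"
  assumes "i < card {j. j < m \<and> f j \<le> t}"
  shows "sort (map f [0..<m]) ! i \<le> t"
proof (rule ccontr)
  let ?xs = "sort (map f [0..<m])"
  assume gt: "\<not> ?xs ! i \<le> t"
  \<comment> \<open>Sorting preserves the number of entries at most t. If entry i exceeded t, all of
    these would sit at positions below i, so there would be at most i of them.\<close>
  have "card {j. j < m \<and> f j \<le> t} = length (filter (\<lambda>x. x \<le> t) (map f [0..<m]))"
    by (simp add: length_filter_conv_card cong: conj_cong)
  also have "\<dots> = length (filter (\<lambda>x. x \<le> t) ?xs)"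
    by (metis filter_sort length_sort)
  also have "\<dots> = card {j. j < m \<and> ?xs ! j \<le> t}"
    by (simp add: length_filter_conv_card)
  also have "\<dots> \<le> card {..<i}"
  proof (rule card_mono)
    show "{j. j < m \<and> ?xs ! j \<le> t} \<subseteq> {..<i}"
    proof safe
      fix j assume j: "j < m" "?xs ! j \<le> t"
      show "j < i"
      proof (rule ccontr)
        assume "\<not> j < i"
        then have "?xs ! i \<le> ?xs ! j"
          using j by (intro sorted_nth_mono) auto
        with j gt show False by simp
      qed
    qed
  qed simp
  finally show False using assms by simp
qed

text \<open>A \<open>LEAST\<close> over the reals need not exist. Here it does: the counted ball
  changes only when r passes one of the finitely many values \<rho> (z j) (z k), so the admissible
  radii, once there is one, have a minimum among these values and 0. The radius t witnesses that
  there is one.\<close>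

lemma extract_radius_props:
  fixes m :: nat and \<rho> :: "'z \<Rightarrow> 'z \<Rightarrow> real"
  assumes "0 \<le> t" "real (card {k. k < m \<and> \<rho> (z j) (z k) \<le> t}) > real m / 2"
  shows extract_radius_le: "extract_radius m \<rho> z j \<le> t"
    and extract_radius_card:
      "real (card {k. k < m \<and> \<rho> (z j) (z k) \<le> extract_radius m \<rho> z j}) > real m / 2"
proof -
  define Q where "Q r \<longleftrightarrow> 0 \<le> r \<and> real (card {k. k < m \<and> \<rho> (z j) (z k) \<le> r}) > real m / 2" for r
  define V where "V = insert 0 ((\<lambda>k. \<rho> (z j) (z k)) ` {..<m})"
  have finV: "finite V" by (simp add: V_def)
  \<comment> \<open>Lowering r to the largest candidate value below it changes neither the ball nor
    the sign condition.\<close>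
  have round: "\<exists>v\<in>V. v \<le> r \<and> Q v" if "Q r" for r
  proof -
    define v where "v = Max {v\<in>V. v \<le> r}"
    have ne: "{v\<in>V. v \<le> r} \<noteq> {}" using that by (auto simp: V_def Q_def)
    then have v: "v \<in> V" "v \<le> r" using Max_in[of "{v\<in>V. v \<le> r}"] finV by (auto simp: v_def)
    have le_v: "w \<le> v" if "w \<in> V" "w \<le> r" for w
      using that finV by (auto simp: v_def)
    have "0 \<le> v" using le_v[of 0] that by (auto simp: V_def Q_def)
    moreover have "{k. k < m \<and> \<rho> (z j) (z k) \<le> v} = {k. k < m \<and> \<rho> (z j) (z k) \<le> r}"
      using v le_v by (force simp: V_def)
    ultimately have "Q v" using that by (simp add: Q_def)
    with v show ?thesis by blast
  qed
  have "Q t" using assms by (simp add: Q_def)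
  define v where "v = Min {v\<in>V. Q v}"
  have ne: "{v\<in>V. Q v} \<noteq> {}" using round[OF \<open>Q t\<close>] by auto
  then have Qv: "Q v" using Min_in[of "{v\<in>V. Q v}"] finV by (auto simp: v_def)
  have least: "v \<le> r" if r: "Q r" for r
  proof -
    obtain w where "w \<in> V" "w \<le> r" "Q w" using round[OF r] by blast
    then have "v \<le> w" using finV by (auto simp: v_def)
    with \<open>w \<le> r\<close> show ?thesis by simp
  qed
  have eq: "extract_radius m \<rho> z j = v"
    unfolding extract_radius_def using Qv least unfolding Q_def by (intro Least_equality) auto
  show "extract_radius m \<rho> z j \<le> t"
    "real (card {k. k < m \<and> \<rho> (z j) (z k) \<le> extract_radius m \<rho> z j}) > real m / 2"
    using least[OF \<open>Q t\<close>] Qv unfolding eq by (auto simp: Q_def)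
qed

lemma majorities_intersect:
  assumes "real (card {k. k < m \<and> A k}) > real m / 2" "real (card {k. k < m \<and> B k}) > real m / 2"
  shows "\<exists>k<m. A k \<and> B k"
proof (rule ccontr)
  assume "\<not> ?thesis"
  then have "card ({k. k < m \<and> A k} \<union> {k. k < m \<and> B k})
      = card {k. k < m \<and> A k} + card {k. k < m \<and> B k}"
    by (intro card_Un_disjoint) auto
  moreover have "card ({k. k < m \<and> A k} \<union> {k. k < m \<and> B k}) \<le> card {..<m}"
    by (intro card_mono) auto
  ultimately show False using assms by simp
qed

text \<open>Two good indices are at distance at most \<open>2 r\<close>, so a majority of the radii is at most
  \<open>2 r\<close>; the ball of an extracted index then contains a good index.\<close>

lemma extract_idx_close:
  fixes d :: "nat \<Rightarrow> real"
  assumes k: "k \<in> extract_idx m \<rho> z"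
    and tri: "\<And>i j. \<rho> (z i) (z j) \<le> d i + d j" "\<And>i j. d i \<le> \<rho> (z i) (z j) + d j"
    and good: "real (card {j. j < m \<and> d j \<le> r}) > real m / 2"
  shows "d k \<le> 3 * r"
proof -
  have dpos: "0 \<le> d j" for j using tri(1)[of j j] tri(2)[of j j] by simp
  obtain j0 where j0: "d j0 \<le> r"
    using majorities_intersect[OF good good] by auto
  have rpos: "0 \<le> 2 * r" using dpos[of j0] j0 by simp
  let ?R = "extract_radius m \<rho> z"
  have maj: "real (card {l. l < m \<and> \<rho> (z j) (z l) \<le> 2 * r}) > real m / 2" if "d j \<le> r" for j
  proof -
    have "card {l. l < m \<and> d l \<le> r} \<le> card {l. l < m \<and> \<rho> (z j) (z l) \<le> 2 * r}"
      using tri(1)[of j] that by (intro card_mono) (auto, smt (verit))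
    with good show ?thesis by linarith
  qed
  have "card {j. j < m \<and> d j \<le> r} \<le> card {j. j < m \<and> ?R j \<le> 2 * r}"
    using extract_radius_le[where \<rho>=\<rho> and z=z, OF rpos maj] by (intro card_mono) auto
  then have "real (card {j. j < m \<and> ?R j \<le> 2 * r}) > real m / 2"
    using good by linarith
  \<comment> \<open>Positions count from 0, so this is the index of the median radius used by
    Extract; a strict majority of small radii reaches it.\<close>
  then have "nat \<lceil>real m / 2\<rceil> - 1 < card {j. j < m \<and> ?R j \<le> 2 * r}"
    by linarith
  then have "sort (map ?R [0..<m]) ! (nat \<lceil>real m / 2\<rceil> - 1) \<le> 2 * r"
    by (rule sort_nth_le_if_card)
  with k have Rk: "?R k \<le> 2 * r" and "k < m"
    by (auto simp: extract_idx_def Let_def)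
  \<comment> \<open>The index k need not be good, so 2 * r is not known to be an admissible radius
    for it. D is some admissible radius, which is what gives the \<open>LEAST\<close> in
    \<open>extract_radius\<close> its meaning at k.\<close>
  define D where "D = (\<Sum>l<m. \<bar>\<rho> (z k) (z l)\<bar>)"
  have "\<rho> (z k) (z l) \<le> D" if "l < m" for l
    using member_le_sum[of l "{..<m}" "\<lambda>l. \<bar>\<rho> (z k) (z l)\<bar>"] that by (auto simp: D_def)
  then have "{l. l < m \<and> \<rho> (z k) (z l) \<le> D} = {..<m}" by auto
  then have "real (card {l. l < m \<and> \<rho> (z k) (z l) \<le> D}) > real m / 2"
    using \<open>k < m\<close> by simp
  moreover have "0 \<le> D" by (simp add: D_def sum_nonneg)
  ultimately have "real (card {l. l < m \<and> \<rho> (z k) (z l) \<le> ?R k}) > real m / 2"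
    by (rule extract_radius_card[rotated])
  from majorities_intersect[OF this good] obtain l where "\<rho> (z k) (z l) \<le> ?R k" "d l \<le> r" by blast
  with Rk tri(2)[of k l] show ?thesis by linarith
qed

lemma extract_idx_dist:
  fixes z :: "nat \<Rightarrow> 'z::metric_space"
  assumes "k \<in> extract_idx m dist z" "real (card {j. j < m \<and> dist (z j) w \<le> r}) > real m / 2"
  shows "dist (z k) w \<le> 3 * r"
  by (rule extract_idx_close[OF assms(1) _ _ assms(2)]) (metis dist_triangle2, metis dist_triangle)

text \<open>The distance to w becomes the seminorm \<bar>v \<bullet> (z - w)\<bar>, which may vanish
  between distinct points; \<open>extract_idx_close\<close> asks only for the two triangle
  inequalities.\<close>

lemma extract_idx_functional:
  fixes z :: "nat \<Rightarrow> 'z::real_inner"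
  assumes "k \<in> extract_idx m (\<lambda>x1 x2. \<bar>v \<bullet> (x1 - x2)\<bar>) z"
    and "real (card {j. j < m \<and> \<bar>v \<bullet> (z j - w)\<bar> \<le> r}) > real m / 2"
  shows "\<bar>v \<bullet> (z k - w)\<bar> \<le> 3 * r"
  by (rule extract_idx_close[OF assms(1) _ _ assms(2)]) (auto simp: inner_diff_right)

lemma extract_idx_less: "k \<in> extract_idx m \<rho> z \<Longrightarrow> k < m"
  by (simp add: extract_idx_def Let_def)

section \<open>Saddle points of strongly convex-concave functions\<close>

text \<open>The squared norm at t a + (1 - t) b is t times that of a plus 1 - t times that of b
  minus t (1 - t) times that of a - b. The added quadratic therefore meets the definition with
  equality, and the moduli add up.\<close>

lemma strongly_convex_on_add_norm_sq:
  fixes f :: "'a::real_inner \<Rightarrow> real"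
  assumes "strongly_convex_on \<mu> S f"
  shows "strongly_convex_on (\<mu> + l) S (\<lambda>x. f x + l / 2 * (norm (x - c))\<^sup>2)"
  unfolding strongly_convex_on_def
proof (intro ballI)
  fix u v and t :: real assume uv: "u \<in> S" "v \<in> S" "t \<in> {0..1}"
  have eq: "t *\<^sub>R u + (1 - t) *\<^sub>R v - c = t *\<^sub>R (u - c) + (1 - t) *\<^sub>R (v - c)"
    by (simp add: algebra_simps)
  have n: "(norm (t *\<^sub>R u + (1 - t) *\<^sub>R v - c))\<^sup>2
      = t * (norm (u - c))\<^sup>2 + (1 - t) * (norm (v - c))\<^sup>2 - t * (1 - t) * (norm ((u - c) - (v - c)))\<^sup>2"
    unfolding eq power2_norm_eq_inner
    by (simp add: inner_add_left inner_add_right inner_diff_left inner_diff_right inner_commute algebra_simps)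
  have "f (t *\<^sub>R u + (1 - t) *\<^sub>R v)
          \<le> t * f u + (1 - t) * f v - \<mu> / 2 * t * (1 - t) * (norm (u - v))\<^sup>2"
    using assms uv by (auto simp: strongly_convex_on_def)
  then show "f (t *\<^sub>R u + (1 - t) *\<^sub>R v) + l / 2 * (norm (t *\<^sub>R u + (1 - t) *\<^sub>R v - c))\<^sup>2
       \<le> t * (f u + l / 2 * (norm (u - c))\<^sup>2) + (1 - t) * (f v + l / 2 * (norm (v - c))\<^sup>2)
          - (\<mu> + l) / 2 * t * (1 - t) * (norm (u - v))\<^sup>2"
    unfolding n by (simp add: field_simps)
qed

text \<open>No derivative of f is available. Minimality of u along the segment towards v, divided by
  t, gives the bound with an extra factor 1 - t, which disappears as t tends to 0.\<close>

lemma strongly_convex_on_minimum_growth: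
  fixes f :: "'a::real_normed_vector \<Rightarrow> real"
  assumes sc: "strongly_convex_on \<mu> S f" and S: "convex S" "u \<in> S" "v \<in> S"
    and min: "\<And>w. w \<in> S \<Longrightarrow> f u \<le> f w"
  shows "\<mu> / 2 * (norm (v - u))\<^sup>2 \<le> f v - f u"
proof -
  have *: "\<mu> / 2 * (1 - t) * (norm (v - u))\<^sup>2 \<le> f v - f u" if t: "0 < t" "t \<le> 1" for t
  proof -
    have "f u \<le> f (t *\<^sub>R v + (1 - t) *\<^sub>R u)"
      using S t by (intro min convexD) auto
    also have "\<dots> \<le> t * f v + (1 - t) * f u - \<mu> / 2 * t * (1 - t) * (norm (v - u))\<^sup>2"
      using sc S t by (auto simp: strongly_convex_on_def)
    finally have "t * (\<mu> / 2 * (1 - t) * (norm (v - u))\<^sup>2) \<le> t * (f v - f u)"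
      by (simp add: algebra_simps)
    with t show ?thesis by simp
  qed
  have "((\<lambda>t. \<mu> / 2 * (1 - t) * (norm (v - u))\<^sup>2) \<longlongrightarrow> \<mu> / 2 * (1 - 0) * (norm (v - u))\<^sup>2) (at_right 0)"
    by (intro tendsto_intros)
  moreover have "\<forall>\<^sub>F t in at_right 0. \<mu> / 2 * (1 - t) * (norm (v - u))\<^sup>2 \<le> f v - f u"
    using * eventually_at_right_less[of 0]
    by (auto simp: eventually_at_right_field intro!: exI[of _ 1])
  ultimately show ?thesis
    using tendsto_upperbound[of _ _ "at_right (0::real)"] by fastforce
qed

text \<open>The Lipschitz constants are only asserted to exist: here they serve continuity and
  measurability, so that they need not be tracked when a proximal term is added. The constants that
  enter the rates belong to the sampled objective.\<close>

locale sc_sc =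
  fixes X :: "'a::euclidean_space set" and Y :: "'b::euclidean_space set"
    and \<mu> \<nu> :: real and f :: "'a \<Rightarrow> 'b \<Rightarrow> real"
  assumes X: "compact X" "convex X" "X \<noteq> {}" and Y: "compact Y" "convex Y" "Y \<noteq> {}"
    and pos: "\<mu> > 0" "\<nu> > 0"
    and sc_x: "\<And>y. y \<in> Y \<Longrightarrow> strongly_convex_on \<mu> X (\<lambda>x. f x y)"
    and sc_y: "\<And>x. x \<in> X \<Longrightarrow> strongly_concave_on \<nu> Y (f x)"
    and lip_x: "\<exists>K. \<forall>y\<in>Y. K-lipschitz_on X (\<lambda>x. f x y)"
    and lip_y: "\<exists>K. \<forall>x\<in>X. K-lipschitz_on Y (f x)"
begin

lemma swap: "sc_sc Y X \<nu> \<mu> (\<lambda>y x. - f x y)"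
  by unfold_locales
    (use X Y pos sc_x sc_y lip_x lip_y in
      \<open>auto simp: strongly_concave_on_def lipschitz_on_def dist_minus dist_commute\<close>)

lemma saddle_growth_x:
  assumes "saddle_point X Y f u v" "x \<in> X"
  shows "\<mu> / 2 * (norm (x - u))\<^sup>2 \<le> f x v - f u v"
  using assms by (intro strongly_convex_on_minimum_growth[OF sc_x X(2)]) (auto simp: saddle_point_def)

lemma saddle_growth_y:
  assumes "saddle_point X Y f u v" "y \<in> Y"
  shows "\<nu> / 2 * (norm (y - v))\<^sup>2 \<le> f u v - f u y"
  using strongly_convex_on_minimum_growth[OF sc_y[unfolded strongly_concave_on_def] Y(2), of u v y] assms
  by (auto simp: saddle_point_def)

lemma saddle_growth:
  assumes "saddle_point X Y f u v" "x \<in> X" "y \<in> Y"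
  shows "\<mu> / 2 * (norm (x - u))\<^sup>2 + \<nu> / 2 * (norm (y - v))\<^sup>2 \<le> f x v - f u y"
  using saddle_growth_x[OF assms(1,2)] saddle_growth_y[OF assms(1,3)] by linarith

lemma saddle_unique:
  assumes "saddle_point X Y f u v" "saddle_point X Y f u' v'"
  shows "u' = u" "v' = v"
proof -
  have "f u' v - f u v' \<le> 0"
    using assms(2,1) by (auto simp: saddle_point_def intro: order_trans)
  moreover have "\<mu> / 2 * (norm (u' - u))\<^sup>2 + \<nu> / 2 * (norm (v' - v))\<^sup>2 \<le> f u' v - f u v'"
    using assms by (intro saddle_growth) (auto simp: saddle_point_def)
  moreover have "0 \<le> \<mu> / 2 * (norm (u' - u))\<^sup>2" "0 \<le> \<nu> / 2 * (norm (v' - v))\<^sup>2" using pos by auto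
  ultimately have "\<mu> / 2 * (norm (u' - u))\<^sup>2 = 0" "\<nu> / 2 * (norm (v' - v))\<^sup>2 = 0" by linarith+
  then show "u' = u" "v' = v" using pos by auto
qed

text \<open>The minimiser g y is Hoelder continuous with exponent 1/2. Quadratic growth at g y'
  bounds the squared displacement by a difference of values; adding the nonnegative gap left by
  optimality of g y turns this into two differences in y alone, each at most K times the distance of
  y and y'.\<close>

lemma continuous_best_response:
  "\<exists>g. continuous_on Y g \<and> g \<in> Y \<rightarrow> X \<and> (\<forall>y\<in>Y. \<forall>x\<in>X. f (g y) y \<le> f x y)"
proof -
  obtain K where K: "\<And>x. x \<in> X \<Longrightarrow> K-lipschitz_on Y (f x)" using lip_y by blast
  have "\<exists>u\<in>X. \<forall>x\<in>X. f u y \<le> f x y" if "y \<in> Y" for y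
    using continuous_attains_inf[OF X(1,3), of "\<lambda>x. f x y"] lip_x that
    by (auto intro: lipschitz_on_continuous_on)
  then obtain g where g: "\<And>y. y \<in> Y \<Longrightarrow> g y \<in> X" "\<And>y x. y \<in> Y \<Longrightarrow> x \<in> X \<Longrightarrow> f (g y) y \<le> f x y"
    by metis
  have K0: "K \<ge> 0" using K X by (auto simp: lipschitz_on_def)
  have holder: "norm (g y - g y') \<le> sqrt (4 * K / \<mu> * norm (y - y'))" if y: "y \<in> Y" "y' \<in> Y" for y y'
  proof (rule real_le_rsqrt)
    have "\<mu> / 2 * (norm (g y - g y'))\<^sup>2 \<le> f (g y) y' - f (g y') y'"
      using y g by (intro strongly_convex_on_minimum_growth[OF sc_x X(2)]) auto
    also have "\<dots> \<le> (f (g y) y' - f (g y) y) + (f (g y') y - f (g y') y')"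
      using g y by simp
    also have "\<dots> \<le> K * norm (y - y') + K * norm (y - y')"
      using lipschitz_onD[OF K[OF g(1)[OF y(1)]] y(1,2)] lipschitz_onD[OF K[OF g(1)[OF y(2)]] y(1,2)]
      by (simp add: dist_norm)
    finally show "(norm (g y - g y'))\<^sup>2 \<le> 4 * K / \<mu> * norm (y - y')"
      using pos by (simp add: field_simps)
  qed
  have "continuous_on Y g"
    unfolding continuous_on_def
  proof
    fix y assume y: "y \<in> Y"
    have "((\<lambda>y'. sqrt (4 * K / \<mu> * norm (y' - y))) \<longlongrightarrow> sqrt (4 * K / \<mu> * norm (y - y))) (at y within Y)"
      by (intro tendsto_intros)
    then have "((\<lambda>y'. sqrt (4 * K / \<mu> * norm (y' - y))) \<longlongrightarrow> 0) (at y within Y)" by simp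
    then have "((\<lambda>y'. norm (g y' - g y)) \<longlongrightarrow> 0) (at y within Y)"
      by (rule tendsto_0_le[where K=1]) (use holder y in \<open>auto simp: eventually_at_filter intro!: always_eventually order_trans[OF _ abs_ge_self]\<close>)
    then show "(g \<longlongrightarrow> g y) (at y within Y)"
      using Lim_null tendsto_norm_zero_iff by blast
  qed
  with g show ?thesis by auto
qed

text \<open>Brouwer's theorem applies to (x, y) \<mapsto> (g y, h x) on the compact convex set X
  \<times> Y, where g and h are the continuous best responses. A fixed point is a pair of mutual
  best responses.\<close>

lemma saddle_exists: "\<exists>u v. saddle_point X Y f u v"
proof -
  interpret S: sc_sc Y X \<nu> \<mu> "\<lambda>y x. - f x y" by (rule swap)
  obtain g where g: "continuous_on Y g" "g \<in> Y \<rightarrow> X" "\<And>x y. x \<in> X \<Longrightarrow> y \<in> Y \<Longrightarrow> f (g y) y \<le> f x y"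
    using continuous_best_response by blast
  obtain h where h: "continuous_on X h" "h \<in> X \<rightarrow> Y" "\<And>x y. x \<in> X \<Longrightarrow> y \<in> Y \<Longrightarrow> f x y \<le> f x (h x)"
    using S.continuous_best_response by auto
  have "continuous_on (X \<times> Y) (\<lambda>p. (g (snd p), h (fst p)))"
    by (intro continuous_intros continuous_on_compose2[OF g(1)] continuous_on_compose2[OF h(1)]) auto
  then obtain p where p: "p \<in> X \<times> Y" "(g (snd p), h (fst p)) = p"
    by (rule brouwer[rotated 3, where S="X \<times> Y"])
      (use X Y g h in \<open>auto intro!: compact_Times convex_Times\<close>)
  obtain u v where "p = (u, v)" by (cases p)
  with p g(3) h(3) have "saddle_point X Y f u v" by (force simp: saddle_point_def)
  then show ?thesis by blast
qed

definition saddle :: "'a \<times> 'b" where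
  "saddle = (SOME p. saddle_point X Y f (fst p) (snd p))"

lemma saddle: "saddle_point X Y f (fst saddle) (snd saddle)"
proof -
  obtain u v where "saddle_point X Y f u v" using saddle_exists by blast
  then show ?thesis
    unfolding saddle_def by (intro someI[of "\<lambda>p. saddle_point X Y f (fst p) (snd p)" "(u, v)"]) simp
qed

lemma saddle_eqI: "saddle_point X Y f u v \<Longrightarrow> saddle = (u, v)"
  using saddle_unique[OF _ saddle] by (simp add: prod_eq_iff)

end

section \<open>Measurability of saddle points\<close>

lemma borel_measurableI_closed:
  assumes "\<And>C. closed C \<Longrightarrow> {w \<in> space N. u w \<in> C} \<in> sets N"
  shows "u \<in> borel_measurable N"
  unfolding borel_eq_closed
  by (rule measurable_measure_of) (use assms in \<open>auto simp: vimage_def Int_def conj_commute\<close>)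

lemma lipschitz_on_closure_le:
  fixes g :: "'a::metric_space \<Rightarrow> real"
  assumes "K-lipschitz_on S g" "D \<subseteq> S" "S \<subseteq> closure D" "x \<in> S" "\<And>d. d \<in> D \<Longrightarrow> g d \<le> c"
  shows "g x \<le> c"
proof (rule field_le_epsilon)
  fix e :: real assume e: "0 < e"
  have K: "K \<ge> 0" using assms(1) by (auto simp: lipschitz_on_def)
  have "x \<in> closure D" using assms by auto
  then obtain d where d: "d \<in> D" "dist d x < e / (K + 1)"
    using K e unfolding closure_approachable by (meson divide_pos_pos add_nonneg_pos zero_less_one)
  have "dist (g x) (g d) \<le> K * dist x d"
    using assms d by (auto intro: lipschitz_onD)
  also have "\<dots> \<le> (K + 1) * dist d x" by (auto simp: dist_commute algebra_simps)
  also have "\<dots> \<le> e" using d K by (simp add: field_simps)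
  finally show "g x \<le> c + e" using assms(5)[OF d(1)] by (auto simp: dist_real_def)
qed

text \<open>Membership of the saddle point in a closed set is expressed by a countable approximate
  saddle inequality, so measurability of \<open>f\<close> at fixed points is enough.\<close>

lemma measurable_saddle_point:
  fixes X :: "'a::euclidean_space set" and Y :: "'b::euclidean_space set"
  assumes sc: "\<And>w. w \<in> space N \<Longrightarrow> sc_sc X Y \<mu> \<nu> (f w)"
    and z_saddle: "\<And>w. w \<in> space N \<Longrightarrow> saddle_point X Y (f w) (fst (z w)) (snd (z w))"
    and meas: "\<And>x y. x \<in> X \<Longrightarrow> y \<in> Y \<Longrightarrow> (\<lambda>w. f w x y) \<in> borel_measurable N"
  shows "z \<in> borel_measurable N"
proof (rule borel_measurableI_closed)
  fix C :: "('a \<times> 'b) set" assume C: "closed C"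
  obtain DX where DX: "countable DX" "DX \<subseteq> X" "X \<subseteq> closure DX" using separable by blast
  obtain DY where DY: "countable DY" "DY \<subseteq> Y" "Y \<subseteq> closure DY" using separable by blast
  \<comment> \<open>D is dense in the part of C inside X \<times> Y itself: a dense subset of the
    whole product could miss C entirely.\<close>
  obtain D where D: "countable D" "D \<subseteq> C \<inter> X \<times> Y" "C \<inter> X \<times> Y \<subseteq> closure D" using separable by blast
  have DXY: "fst d \<in> X" "snd d \<in> Y" if "d \<in> D" for d using that D(2) by auto
  define Q where "Q w \<longleftrightarrow> (\<forall>k::nat. \<exists>d\<in>D. \<forall>x\<in>DX. \<forall>y\<in>DY. f w (fst d) y \<le> f w x (snd d) + 1 / Suc k)" for w
  have "z w \<in> C \<longleftrightarrow> Q w" if w: "w \<in> space N" for w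
  proof -
    interpret sc_sc X Y \<mu> \<nu> "f w" using sc w .
    note z = z_saddle[OF w]
    have zX: "fst (z w) \<in> X" "snd (z w) \<in> Y" using z by (auto simp: saddle_point_def)
    obtain K where K: "\<And>y. y \<in> Y \<Longrightarrow> K-lipschitz_on X (\<lambda>x. f w x y)" using lip_x by blast
    obtain K' where K': "\<And>x. x \<in> X \<Longrightarrow> K'-lipschitz_on Y (f w x)" using lip_y by blast
    have K0: "K \<ge> 0" "K' \<ge> 0" using K K' X Y by (auto simp: lipschitz_on_def)
    show ?thesis
    proof
      assume "z w \<in> C"
      show "Q w" unfolding Q_def
      proof
        fix k :: nat
        \<comment> \<open>With this tolerance, moving from the saddle point to d changes the two
          sides of the saddle inequality by at most 1 / Suc k in total.\<close>
        define e where "e = 1 / (real (Suc k) * (K + K' + 1))"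
        have e: "e > 0" using K0 by (auto simp: e_def)
        have "z w \<in> closure D" using \<open>z w \<in> C\<close> zX D by (auto simp: mem_Times_iff)
        then obtain d where d: "d \<in> D" "dist d (z w) < e"
          using e unfolding closure_approachable by blast
        have "f w (fst d) y \<le> f w x (snd d) + 1 / Suc k" if x: "x \<in> DX" and y: "y \<in> DY" for x y
        proof -
          have xy: "x \<in> X" "y \<in> Y" using x y DX DY by auto
          have "f w (fst d) y \<le> f w (fst (z w)) y + K * dist (fst d) (fst (z w))"
            using lipschitz_onD[OF K[OF xy(2)] DXY(1)[OF d(1)] zX(1)] by (auto simp: dist_real_def)
          also have "\<dots> \<le> f w (fst (z w)) (snd (z w)) + K * dist d (z w)"
            using z xy K0 dist_fst_le[of d "z w"]
            by (intro add_mono mult_left_mono) (auto simp: saddle_point_def)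
          finally have 1: "f w (fst d) y \<le> f w (fst (z w)) (snd (z w)) + K * dist d (z w)" .
          have "f w (fst (z w)) (snd (z w)) \<le> f w x (snd (z w))"
            using z xy by (auto simp: saddle_point_def)
          also have "\<dots> \<le> f w x (snd d) + K' * dist (snd d) (snd (z w))"
            using lipschitz_onD[OF K'[OF xy(1)] DXY(2)[OF d(1)] zX(2)] by (auto simp: dist_real_def)
          also have "\<dots> \<le> f w x (snd d) + K' * dist d (z w)"
            using K0 dist_snd_le[of d "z w"] by (intro add_mono mult_left_mono) auto
          finally have 2: "f w (fst (z w)) (snd (z w)) \<le> f w x (snd d) + K' * dist d (z w)" .
          have "K * dist d (z w) + K' * dist d (z w) \<le> (K + K' + 1) * e"
            unfolding distrib_right[symmetric] using d(2) K0 by (intro mult_mono) auto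
          also have "\<dots> = 1 / Suc k" using K0 by (simp add: e_def)
          finally show ?thesis using 1 2 by linarith
        qed
        with d show "\<exists>d\<in>D. \<forall>x\<in>DX. \<forall>y\<in>DY. f w (fst d) y \<le> f w x (snd d) + 1 / Suc k" by blast
      qed
    next
      assume "Q w"
      \<comment> \<open>By Lipschitz continuity the approximate inequalities extend from DX and DY
        to the components of z w. Growth at the saddle point then forces d towards z w, and
        closedness of C finishes.\<close>
      have "\<forall>k. \<exists>d. d \<in> D \<and> \<mu> / 2 * (norm (fst d - fst (z w)))\<^sup>2 + \<nu> / 2 * (norm (snd d - snd (z w)))\<^sup>2 \<le> 1 / real (Suc k)"
      proof
        fix k
        from \<open>Q w\<close> have "\<exists>d\<in>D. \<forall>x\<in>DX. \<forall>y\<in>DY. f w (fst d) y \<le> f w x (snd d) + 1 / Suc k"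
          unfolding Q_def by (rule spec)
        then obtain d where d: "d \<in> D" "\<And>x y. x \<in> DX \<Longrightarrow> y \<in> DY \<Longrightarrow> f w (fst d) y \<le> f w x (snd d) + 1 / Suc k"
          by blast
        have 1: "f w (fst d) (snd (z w)) \<le> f w x (snd d) + 1 / Suc k" if "x \<in> DX" for x
          using d(2)[OF that] by (rule lipschitz_on_closure_le[OF K'[OF DXY(1)[OF d(1)]] DY(2,3) zX(2)])
        have "- f w (fst (z w)) (snd d) \<le> 1 / Suc k - f w (fst d) (snd (z w))"
          by (rule lipschitz_on_closure_le[OF lipschitz_on_minus[OF K[OF DXY(2)[OF d(1)]]] DX(2,3) zX(1)])
            (use 1 in \<open>auto simp: algebra_simps\<close>)
        then have "\<mu> / 2 * (norm (fst d - fst (z w)))\<^sup>2 + \<nu> / 2 * (norm (snd d - snd (z w)))\<^sup>2 \<le> 1 / Suc k"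
          using saddle_growth[OF z DXY[OF d(1)]] by linarith
        with d(1) show "\<exists>d. d \<in> D \<and> \<mu> / 2 * (norm (fst d - fst (z w)))\<^sup>2
            + \<nu> / 2 * (norm (snd d - snd (z w)))\<^sup>2 \<le> 1 / real (Suc k)" by blast
      qed
      from choice[OF this] obtain d where d: "\<And>k::nat. d k \<in> D"
        "\<And>k. \<mu> / 2 * (norm (fst (d k) - fst (z w)))\<^sup>2 + \<nu> / 2 * (norm (snd (d k) - snd (z w)))\<^sup>2 \<le> 1 / real (Suc k)"
        by auto
      define m where "m = min \<mu> \<nu> / 2"
      have m: "m > 0" using pos by (auto simp: m_def)
      have "(dist (d k) (z w))\<^sup>2 \<le> 1 / Suc k / m" for k
      proof -
        have "m * (dist (d k) (z w))\<^sup>2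
            = m * (norm (fst (d k) - fst (z w)))\<^sup>2 + m * (norm (snd (d k) - snd (z w)))\<^sup>2"
          unfolding dist_prod_def by (simp add: distrib_left dist_norm)
        also have "\<dots> \<le> \<mu> / 2 * (norm (fst (d k) - fst (z w)))\<^sup>2 + \<nu> / 2 * (norm (snd (d k) - snd (z w)))\<^sup>2"
          by (intro add_mono mult_right_mono) (auto simp: m_def)
        also note d(2)[of k]
        finally show ?thesis using m by (simp only: pos_le_divide_eq mult.commute)
      qed
      moreover have "(\<lambda>k. 1 / real (Suc k) / m) \<longlonglongrightarrow> 0 / m"
        using tendsto_divide[OF LIMSEQ_inverse_real_of_nat tendsto_const[of m]] m by (simp add: inverse_eq_divide)
      ultimately have "(\<lambda>k. (dist (d k) (z w))\<^sup>2) \<longlonglongrightarrow> 0"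
        using tendsto_sandwich[of "\<lambda>_. 0" "\<lambda>k. (dist (d k) (z w))\<^sup>2" sequentially "\<lambda>k. 1 / real (Suc k) / m" 0]
        by simp
      then have "(\<lambda>k. sqrt ((dist (d k) (z w))\<^sup>2)) \<longlonglongrightarrow> sqrt 0"
        by (rule tendsto_real_sqrt)
      then have "d \<longlonglongrightarrow> z w"
        by (subst tendsto_dist_iff) simp
      with d(1) D(2) show "z w \<in> C"
        by (intro closed_sequentially[OF C, of d "z w"]) auto
    qed
  qed
  then have "{w \<in> space N. z w \<in> C} = {w \<in> space N. Q w}" by auto
  also have "\<dots> \<in> sets N"
    unfolding Q_def using D(1) DX(1) DY(1)
  proof (intro sets.sets_Collect_countable_All sets.sets_Collect_countable_All' sets.sets_Collect_countable_Ex')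
    fix k :: nat and d x y assume "d \<in> D" "x \<in> DX" "y \<in> DY"
    then show "{w \<in> space N. f w (fst d) y \<le> f w x (snd d) + 1 / Suc k} \<in> sets N"
      by (intro borel_measurable_le borel_measurable_add borel_measurable_const
          meas[OF DXY(1)] meas[OF subsetD[OF DX(2)] DXY(2)] subsetD[OF DY(2)] meas[OF DXY(1) subsetD[OF DY(2)]])
  qed
  finally show "{w \<in> space N. z w \<in> C} \<in> sets N" .
qed

section \<open>Proximal terms\<close>

definition prox :: "('a::real_normed_vector \<Rightarrow> 'b \<Rightarrow> real) \<Rightarrow> real \<Rightarrow> 'a \<Rightarrow> 'a \<Rightarrow> 'b \<Rightarrow> real" where
  "prox f l c x y = f x y + l / 2 * (norm (x - c))\<^sup>2"

lemma strongly_convex_on_add_const: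
  assumes "strongly_convex_on \<mu> S f"
  shows "strongly_convex_on \<mu> S (\<lambda>x. f x + c)"
  unfolding strongly_convex_on_def
proof (intro ballI)
  fix u v and t :: real assume "u \<in> S" "v \<in> S" "t \<in> {0..1}"
  then have "f (t *\<^sub>R u + (1 - t) *\<^sub>R v)
      \<le> t * f u + (1 - t) * f v - \<mu> / 2 * t * (1 - t) * (norm (u - v))\<^sup>2"
    using assms by (auto simp: strongly_convex_on_def)
  then show "f (t *\<^sub>R u + (1 - t) *\<^sub>R v) + c
      \<le> t * (f u + c) + (1 - t) * (f v + c) - \<mu> / 2 * t * (1 - t) * (norm (u - v))\<^sup>2"
    by (simp add: algebra_simps)
qed

lemma (in sc_sc) prox:
  assumes "l \<ge> 0"
  shows "sc_sc X Y (\<mu> + l) \<nu> (prox f l c)"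
proof unfold_locales
  show "strongly_convex_on (\<mu> + l) X (\<lambda>x. prox f l c x y)" if "y \<in> Y" for y
    unfolding prox_def by (intro strongly_convex_on_add_norm_sq sc_x that)
  show "strongly_concave_on \<nu> Y (prox f l c x)" if "x \<in> X" for x
    using strongly_convex_on_add_const[OF sc_y[OF that, unfolded strongly_concave_on_def], of "- (l / 2 * (norm (x - c))\<^sup>2)"]
    by (simp add: strongly_concave_on_def prox_def)
  obtain K where K: "\<And>y. y \<in> Y \<Longrightarrow> K-lipschitz_on X (\<lambda>x. f x y)" using lip_x by blast
  have "bounded ((\<lambda>x. x - c) ` X)"
    using X(1) compact_imp_bounded by (intro compact_imp_bounded compact_continuous_image continuous_intros) auto
  then obtain R where R: "\<And>x. x \<in> X \<Longrightarrow> norm (x - c) \<le> R" unfolding bounded_iff by auto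
  have R0: "0 \<le> R" using R X(3) norm_ge_zero by (meson all_not_in_conv order_trans)
  have "(2 * R)-lipschitz_on X (\<lambda>x. (norm (x - c))\<^sup>2)"
  proof (rule lipschitz_onI)
    fix u v assume uv: "u \<in> X" "v \<in> X"
    have "dist ((norm (u - c))\<^sup>2) ((norm (v - c))\<^sup>2)
        = \<bar>norm (u - c) - norm (v - c)\<bar> * (norm (u - c) + norm (v - c))"
      by (simp add: dist_real_def power2_eq_square square_diff_square_factored abs_mult)
    also have "\<dots> \<le> norm (u - v) * (R + R)"
      using norm_triangle_ineq3[of "u - c" "v - c"] R uv by (intro mult_mono add_mono) auto
    finally show "dist ((norm (u - c))\<^sup>2) ((norm (v - c))\<^sup>2) \<le> 2 * R * dist u v"
      by (simp add: dist_norm mult_ac)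
  qed (use R0 in auto)
  then have "(K + \<bar>l / 2\<bar> * (2 * R))-lipschitz_on X (\<lambda>x. f x y + l / 2 * (norm (x - c))\<^sup>2)" if "y \<in> Y" for y
    by (intro lipschitz_on_add K that lipschitz_on_cmult_real)
  then show "\<exists>K. \<forall>y\<in>Y. K-lipschitz_on X (\<lambda>x. prox f l c x y)"
    unfolding prox_def by blast
  show "\<exists>K. \<forall>x\<in>X. K-lipschitz_on Y (prox f l c x)"
    using lip_y by (auto simp: prox_def lipschitz_on_def dist_real_def)
qed (use X Y pos assms in auto)

text \<open>The point u is tried in the new minimisation against v', and v' in the old maximisation
  against u. Passing from one objective to the other at (u, v') costs only the new proximal term at
  u, since the old one is nonnegative.\<close>

lemma prox_saddle_value_step:
  assumes "saddle_point X Y (prox f l c) u v" "saddle_point X Y (prox f l' c') u' v'" "0 \<le> l"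
  shows "prox f l' c' u' v' \<le> prox f l c u v + l' / 2 * (norm (u - c'))\<^sup>2"
proof -
  have "prox f l' c' u' v' \<le> prox f l' c' u v'"
    using assms by (auto simp: saddle_point_def)
  also have "\<dots> = f u v' + l' / 2 * (norm (u - c'))\<^sup>2" by (simp add: prox_def)
  also have "f u v' \<le> prox f l c u v'" using assms by (simp add: prox_def)
  also have "\<dots> \<le> prox f l c u v" using assms by (auto simp: saddle_point_def)
  finally show ?thesis by simp
qed

text \<open>The first step costs at most \<open>\<delta>\<close>, as \<open>lam 0 = \<mu>\<close>; every later one at most \<open>2 \<delta>\<close>, as
  \<open>lam i \<le> 2 (\<mu> + lam (i - 1))\<close>.\<close>

lemma prox_boost:
  assumes saddle: "\<And>i. i \<le> T + 1 \<Longrightarrow> saddle_point X Y (prox f (prev 0 lam i) (prev 0 c i)) (u i) (v i)"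
    and \<mu>: "\<mu> > 0" and \<delta>: "\<delta> \<ge> 0" and lam: "\<And>i. lam i = \<mu> * 2 ^ i"
    and close: "\<And>i. i \<le> T \<Longrightarrow> (\<mu> + prev 0 lam i) / 2 * (norm (c i - u i))\<^sup>2 \<le> \<delta>"
  shows "prox f (lam T) (c T) (u (T + 1)) (v (T + 1)) \<le> f (u 0) (v 0) + \<delta> * (1 + 2 * real T)"
proof -
  define V where "V i = prox f (prev 0 lam i) (prev 0 c i) (u i) (v i)" for i
  have lam0: "0 \<le> prev 0 lam i" for i using \<mu> by (auto simp: prev_def lam split: nat.split)
  have step: "V (Suc i) \<le> V i + (if i = 0 then \<delta> else 2 * \<delta>)" if i: "i \<le> T" for i
  proof -
    have V: "V (Suc i) \<le> V i + lam i / 2 * (norm (u i - c i))\<^sup>2"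
      using prox_saddle_value_step[OF saddle[of i] saddle[of "Suc i"] lam0] i
      by (simp add: V_def prev_def)
    have "lam i \<le> (if i = 0 then 1 else 2) * (\<mu> + prev 0 lam i)"
      using \<mu> by (cases i) (auto simp: lam prev_def)
    then have "lam i / 2 * (norm (u i - c i))\<^sup>2
        \<le> (if i = 0 then 1 else 2) * (\<mu> + prev 0 lam i) / 2 * (norm (u i - c i))\<^sup>2"
      by (intro mult_right_mono divide_right_mono) auto
    also have "\<dots> = (if i = 0 then 1 else 2) * ((\<mu> + prev 0 lam i) / 2 * (norm (c i - u i))\<^sup>2)"
      by (simp add: norm_minus_commute)
    also have "\<dots> \<le> (if i = 0 then 1 else 2) * \<delta>"
      using close[OF i] by (intro mult_left_mono) auto
    finally show ?thesis using V by (simp split: if_splits)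
  qed
  have "V (Suc i) \<le> V 0 + \<delta> * (1 + 2 * real i)" if "i \<le> T" for i
    using that
  proof (induction i)
    case (Suc i)
    then show ?case using step[of "Suc i"] by (auto simp: algebra_simps)
  qed (use step[of 0] in auto)
  from this[of T] show ?thesis by (simp add: V_def prev_def prox_def)
qed

section \<open>Gradients relative to a convex set\<close>

lemma has_gradient_within_segment:
  assumes "has_gradient_within f g (a + t *\<^sub>R (b - a)) S" "convex S" "a \<in> S" "b \<in> S"
  shows "((\<lambda>t. f (a + t *\<^sub>R (b - a))) has_real_derivative g \<bullet> (b - a)) (at t within {0..1})"
proof -
  have "(\<lambda>t. a + t *\<^sub>R (b - a)) ` {0..1} \<subseteq> S"
  proof safe
    fix s :: real assume "s \<in> {0..1}"
    then have "(1 - s) *\<^sub>R a + s *\<^sub>R b \<in> S" using assms by (intro convexD) auto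
    then show "a + s *\<^sub>R (b - a) \<in> S" by (simp add: algebra_simps)
  qed
  then have "(f has_derivative (\<lambda>h. g \<bullet> h))
      (at (a + t *\<^sub>R (b - a)) within (\<lambda>t. a + t *\<^sub>R (b - a)) ` {0..1})"
    using assms(1) unfolding has_gradient_within_def by (rule has_derivative_subset[rotated])
  then have "((\<lambda>t. f (a + t *\<^sub>R (b - a))) has_derivative (\<lambda>h. g \<bullet> (h *\<^sub>R (b - a)))) (at t within {0..1})"
    by (rule has_derivative_in_compose[rotated, of _ _ "\<lambda>t. a + t *\<^sub>R (b - a)"])
      (auto intro!: derivative_eq_intros)
  then show ?thesis
    by (simp add: has_field_derivative_def mult_commute_abs)
qed

text \<open>The point a may lie on the boundary of S, so only the right derivative at 0 along the
  segment is available; it inherits the bound from the difference quotients.\<close>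

lemma has_gradient_within_inner_le:
  assumes grad: "has_gradient_within f g a S" and S: "convex S" "a \<in> S" "b \<in> S"
    and le: "\<And>t. 0 < t \<Longrightarrow> t \<le> 1 \<Longrightarrow> f (a + t *\<^sub>R (b - a)) - f a \<le> t * c"
  shows "g \<bullet> (b - a) \<le> c"
proof -
  have "((\<lambda>t. f (a + t *\<^sub>R (b - a))) has_real_derivative g \<bullet> (b - a)) (at 0 within {0..1})"
    using has_gradient_within_segment[of f g a 0 b S] assms by simp
  then have "((\<lambda>t. (f (a + t *\<^sub>R (b - a)) - f a) / t) \<longlongrightarrow> g \<bullet> (b - a)) (at 0 within {0..1})"
    by (simp add: has_field_derivative_iff)
  moreover have "\<forall>\<^sub>F t in at 0 within {0..1}. (f (a + t *\<^sub>R (b - a)) - f a) / t \<le> c"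
    using le by (auto simp: eventually_at_filter divide_le_eq mult.commute intro!: always_eventually)
  moreover have "at (0::real) within {0..1} \<noteq> bot"
    by (simp add: at_within_Icc_at_right)
  ultimately show ?thesis by (rule tendsto_upperbound)
qed

lemma has_gradient_within_inner_ge:
  assumes grad: "has_gradient_within f g a S" and S: "convex S" "a \<in> S" "b \<in> S"
    and ge: "\<And>t. 0 < t \<Longrightarrow> t \<le> 1 \<Longrightarrow> t * c \<le> f (a + t *\<^sub>R (b - a)) - f a"
  shows "c \<le> g \<bullet> (b - a)"
proof -
  have "has_gradient_within (\<lambda>x. - f x) (- g) a S"
    using grad unfolding has_gradient_within_def inner_minus_left by (rule has_derivative_minus)
  from has_gradient_within_inner_le[OF this S, of "- c"] show ?thesis using ge by force
qed

text \<open>Subtracting the linear and quadratic terms along the segment leaves a function h whose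
  derivative is nonpositive, by Cauchy-Schwarz and the Lipschitz bound on g. Monotonicity of h
  replaces an integral of the gradient.\<close>

lemma descent_lemma:
  assumes grad: "\<And>x. x \<in> S \<Longrightarrow> has_gradient_within f (g x) x S"
    and S: "convex S" "a \<in> S" "b \<in> S"
    and lip: "\<And>x y. x \<in> S \<Longrightarrow> y \<in> S \<Longrightarrow> norm (g x - g y) \<le> L * norm (x - y)"
  shows "f b \<le> f a + g a \<bullet> (b - a) + L / 2 * (norm (b - a))\<^sup>2"
proof -
  let ?d = "b - a"
  have seg: "a + t *\<^sub>R ?d \<in> S" if "0 \<le> t" "t \<le> 1" for t
  proof -
    have "(1 - t) *\<^sub>R a + t *\<^sub>R b \<in> S" using S that by (intro convexD) auto
    then show ?thesis by (simp add: algebra_simps)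
  qed
  define h where "h t = f (a + t *\<^sub>R ?d) - (t * (g a \<bullet> ?d) + L / 2 * t\<^sup>2 * (norm ?d)\<^sup>2)" for t
  have h: "(h has_real_derivative (g (a + t *\<^sub>R ?d) \<bullet> ?d - (g a \<bullet> ?d + L * t * (norm ?d)\<^sup>2))) (at t within {0..1})"
    if "0 \<le> t" "t \<le> 1" for t
    unfolding h_def
    by (intro DERIV_diff has_gradient_within_segment[OF grad[OF seg[OF that]] S])
      (auto intro!: derivative_eq_intros)
  have "h 1 \<le> h 0"
  proof (rule DERIV_nonpos_imp_decreasing_open[of 0 1 h])
    show "continuous_on {0..1} h"
      using h by (intro DERIV_continuous_on) auto
  next
    fix t :: real assume t: "0 < t" "t < 1"
    have "(g (a + t *\<^sub>R ?d) - g a) \<bullet> ?d \<le> norm (g (a + t *\<^sub>R ?d) - g a) * norm ?d"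
      by (rule norm_cauchy_schwarz)
    also have "\<dots> \<le> L * norm (t *\<^sub>R ?d) * norm ?d"
      using lip[OF seg[of t] S(2)] t by (intro mult_right_mono) auto
    also have "\<dots> = L * t * (norm ?d)\<^sup>2" using t by (simp add: power2_eq_square)
    finally have "g (a + t *\<^sub>R ?d) \<bullet> ?d - (g a \<bullet> ?d + L * t * (norm ?d)\<^sup>2) \<le> 0"
      by (simp add: inner_diff_left)
    moreover have "at t within {0..1} = at t" using t by (intro at_within_interior) auto
    ultimately show "\<exists>y. (h has_real_derivative y) (at t) \<and> y \<le> 0"
      using h[of t] t by auto
  qed simp
  then show ?thesis by (simp add: h_def)
qed

lemma has_gradient_within_prox:
  assumes "has_gradient_within (\<lambda>x. f x y) g x S"
  shows "has_gradient_within (\<lambda>x. prox f l c x y) (g + l *\<^sub>R (x - c)) x S"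
proof -
  have "((\<lambda>x. f x y + l / 2 * ((x - c) \<bullet> (x - c))) has_derivative
      (\<lambda>h. g \<bullet> h + l / 2 * ((x - c) \<bullet> h + h \<bullet> (x - c)))) (at x within S)"
    using assms unfolding has_gradient_within_def by (auto intro!: derivative_eq_intros)
  moreover have "(\<lambda>h. g \<bullet> h + l / 2 * ((x - c) \<bullet> h + h \<bullet> (x - c))) = (\<lambda>h. (g + l *\<^sub>R (x - c)) \<bullet> h)"
    by (intro ext) (simp add: inner_add_left inner_commute[of _ "x - c"])
  ultimately show ?thesis
    by (simp add: has_gradient_within_def prox_def power2_norm_eq_inner)
qed

section \<open>Selection by function gap\<close>

context sc_sc begin

text \<open>The maximal value over \<open>Y\<close> is bounded without differentiating it: the quadratic decay of
  \<open>f u\<close> away from \<open>v\<close> absorbs the change of the \<open>x\<close>-gradient between \<open>v\<close> and \<open>y\<close>.\<close>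

lemma saddle_primal_smooth:
  assumes saddle: "saddle_point X Y f u v"
    and grad: "\<And>x y. x \<in> X \<Longrightarrow> y \<in> Y \<Longrightarrow> has_gradient_within (\<lambda>x. f x y) (g x y) x X"
    and lip: "\<And>x1 x2 y. x1 \<in> X \<Longrightarrow> x2 \<in> X \<Longrightarrow> y \<in> Y \<Longrightarrow> norm (g x1 y - g x2 y) \<le> L * norm (x1 - x2)"
    and lip': "\<And>x y1 y2. x \<in> X \<Longrightarrow> y1 \<in> Y \<Longrightarrow> y2 \<in> Y \<Longrightarrow> norm (g x y1 - g x y2) \<le> L' * norm (y1 - y2)"
    and xy: "x \<in> X" "y \<in> Y"
  shows "f x y \<le> f u v + g u v \<bullet> (x - u) + (L / 2 + L'\<^sup>2 / (2 * \<nu>)) * (norm (x - u))\<^sup>2"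
proof -
  have uv: "u \<in> X" "v \<in> Y" using saddle by (auto simp: saddle_point_def)
  define a b where "a = norm (x - u)" and "b = norm (y - v)"
  have "f x y \<le> f u y + g u y \<bullet> (x - u) + L / 2 * a\<^sup>2"
    unfolding a_def
    by (rule descent_lemma[where S=X and g="\<lambda>x. g x y", OF grad[OF _ xy(2)] X(2) uv(1) xy(1) lip[OF _ _ xy(2)]])
  moreover have "g u y \<bullet> (x - u) = g u v \<bullet> (x - u) + (g u y - g u v) \<bullet> (x - u)"
    by (simp add: inner_diff_left)
  moreover have "(g u y - g u v) \<bullet> (x - u) \<le> (L' * b) * a"
    unfolding a_def b_def using lip'[OF uv(1) xy(2) uv(2)]
    by (intro order_trans[OF norm_cauchy_schwarz] mult_right_mono) auto
  \<comment> \<open>Young's inequality, weighted so that its b-term is exactly the decay of f u away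
    from v in the next step.\<close>
  moreover have "(L' * b) * a \<le> \<nu> / 2 * b\<^sup>2 + L'\<^sup>2 / (2 * \<nu>) * a\<^sup>2"
  proof -
    have "0 \<le> (\<nu> * b - L' * a)\<^sup>2 / (2 * \<nu>)" using pos by simp
    also have "\<dots> = \<nu> / 2 * b\<^sup>2 + L'\<^sup>2 / (2 * \<nu>) * a\<^sup>2 - (L' * b) * a"
      using pos by (simp add: field_simps power2_eq_square)
    finally show ?thesis by simp
  qed
  moreover have "f u y \<le> f u v - \<nu> / 2 * b\<^sup>2"
    using saddle_growth_y[OF saddle xy(2)] by (simp add: b_def)
  ultimately show ?thesis unfolding a_def[symmetric] distrib_right by linarith
qed

lemma sqrt_radius:
  assumes "(\<kappa>::real) > 0" "\<kappa> / 2 * r\<^sup>2 \<le> e"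
  shows "r \<le> sqrt 2 * sqrt (e / \<kappa>)"
proof -
  have "r\<^sup>2 \<le> 2 * (e / \<kappa>)" using assms by (simp add: field_simps)
  then show ?thesis using real_le_rsqrt by (simp flip: real_sqrt_mult)
qed

text \<open>For a good index \<open>j\<close>, optimality of \<open>u\<close> and convexity give \<open>0 \<le> g u v \<bullet> (xh j - u) \<le> e\<close>, so the
  selection by the functional \<open>w \<approx> g u v\<close> controls the first-order term at the chosen point.\<close>

lemma function_gap_bound:
  assumes saddle: "saddle_point X Y f u v"
    and grad: "\<And>x y. x \<in> X \<Longrightarrow> y \<in> Y \<Longrightarrow> has_gradient_within (\<lambda>x. f x y) (g x y) x X"
    and lip: "\<And>x1 x2 y. x1 \<in> X \<Longrightarrow> x2 \<in> X \<Longrightarrow> y \<in> Y \<Longrightarrow> norm (g x1 y - g x2 y) \<le> L * norm (x1 - x2)"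
    and lip': "\<And>x y1 y2. x \<in> X \<Longrightarrow> y1 \<in> Y \<Longrightarrow> y2 \<in> Y \<Longrightarrow> norm (g x y1 - g x y2) \<le> L' * norm (y1 - y2)"
    and L: "L \<ge> 0" "L' \<ge> 0" and e: "e > 0"
    and xh: "\<And>j. j < m \<Longrightarrow> xh j \<in> X" and yh: "\<And>j. j < m \<Longrightarrow> yh j \<in> Y"
    and good: "real (card {j. j < m \<and> f (xh j) v - f u (yh j) \<le> e}) > real m / 2"
    and k1: "k1 \<in> extract_idx m dist xh" and k2: "k2 \<in> extract_idx m dist yh"
    and w: "dist w (g (xh k1) (yh k2)) \<le> 3 * (L * sqrt (e / \<mu>))"
    and k3: "k3 \<in> extract_idx m dist xh" "k3 \<in> extract_idx m (\<lambda>x1 x2. \<bar>w \<bullet> (x1 - x2)\<bar>) xh"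
    and y: "y \<in> Y"
  shows "f (xh k3) y - f u v
    \<le> (3 + (18 * sqrt 2 + 45) * (L / \<mu>) + 36 * L' / sqrt (\<mu> * \<nu>) + 9 * L'\<^sup>2 / (\<mu> * \<nu>)) * e"
proof -
  have uv: "u \<in> X" "v \<in> Y" using saddle by (auto simp: saddle_point_def)
  \<comment> \<open>Here r and r' are the radii that a gap of e allows around u and v, while L * q
    is the accuracy requested from the gradient estimate.\<close>
  define q q' where "q = sqrt (e / \<mu>)" and "q' = sqrt (e / \<nu>)"
  define r r' where "r = sqrt 2 * q" and "r' = sqrt 2 * q'"
  have q0: "q \<ge> 0" "q' \<ge> 0" "r \<ge> 0" "r' \<ge> 0"
    using e pos by (auto simp: q_def q'_def r_def r'_def)
  let ?good = "\<lambda>j. j < m \<and> f (xh j) v - f u (yh j) \<le> e"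
  define G where "G = g u v"
  have good_pt: "dist (xh j) u \<le> r" "dist (yh j) v \<le> r'" "\<bar>G \<bullet> (xh j - u)\<bar> \<le> e" if j: "?good j" for j
  proof -
    have gr: "\<mu> / 2 * (norm (xh j - u))\<^sup>2 + \<nu> / 2 * (norm (yh j - v))\<^sup>2 \<le> e"
      using saddle_growth[OF saddle xh yh, of j j] j by linarith
    moreover have "0 \<le> \<mu> / 2 * (norm (xh j - u))\<^sup>2" "0 \<le> \<nu> / 2 * (norm (yh j - v))\<^sup>2" using pos by auto
    ultimately have "\<mu> / 2 * (norm (xh j - u))\<^sup>2 \<le> e" "\<nu> / 2 * (norm (yh j - v))\<^sup>2 \<le> e"
      by linarith+
    then show "dist (xh j) u \<le> r" "dist (yh j) v \<le> r'"
      unfolding dist_norm r_def r'_def q_def q'_def using sqrt_radius[OF pos(1)] sqrt_radius[OF pos(2)] by simp_all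
    have "0 \<le> G \<bullet> (xh j - u)"
      unfolding G_def
    proof (rule has_gradient_within_inner_ge[OF grad[OF uv] X(2) uv(1) xh])
      fix t :: real assume t: "0 < t" "t \<le> 1"
      have "(1 - t) *\<^sub>R u + t *\<^sub>R xh j \<in> X" using X(2) uv xh j t by (intro convexD) auto
      then show "t * 0 \<le> f (u + t *\<^sub>R (xh j - u)) v - f u v"
        using saddle by (auto simp: saddle_point_def algebra_simps)
    qed (use j in auto)
    moreover have "G \<bullet> (xh j - u) \<le> f (xh j) v - f u v"
      unfolding G_def
    proof (rule has_gradient_within_inner_le[OF grad[OF uv] X(2) uv(1) xh])
      fix t :: real assume t: "0 < t" "t \<le> 1"
      have conv: "f (t *\<^sub>R xh j + (1 - t) *\<^sub>R u) v \<le> t * f (xh j) v + (1 - t) * f u v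
          - \<mu> / 2 * t * (1 - t) * (norm (xh j - u))\<^sup>2"
        using sc_x[OF uv(2)] xh uv j t by (auto simp: strongly_convex_on_def)
      have nn: "0 \<le> \<mu> / 2 * t * (1 - t) * (norm (xh j - u))\<^sup>2" using pos t by auto
      have eq: "u + t *\<^sub>R (xh j - u) = t *\<^sub>R xh j + (1 - t) *\<^sub>R u" by (simp add: algebra_simps)
      have "t * f (xh j) v + (1 - t) * f u v = f u v + t * (f (xh j) v - f u v)"
        by (simp add: algebra_simps)
      then show "f (u + t *\<^sub>R (xh j - u)) v - f u v \<le> t * (f (xh j) v - f u v)"
        unfolding eq using conv nn by linarith
    qed (use j in auto)
    moreover have "f u (yh j) \<le> f u v" using saddle yh j by (auto simp: saddle_point_def)
    ultimately show "\<bar>G \<bullet> (xh j - u)\<bar> \<le> e" using j by linarith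
  qed
  have majority: "real (card {j. j < m \<and> A j}) > real m / 2" if "\<And>j. ?good j \<Longrightarrow> A j" for A
  proof -
    have "card {j. ?good j} \<le> card {j. j < m \<and> A j}" using that by (intro card_mono) auto
    with good show ?thesis by simp
  qed
  have d1: "dist (xh k1) u \<le> 3 * r" and d2: "dist (yh k2) v \<le> 3 * r'" and d3: "dist (xh k3) u \<le> 3 * r"
    using good_pt by (auto intro!: extract_idx_dist[OF k1] extract_idx_dist[OF k2] extract_idx_dist[OF k3(1)] majority)
  note k_less = extract_idx_less[OF k1] extract_idx_less[OF k2] extract_idx_less[OF k3(1)]
  note xy = xh[OF k_less(1)] yh[OF k_less(2)]
  \<comment> \<open>D is the error of w as a substitute for the gradient at (u, v): the estimation
    error, and the drift of the gradient over the distances 3 * r and 3 * r' between (u, v) and the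
    point where it was estimated.\<close>
  define D where "D = 3 * (L * q) + L * (3 * r) + L' * (3 * r')"
  have D0: "D \<ge> 0" using q0 L by (auto simp: D_def)
  have D: "norm (w - G) \<le> D"
  proof -
    have "norm (w - G) \<le> norm (w - g (xh k1) (yh k2)) + norm (g (xh k1) (yh k2) - g u (yh k2))
        + norm (g u (yh k2) - G)"
      using norm_triangle_ineq[of "w - g (xh k1) (yh k2)" "g (xh k1) (yh k2) - g u (yh k2)"]
        norm_triangle_ineq[of "w - g u (yh k2)" "g u (yh k2) - G"] by simp
    also have "\<dots> \<le> 3 * (L * q) + L * norm (xh k1 - u) + L' * norm (yh k2 - v)"
      using w lip[OF xy(1) uv(1) xy(2)] lip'[OF uv(1) xy(2) uv(2)]
      unfolding dist_norm q_def G_def by linarith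
    also have "\<dots> \<le> D"
      unfolding D_def using d1 d2 L by (intro add_mono mult_left_mono) (auto simp: dist_norm)
    finally show ?thesis .
  qed
  have w_G: "\<bar>w \<bullet> z\<bar> \<le> \<bar>G \<bullet> z\<bar> + D * norm z" "G \<bullet> z \<le> \<bar>w \<bullet> z\<bar> + D * norm z" for z
  proof -
    have "\<bar>w \<bullet> z - G \<bullet> z\<bar> \<le> D * norm z"
      using Cauchy_Schwarz_ineq2[of "w - G" z] mult_right_mono[OF D norm_ge_zero[of z]]
      unfolding inner_diff_left by linarith
    then show "\<bar>w \<bullet> z\<bar> \<le> \<bar>G \<bullet> z\<bar> + D * norm z" "G \<bullet> z \<le> \<bar>w \<bullet> z\<bar> + D * norm z"
      by linarith+
  qed
  have "\<bar>w \<bullet> (xh k3 - u)\<bar> \<le> 3 * (e + D * r)"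
  proof (rule extract_idx_functional[OF k3(2)], rule majority)
    fix j assume j: "?good j"
    have "D * norm (xh j - u) \<le> D * r"
      using good_pt(1)[OF j] D0 by (intro mult_left_mono) (auto simp: dist_norm)
    then show "\<bar>w \<bullet> (xh j - u)\<bar> \<le> e + D * r"
      using w_G(1)[of "xh j - u"] good_pt(3)[OF j] by linarith
  qed
  moreover have "D * norm (xh k3 - u) \<le> D * (3 * r)"
    using d3 D0 by (intro mult_left_mono) (auto simp: dist_norm)
  \<comment> \<open>Of the six copies of D * r, three come from the selection by w, and three from
    passing from w back to G at the selected point, which is within 3 * r of u.\<close>
  ultimately have GA: "G \<bullet> (xh k3 - u) \<le> 3 * e + 6 * (D * r)"
    using w_G(2)[of "xh k3 - u"] by (simp add: algebra_simps)
  have "(norm (xh k3 - u))\<^sup>2 \<le> (3 * r)\<^sup>2"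
    using d3 by (intro power_mono) (auto simp: dist_norm)
  then have "(L / 2 + L'\<^sup>2 / (2 * \<nu>)) * (norm (xh k3 - u))\<^sup>2 \<le> (L / 2 + L'\<^sup>2 / (2 * \<nu>)) * (3 * r)\<^sup>2"
    using L pos by (intro mult_left_mono) auto
  with GA saddle_primal_smooth[OF saddle grad lip lip' xh[OF k_less(3)] y]
  have "f (xh k3) y - f u v \<le> 3 * e + 6 * (D * r) + (L / 2 + L'\<^sup>2 / (2 * \<nu>)) * (3 * r)\<^sup>2"
    unfolding G_def by linarith
  \<comment> \<open>The term 18 * sqrt 2 comes from the estimation error 18 * L * q * r. In 45 = 36
    + 9, the 36 comes from the drift 18 * L * r * r, since r squared is 2 * q * q, and the 9 from
    the quadratic term. The same two sources give 36 and 9 for L'.\<close>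
  also have "\<dots> = (3 + (18 * sqrt 2 + 45) * (L / \<mu>) + 36 * L' / sqrt (\<mu> * \<nu>) + 9 * L'\<^sup>2 / (\<mu> * \<nu>)) * e"
  proof -
    have qq: "q * q = e / \<mu>" using e pos by (simp add: q_def)
    have qq': "q' * q = e / sqrt (\<mu> * \<nu>)"
      using e pos by (simp add: q_def q'_def real_sqrt_divide real_sqrt_mult)
    have 1: "L * q * r = sqrt 2 * L * (q * q)" by (simp add: r_def)
    have 2: "L * r * r = 2 * L * (q * q)" "L' * r' * r = 2 * L' * (q' * q)" "r\<^sup>2 = 2 * (q * q)"
      by (simp_all add: r_def r'_def power2_eq_square)
    have "6 * (D * r) = 18 * (L * q * r) + 18 * (L * r * r) + 18 * (L' * r' * r)"
      by (simp add: D_def algebra_simps)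
    then have D_eq: "6 * (D * r) = 18 * sqrt 2 * L * (e / \<mu>) + 36 * L * (e / \<mu>) + 36 * L' * (e / sqrt (\<mu> * \<nu>))"
      unfolding 1 2 qq qq' by simp
    have rr: "(3 * r)\<^sup>2 = 18 * (e / \<mu>)" using 2(3) by (simp add: power_mult_distrib qq)
    have "(L / 2 + L'\<^sup>2 / (2 * \<nu>)) * (3 * r)\<^sup>2 = 9 * (L / \<mu>) * e + 9 * L'\<^sup>2 / (\<mu> * \<nu>) * e"
      unfolding rr using pos by (simp add: field_simps)
    then show ?thesis unfolding D_eq by (simp add: algebra_simps)
  qed
  finally show ?thesis .
qed

end

section \<open>Independent samples\<close>

lemma indep_vars_PiM_coordinates:
  assumes P: "prob_space P" and I: "I \<noteq> {}"
  shows "prob_space.indep_vars (Pi\<^sub>M I (\<lambda>_. P)) (\<lambda>_. P) (\<lambda>i s. s i) I"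
proof -
  interpret S: prob_space "Pi\<^sub>M I (\<lambda>_. P)" using P by (intro prob_space_PiM)
  have "distr (Pi\<^sub>M I (\<lambda>_. P)) (Pi\<^sub>M I (\<lambda>_. P)) (\<lambda>s. \<lambda>i\<in>I. s i)
      = distr (Pi\<^sub>M I (\<lambda>_. P)) (Pi\<^sub>M I (\<lambda>_. P)) (\<lambda>s. s)"
    by (intro distr_cong) (auto simp: space_PiM)
  also have "\<dots> = (\<Pi>\<^sub>M i\<in>I. distr (Pi\<^sub>M I (\<lambda>_. P)) P (\<lambda>s. s i))"
    using P by (auto simp: distr_id2 intro!: PiM_cong distr_PiM_component[symmetric])
  finally show ?thesis
    using I by (subst S.indep_vars_iff_distr_eq_PiM') auto
qed

lemma distr_PiM_subsequence:
  fixes e :: "'j \<Rightarrow> 'i"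
  assumes "prob_space P" "inj e"
  shows "distr (Pi\<^sub>M UNIV (\<lambda>_. P)) (Pi\<^sub>M UNIV (\<lambda>_. P)) (\<lambda>s k. s (e k)) = Pi\<^sub>M UNIV (\<lambda>_. P)"
  using distr_PiM_reindex[of UNIV "\<lambda>_. P" e UNIV] assms by (simp add: restrict_UNIV)

lemma card_eq_sum_if:
  fixes m :: nat
  shows "real (card {j. j < m \<and> Q j}) = (\<Sum>j<m. if Q j then 1 else (0::real))"
proof -
  have "{..<m} \<inter> {j. Q j} = {j. j < m \<and> Q j}" by auto
  then show ?thesis by (simp add: sum.If_cases)
qed

text \<open>Hoeffding's inequality with deviation \<open>m / 2 - m / 3 = m / 6\<close>.\<close>

lemma majority_amplification:
  fixes e :: "nat \<Rightarrow> nat \<Rightarrow> 'i"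
  assumes P: "prob_space P" and e: "inj (\<lambda>(j, k). e j k)" and m: "m > 0"
    and B: "B \<in> sets (Pi\<^sub>M UNIV (\<lambda>_::nat. P))"
    and fail: "measure (Pi\<^sub>M UNIV (\<lambda>_::nat. P)) B \<le> 1 / 3"
  shows "measure (Pi\<^sub>M UNIV (\<lambda>_::'i. P))
     {s \<in> space (Pi\<^sub>M UNIV (\<lambda>_::'i. P)). real m / 2 \<le> real (card {j. j < m \<and> (\<lambda>k. s (e j k)) \<in> B})}
     \<le> exp (- real m / 18)"
proof -
  let ?S = "Pi\<^sub>M UNIV (\<lambda>_::nat. P)" and ?SS = "Pi\<^sub>M UNIV (\<lambda>_::'i. P)"
  interpret S: prob_space ?S using P by (intro prob_space_PiM)
  interpret SS: prob_space ?SS using P by (intro prob_space_PiM)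
  define X where "X j s = (indicator B (\<lambda>k. s (e j k)) :: real)" for j s
  have inj_e: "inj (e j)" for j using e by (auto simp: inj_def)
  note [measurable] = B
  have sub_meas: "(\<lambda>s k. s (e j k)) \<in> ?SS \<rightarrow>\<^sub>M ?S" for j
    by (intro measurable_PiM_single') (auto simp: space_PiM PiE_iff)
  have X_meas[measurable]: "X j \<in> borel_measurable ?SS" for j
    unfolding X_def using sub_meas[of j] by measurable
  \<comment> \<open>The m sub-samples read disjoint sets of coordinates, which makes their failure
    indicators independent.\<close>
  have "disjoint_family_on (\<lambda>j. range (e j)) {..<m}"
    using e by (auto simp: disjoint_family_on_def inj_def)
  then have "SS.indep_vars (\<lambda>j. Pi\<^sub>M (range (e j)) (\<lambda>_. P)) (\<lambda>j s. restrict (\<lambda>i. s i) (range (e j))) {..<m}"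
    by (intro SS.indep_vars_restrict[OF indep_vars_PiM_coordinates[OF P]]) auto
  then have "SS.indep_vars (\<lambda>_. borel) (\<lambda>j s. indicator B (\<lambda>k. restrict (\<lambda>i. s i) (range (e j)) (e j k)) :: real) {..<m}"
  proof (rule SS.indep_vars_compose2)
    fix j
    have "(\<lambda>s k. s (e j k)) \<in> Pi\<^sub>M (range (e j)) (\<lambda>_. P) \<rightarrow>\<^sub>M ?S"
      by (intro measurable_PiM_single') (auto simp: space_PiM)
    then show "(\<lambda>s. indicator B (\<lambda>k. s (e j k)) :: real) \<in> borel_measurable (Pi\<^sub>M (range (e j)) (\<lambda>_. P))"
      by measurable
  qed
  then have indep: "SS.indep_vars (\<lambda>_. borel) X {..<m}" by (simp add: X_def[abs_def])
  interpret H: Hoeffding_ineq ?SS "{..<m}" X "\<lambda>_. 0" "\<lambda>_. 1" "\<Sum>j<m. SS.expectation (X j)"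
    by unfold_locales (auto simp: indep, auto simp: X_def indicator_def)
  have "SS.expectation (X j) \<le> 1 / 3" for j
  proof -
    have "SS.expectation (X j) = (\<integral>s. indicator B s \<partial>distr ?SS ?S (\<lambda>s k. s (e j k)))"
      unfolding X_def using sub_meas by (intro integral_distr[symmetric]) auto
    also have "\<dots> = measure ?S B" by (simp add: distr_PiM_subsequence[OF P inj_e])
    finally show ?thesis using fail by simp
  qed
  then have "(\<Sum>j<m. SS.expectation (X j)) \<le> (\<Sum>j<m. 1 / 3)" by (intro sum_mono) auto
  then have mean: "(\<Sum>j<m. SS.expectation (X j)) \<le> real m / 3" by simp
  define d where "d = real m / 2 - (\<Sum>j<m. SS.expectation (X j))"
  have d: "real m / 6 \<le> d" using mean by (simp add: d_def)
  have count: "(\<Sum>j<m. X j s) = real (card {j. j < m \<and> (\<lambda>k. s (e j k)) \<in> B})" for s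
    unfolding X_def card_eq_sum_if by (intro sum.cong) (auto simp: indicator_def)
  have "SS.prob {s \<in> space ?SS. (\<Sum>j<m. SS.expectation (X j)) + d \<le> (\<Sum>j<m. X j s)}
      \<le> exp (- 2 * d\<^sup>2 / (\<Sum>j<m. (1 - 0)\<^sup>2))"
    by (rule H.Hoeffding_ineq_ge) (use d m in auto)
  also have "\<dots> \<le> exp (- real m / 18)"
  proof -
    \<comment> \<open>The exponent 2 * d^2 / m with d at least m / 6 is at least m / 18.\<close>
    have "(real m / 6)\<^sup>2 \<le> d\<^sup>2" using d by (intro power_mono) auto
    then have "real m * real m \<le> 36 * d\<^sup>2" by (simp add: power2_eq_square)
    then show ?thesis using m by (simp add: field_simps)
  qed
  finally show ?thesis by (simp add: d_def count)
qed

text \<open>A quantity W known before the round and the batch of that round have a product law. This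
  licenses proving a bound for each fixed value of W and then integrating. Independence from F gives
  the product form on rectangles; independence within the batch identifies its law as the infinite
  product of P.\<close>

lemma (in prob_space) distr_Pair_indep:
  fixes \<xi> :: "'i \<Rightarrow> 'a \<Rightarrow> 'c" and P :: "'c measure"
  assumes F: "space F = space M" "sets F \<subseteq> events" and P: "prob_space P"
    and indep: "indep_vars (\<lambda>_. P) \<xi> UNIV" and distr: "\<And>i. distr M P (\<xi> i) = P"
    and ind: "indep_set (sets F)
        (sets (vimage_algebra (space M) (\<lambda>\<omega> i. \<xi> i \<omega>) (Pi\<^sub>M UNIV (\<lambda>_. P))))"
    and W: "W \<in> F \<rightarrow>\<^sub>M N"
  shows "(\<lambda>\<omega>. (W \<omega>, \<lambda>i. \<xi> i \<omega>)) \<in> M \<rightarrow>\<^sub>M N \<Otimes>\<^sub>M Pi\<^sub>M UNIV (\<lambda>_. P)"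
    and "distr M (N \<Otimes>\<^sub>M Pi\<^sub>M UNIV (\<lambda>_. P)) (\<lambda>\<omega>. (W \<omega>, \<lambda>i. \<xi> i \<omega>)) = distr M N W \<Otimes>\<^sub>M Pi\<^sub>M UNIV (\<lambda>_. P)"
proof -
  let ?SS = "Pi\<^sub>M UNIV (\<lambda>_::'i. P)" and ?\<xi> = "\<lambda>\<omega> i. \<xi> i \<omega>"
  have \<xi>: "\<xi> i \<in> M \<rightarrow>\<^sub>M P" for i using indep by (auto simp: indep_vars_def)
  then have \<xi>': "?\<xi> \<in> M \<rightarrow>\<^sub>M ?SS" by (intro measurable_PiM_single') (auto dest: measurable_space)
  have W': "W \<in> M \<rightarrow>\<^sub>M N" using W F by (auto simp: measurable_def)
  have d: "distr M ?SS ?\<xi> = ?SS"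
    using indep_vars_iff_distr_eq_PiM[where I=UNIV and M'="\<lambda>_. P" and X=\<xi>] \<xi> indep distr by (simp add: restrict_UNIV)
  have pair: "(\<lambda>\<omega>. (W \<omega>, ?\<xi> \<omega>)) \<in> M \<rightarrow>\<^sub>M N \<Otimes>\<^sub>M ?SS" using W' \<xi>' by simp
  interpret SS: prob_space ?SS using P by (intro prob_space_PiM)
  interpret DW: prob_space "distr M N W" using W' by (rule prob_space_distr)
  show "distr M (N \<Otimes>\<^sub>M ?SS) (\<lambda>\<omega>. (W \<omega>, ?\<xi> \<omega>)) = distr M N W \<Otimes>\<^sub>M ?SS"
  proof (rule pair_measure_eqI[symmetric])
    fix A B assume "A \<in> sets (distr M N W)" and B: "B \<in> sets ?SS"
    then have A: "A \<in> sets N" by simp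
    have "W -` A \<inter> space M \<in> sets F" using measurable_sets[OF W A] F by simp
    moreover have "?\<xi> -` B \<inter> space M \<in> sets (vimage_algebra (space M) ?\<xi> ?SS)"
      using B by (rule in_vimage_algebra)
    ultimately have "prob ((W -` A \<inter> space M) \<inter> (?\<xi> -` B \<inter> space M)) = prob (W -` A \<inter> space M) * prob (?\<xi> -` B \<inter> space M)"
      by (rule indep_setD[OF ind])
    moreover have "(\<lambda>\<omega>. (W \<omega>, ?\<xi> \<omega>)) -` (A \<times> B) \<inter> space M = (W -` A \<inter> space M) \<inter> (?\<xi> -` B \<inter> space M)"
      by auto
    moreover have "emeasure ?SS B = emeasure M (?\<xi> -` B \<inter> space M)"
      using \<xi>' B by (subst d[symmetric]) (rule emeasure_distr)
    ultimately show "emeasure (distr M N W) A * emeasure ?SS B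
        = emeasure (distr M (N \<Otimes>\<^sub>M ?SS) (\<lambda>\<omega>. (W \<omega>, ?\<xi> \<omega>))) (A \<times> B)"
      using W' \<xi>' pair A B by (simp add: emeasure_distr emeasure_eq_measure ennreal_mult)
  qed (auto intro: sets_pair_measure_cong DW.sigma_finite_measure_axioms SS.sigma_finite_measure_axioms)
  show "(\<lambda>\<omega>. (W \<omega>, ?\<xi> \<omega>)) \<in> M \<rightarrow>\<^sub>M N \<Otimes>\<^sub>M ?SS" by (rule pair)
qed

text \<open>For fixed w the bound is \<open>majority_amplification\<close> on the coordinates (b, j,
  k), and it integrates over the law of W by Fubini. B consists of bad pairs of past and sub-sample,
  so what counts as failure may depend on the random centre.\<close>

lemma fresh_samples_majority:
  fixes b :: bool
  assumes M: "prob_space M" and P: "prob_space P" and fresh: "fresh_samples M F P \<xi>"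
    and W: "W \<in> F r \<rightarrow>\<^sub>M N" and B: "B \<in> sets (N \<Otimes>\<^sub>M Pi\<^sub>M UNIV (\<lambda>_::nat. P))" and m: "m > 0"
    and fail: "\<And>w. w \<in> space N \<Longrightarrow> measure (Pi\<^sub>M UNIV (\<lambda>_::nat. P)) (Pair w -` B) \<le> 1 / 3"
  defines "A \<equiv> {\<omega> \<in> space M. real m / 2 \<le> real (card {j. j < m \<and> (W \<omega>, \<lambda>k. \<xi> r (b, j, k) \<omega>) \<in> B})}"
  shows "A \<in> sets M" "measure M A \<le> exp (- real m / 18)"
proof -
  let ?S = "Pi\<^sub>M UNIV (\<lambda>_::nat. P)" and ?SS = "Pi\<^sub>M UNIV (\<lambda>_::bool \<times> nat \<times> nat. P)"
  interpret prob_space M by (rule M)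
  interpret SS: prob_space ?SS using P by (intro prob_space_PiM)
  have F: "space (F r) = space M" "sets (F r) \<subseteq> events"
    using fresh by (auto simp: fresh_samples_def filtration_def)
  note * = distr_Pair_indep[OF F P _ _ _ W, of "\<xi> r"]
  have meas: "(\<lambda>\<omega>. (W \<omega>, \<lambda>i. \<xi> r i \<omega>)) \<in> M \<rightarrow>\<^sub>M N \<Otimes>\<^sub>M ?SS"
    and dist: "distr M (N \<Otimes>\<^sub>M ?SS) (\<lambda>\<omega>. (W \<omega>, \<lambda>i. \<xi> r i \<omega>)) = distr M N W \<Otimes>\<^sub>M ?SS"
    using fresh by (auto simp: fresh_samples_def intro!: *)
  define C where "C = {p \<in> space (N \<Otimes>\<^sub>M ?SS). real m / 2 \<le> real (card {j. j < m \<and> (fst p, \<lambda>k. snd p (b, j, k)) \<in> B})}"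
  have [measurable]: "(\<lambda>p k. snd p (b, j, k)) \<in> N \<Otimes>\<^sub>M ?SS \<rightarrow>\<^sub>M ?S" for j
    by (intro measurable_PiM_single') (auto simp: space_pair_measure space_PiM)
  note [measurable] = B
  have C: "C \<in> sets (N \<Otimes>\<^sub>M ?SS)"
    unfolding C_def card_eq_sum_if by measurable
  have W': "W \<in> M \<rightarrow>\<^sub>M N" using W F by (auto simp: measurable_def)
  have A_eq: "A = (\<lambda>\<omega>. (W \<omega>, \<lambda>i. \<xi> r i \<omega>)) -` C \<inter> space M"
    using measurable_space[OF meas] by (auto simp: A_def C_def)
  show "A \<in> sets M" unfolding A_eq using meas C by (rule measurable_sets)
  interpret DW: prob_space "distr M N W" using W' by (rule prob_space_distr)
  have "emeasure M A = emeasure (distr M N W \<Otimes>\<^sub>M ?SS) C"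
    unfolding A_eq dist[symmetric] using meas C by (simp add: emeasure_distr)
  also have "\<dots> = (\<integral>\<^sup>+w. emeasure ?SS (Pair w -` C) \<partial>distr M N W)"
    using C by (intro SS.emeasure_pair_measure_alt) simp
  also have "\<dots> \<le> (\<integral>\<^sup>+w. ennreal (exp (- real m / 18)) \<partial>distr M N W)"
  proof (intro nn_integral_mono)
    fix w assume "w \<in> space (distr M N W)"
    then have w: "w \<in> space N" by simp
    have "Pair w -` C = {s \<in> space ?SS. real m / 2 \<le> real (card {j. j < m \<and> (\<lambda>k. s (b, j, k)) \<in> Pair w -` B})}"
      using w by (auto simp: C_def space_pair_measure)
    moreover have "measure ?SS \<dots> \<le> exp (- real m / 18)"
      using B w fail by (intro majority_amplification[OF P _ m]) (auto simp: inj_def sets_Pair1)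
    ultimately show "emeasure ?SS (Pair w -` C) \<le> ennreal (exp (- real m / 18))"
      by (simp add: SS.emeasure_eq_measure)
  qed
  also have "\<dots> = ennreal (exp (- real m / 18))" using DW.emeasure_space_1 by simp
  finally show "measure M A \<le> exp (- real m / 18)" by (simp add: emeasure_eq_measure)
qed

section \<open>Exchangeability: generalisation of stable procedures, variance of sample
  means\<close>

text \<open>Up to splitting off the head, the map transposes two entries of the i.i.d. sequence
  \<open>c, s 0, s 1, \<dots>\<close>.\<close>

lemma distr_resample:
  assumes P: "prob_space P"
  defines "S \<equiv> Pi\<^sub>M UNIV (\<lambda>_::nat. P)"
  shows "distr (P \<Otimes>\<^sub>M S) (P \<Otimes>\<^sub>M S) (\<lambda>(c, s). (s i, s(i := c))) = P \<Otimes>\<^sub>M S"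
proof -
  interpret Q: sequence_space P
    by (simp add: sequence_space_def product_prob_space_def product_sigma_finite_def
        product_prob_space_axioms_def P prob_space_imp_sigma_finite)
  define U where "U = (\<lambda>(c :: 'a, s :: nat \<Rightarrow> 'a). case_nat c s)"
  define V where "V = (\<lambda>s :: nat \<Rightarrow> 'a. (s 0, \<lambda>k. s (Suc k)))"
  define R where "R = (\<lambda>s :: nat \<Rightarrow> 'a. \<lambda>k. s (Transposition.transpose 0 (Suc i) k))"
  have U[measurable]: "U \<in> P \<Otimes>\<^sub>M S \<rightarrow>\<^sub>M S" unfolding U_def S_def
  proof (intro measurable_PiM_single')
    show "(\<lambda>p. (case p of (c, s) \<Rightarrow> case_nat c s) i) \<in> P \<Otimes>\<^sub>M Pi\<^sub>M UNIV (\<lambda>_. P) \<rightarrow>\<^sub>M P" for i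
      by (cases i) (auto simp: split_beta)
  qed (auto simp: space_pair_measure space_PiM PiE_iff split: nat.split)
  have V[measurable]: "V \<in> S \<rightarrow>\<^sub>M P \<Otimes>\<^sub>M S" unfolding V_def S_def
    by (intro measurable_Pair measurable_PiM_single') (auto simp: space_PiM)
  have R[measurable]: "R \<in> S \<rightarrow>\<^sub>M S" unfolding R_def S_def
    by (intro measurable_PiM_single') (auto simp: space_PiM)
  have dU: "distr (P \<Otimes>\<^sub>M S) S U = S"
    using Q.PiM_iter by (simp add: U_def S_def)
  have dR: "distr S S R = S"
    unfolding S_def R_def using P by (intro distr_PiM_subsequence) auto
  have "V (U p) = p" for p by (cases p) (auto simp: U_def V_def)
  then have dV: "distr S (P \<Otimes>\<^sub>M S) V = P \<Otimes>\<^sub>M S"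
    by (subst dU[symmetric]) (simp add: distr_distr comp_def distr_id2)
  have "V (R (U p)) = (case p of (c, s) \<Rightarrow> (s i, s(i := c)))" for p
    by (cases p) (auto simp: U_def V_def R_def Transposition.transpose_def fun_eq_iff)
  then have "distr (P \<Otimes>\<^sub>M S) (P \<Otimes>\<^sub>M S) (\<lambda>(c, s). (s i, s(i := c)))
      = distr (distr (distr (P \<Otimes>\<^sub>M S) S U) S R) (P \<Otimes>\<^sub>M S) V"
    by (simp add: distr_distr comp_def)
  also have "\<dots> = P \<Otimes>\<^sub>M S" by (simp add: dU dR dV)
  finally show ?thesis .
qed

text \<open>Exchanging the fresh point c with s i preserves the joint law and turns the test of z s
  on a new point into the test of the retrained z (s(i := c)) on the old point s i. Stability
  returns to z s at cost \<beta>, and averaging over i < n produces the empirical mean.\<close>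

lemma uniform_stability:
  fixes \<psi> :: "'c \<Rightarrow> 'z \<Rightarrow> real"
  assumes P: "prob_space P"
  defines "S \<equiv> Pi\<^sub>M UNIV (\<lambda>_::nat. P)"
  assumes psi: "(\<lambda>(c, w). \<psi> c w) \<in> borel_measurable (P \<Otimes>\<^sub>M N)" and z: "z \<in> S \<rightarrow>\<^sub>M N"
    and bdd: "\<And>c w. c \<in> space P \<Longrightarrow> w \<in> space N \<Longrightarrow> \<bar>\<psi> c w\<bar> \<le> B"
    and stable: "\<And>c s i. c \<in> space P \<Longrightarrow> s \<in> space S \<Longrightarrow> i < n \<Longrightarrow> \<psi> (s i) (z (s(i := c))) \<le> \<psi> (s i) (z s) + \<beta>"
    and n: "n > 0"
  shows "(\<integral>s. (\<integral>c. \<psi> c (z s) \<partial>P) \<partial>S) \<le> (\<integral>s. (\<Sum>i<n. \<psi> (s i) (z s)) / n \<partial>S) + \<beta>"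
proof -
  interpret P: prob_space P by (rule P)
  interpret S: prob_space S unfolding S_def using P by (intro prob_space_PiM)
  interpret PS: pair_prob_space P S ..
  have psi'[measurable (raw)]: "(\<lambda>x. \<psi> (f x) (g x)) \<in> borel_measurable L"
    if "f \<in> L \<rightarrow>\<^sub>M P" "g \<in> L \<rightarrow>\<^sub>M N" for f g and L :: "'l measure"
    using measurable_compose[OF measurable_Pair[OF that] psi] by simp
  note [measurable] = z
  have coord[measurable]: "(\<lambda>s. s i) \<in> S \<rightarrow>\<^sub>M P" for i unfolding S_def by simp
  have coordS: "s i \<in> space P" if "s \<in> space S" for s i using that by (auto simp: S_def space_PiM)
  have zS: "z s \<in> space N" if "s \<in> space S" for s using measurable_space[OF z that] .
  have upd[measurable]: "(\<lambda>(c, s). (s i, s(i := c))) \<in> P \<Otimes>\<^sub>M S \<rightarrow>\<^sub>M P \<Otimes>\<^sub>M S" for i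
    unfolding S_def split_beta
    by (intro measurable_Pair measurable_PiM_single') (auto simp: space_pair_measure space_PiM)
  have h_int: "integrable (P \<Otimes>\<^sub>M S) (\<lambda>(c, s). \<psi> c (z s))"
    by (rule PS.integrable_const_bound[of _ B]) (auto simp: space_pair_measure bdd zS)
  have c_int: "integrable S (\<lambda>s. \<psi> (s i) (z s))" for i
    by (rule S.integrable_const_bound[of _ B]) (auto simp: bdd zS coordS)
  have each: "(\<integral>s. (\<integral>c. \<psi> c (z s) \<partial>P) \<partial>S) \<le> (\<integral>s. \<psi> (s i) (z s) \<partial>S) + \<beta>" if i: "i < n" for i
  proof -
    have "(\<integral>s. (\<integral>c. \<psi> c (z s) \<partial>P) \<partial>S) = (\<integral>p. (case p of (c, s) \<Rightarrow> \<psi> c (z s)) \<partial>(P \<Otimes>\<^sub>M S))"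
      using PS.integral_snd[OF h_int] by simp
    also have "\<dots> = (\<integral>p. (case p of (c, s) \<Rightarrow> \<psi> c (z s))
        \<partial>distr (P \<Otimes>\<^sub>M S) (P \<Otimes>\<^sub>M S) (\<lambda>(c, s). (s i, s(i := c))))"
      unfolding S_def by (subst distr_resample[OF P]) simp
    also have "\<dots> = (\<integral>p. (case p of (c, s) \<Rightarrow> \<psi> (s i) (z (s(i := c)))) \<partial>(P \<Otimes>\<^sub>M S))"
      using borel_measurable_integrable[OF h_int] by (subst integral_distr) (simp_all add: case_prod_unfold)
    also have "\<dots> \<le> (\<integral>p. \<psi> (snd p i) (z (snd p)) + \<beta> \<partial>(P \<Otimes>\<^sub>M S))"
    proof (rule integral_mono)
      have m: "(\<lambda>p. case p of (c, s) \<Rightarrow> \<psi> (s i) (z (s(i := c)))) \<in> borel_measurable (P \<Otimes>\<^sub>M S)"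
        using measurable_compose[OF upd[of i] borel_measurable_integrable[OF h_int]]
        by (simp add: split_beta)
      show "integrable (P \<Otimes>\<^sub>M S) (\<lambda>p. case p of (c, s) \<Rightarrow> \<psi> (s i) (z (s(i := c))))"
        by (rule PS.integrable_const_bound[OF _ m, of B], intro AE_I2)
          (use measurable_space[OF upd[of i]] in \<open>auto simp: space_pair_measure bdd zS coordS\<close>)
      show "integrable (P \<Otimes>\<^sub>M S) (\<lambda>p. \<psi> (snd p i) (z (snd p)) + \<beta>)"
        by (rule PS.integrable_const_bound[of _ "B + \<bar>\<beta>\<bar>"])
          (auto simp: space_pair_measure bdd zS coordS intro!: order_trans[OF abs_triangle_ineq] add_mono)
    qed (auto simp: space_pair_measure stable i)
    also have "\<dots> = (\<integral>s. \<psi> (s i) (z s) \<partial>S) + \<beta>"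
    proof -
      have "integrable (P \<Otimes>\<^sub>M S) (\<lambda>(c, s). \<psi> (s i) (z s) + \<beta>)"
        by (rule PS.integrable_const_bound[of _ "B + \<bar>\<beta>\<bar>"])
          (auto simp: space_pair_measure bdd zS coordS intro!: order_trans[OF abs_triangle_ineq] add_mono)
      from PS.integral_snd[OF this] show ?thesis
        using c_int[of i] by (simp add: case_prod_unfold P.prob_space S.prob_space)
    qed
    finally show ?thesis .
  qed
  have "real n * (\<integral>s. (\<integral>c. \<psi> c (z s) \<partial>P) \<partial>S) = (\<Sum>i<n. (\<integral>s. (\<integral>c. \<psi> c (z s) \<partial>P) \<partial>S))" by simp
  also have "\<dots> \<le> (\<Sum>i<n. (\<integral>s. \<psi> (s i) (z s) \<partial>S) + \<beta>)" by (intro sum_mono each) auto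
  also have "\<dots> = real n * ((\<integral>s. (\<Sum>i<n. \<psi> (s i) (z s)) / n \<partial>S) + \<beta>)"
    using c_int n by (simp add: sum.distrib algebra_simps)
  finally show ?thesis using n by simp
qed

text \<open>The squared norm of the centred sum expands into inner products; the mixed ones have
  mean 0 by independence, and n diagonal ones divided by n^2 leave V / n.\<close>

lemma sample_mean_variance:
  fixes Z :: "'c \<Rightarrow> 'v::euclidean_space"
  assumes P: "prob_space P"
  defines "S \<equiv> Pi\<^sub>M UNIV (\<lambda>_::nat. P)"
  assumes mean: "has_bochner_integral P Z g"
    and var: "(\<integral>\<^sup>+c. ennreal ((norm (Z c - g))\<^sup>2) \<partial>P) \<le> ennreal V" and V: "V \<ge> 0" and n: "n > 0"
  shows "integrable S (\<lambda>s. (norm ((1 / real n) *\<^sub>R (\<Sum>i<n. Z (s i)) - g))\<^sup>2)"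
    and "(\<integral>s. (norm ((1 / real n) *\<^sub>R (\<Sum>i<n. Z (s i)) - g))\<^sup>2 \<partial>S) \<le> V / n"
proof -
  interpret P: prob_space P by (rule P)
  interpret S: prob_space S unfolding S_def using P by (intro prob_space_PiM)
  define D where "D c = Z c - g" for c
  have Z: "integrable P Z" "integral\<^sup>L P Z = g" using mean by (auto simp: has_bochner_integral_iff)
  then have D: "integrable P D" "integral\<^sup>L P D = 0" by (auto simp: D_def[abs_def] P.prob_space)
  have Dm[measurable]: "D \<in> borel_measurable P" using D by simp
  have D2: "integrable P (\<lambda>c. (norm (D c))\<^sup>2)"
    using var unfolding D_def[symmetric] by (intro integrableI_bounded) (auto simp: le_less_trans[OF _ ennreal_less_top])
  have "ennreal (\<integral>c. (norm (D c))\<^sup>2 \<partial>P) \<le> ennreal V"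
    using var unfolding D_def[symmetric] by (subst nn_integral_eq_integral[symmetric, OF D2]) auto
  then have D2V: "(\<integral>c. (norm (D c))\<^sup>2 \<partial>P) \<le> V" using V by simp
  have dist: "distr S P (\<lambda>s. s i) = P" for i
    unfolding S_def by (intro distr_PiM_component P) auto
  have coord[measurable]: "(\<lambda>s. s i) \<in> S \<rightarrow>\<^sub>M P" for i unfolding S_def by simp
  have int_coord: "integrable S (\<lambda>s. f (s i)) = integrable P f" "(\<integral>s. f (s i) \<partial>S) = (\<integral>c. f c \<partial>P)"
    if [measurable]: "f \<in> borel_measurable P" for f :: "'c \<Rightarrow> real" and i
    using integrable_distr_eq[of "\<lambda>s. s i" S P f] integral_distr[of "\<lambda>s. s i" S P f] by (auto simp: dist)
  have coords: "S.indep_vars (\<lambda>_. P) (\<lambda>i s. s i) UNIV"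
    unfolding S_def by (rule indep_vars_PiM_coordinates[OF P]) simp
  have prod: "integrable S (\<lambda>s. D (s i) \<bullet> D (s j)) \<and> (\<integral>s. D (s i) \<bullet> D (s j) \<partial>S) = 0" if ij: "i \<noteq> j" for i j
  proof -
    \<comment> \<open>The product rule for expectations of independent variables is real-valued, so
      the inner product is split along an orthonormal basis.\<close>
    have comp: "integrable S (\<lambda>s. (D (s i) \<bullet> b) * (D (s j) \<bullet> b)) \<and> (\<integral>s. (D (s i) \<bullet> b) * (D (s j) \<bullet> b) \<partial>S) = 0" for b
    proof -
      have "S.indep_var (Pi\<^sub>M {i} (\<lambda>_. P)) (\<lambda>s. restrict (\<lambda>i. s i) {i})
          (Pi\<^sub>M {j} (\<lambda>_. P)) (\<lambda>s. restrict (\<lambda>i. s i) {j})"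
        using ij by (intro S.indep_var_restrict[OF coords]) auto
      then have "S.indep_var borel ((\<lambda>t. D (t i) \<bullet> b) \<circ> (\<lambda>s. restrict (\<lambda>i. s i) {i}))
          borel ((\<lambda>t. D (t j) \<bullet> b) \<circ> (\<lambda>s. restrict (\<lambda>i. s i) {j}))"
        by (rule S.indep_var_compose) measurable
      then have ind: "S.indep_var borel (\<lambda>s. D (s i) \<bullet> b) borel (\<lambda>s. D (s j) \<bullet> b)" by (simp add: comp_def)
      have i: "integrable S (\<lambda>s. D (s k) \<bullet> b)" and e: "(\<integral>s. D (s k) \<bullet> b \<partial>S) = 0" for k
        using D int_coord[of "\<lambda>c. D c \<bullet> b" k] by simp_all
      show ?thesis
        using S.indep_var_integrable[OF ind i i] S.indep_var_lebesgue_integral[OF ind i i] by (simp add: e)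
    qed
    have "(\<lambda>s. D (s i) \<bullet> D (s j)) = (\<lambda>s. \<Sum>b\<in>Basis. (D (s i) \<bullet> b) * (D (s j) \<bullet> b))"
      by (intro ext euclidean_inner)
    then show ?thesis using comp by simp
  qed
  have diag: "integrable S (\<lambda>s. D (s i) \<bullet> D (s i))" "(\<integral>s. D (s i) \<bullet> D (s i) \<partial>S) \<le> V" for i
    using D2 D2V int_coord[of "\<lambda>c. D c \<bullet> D c" i] by (simp_all add: power2_norm_eq_inner)
  have pair: "integrable S (\<lambda>s. D (s i) \<bullet> D (s j))" "(\<integral>s. D (s i) \<bullet> D (s j) \<partial>S) \<le> (if i = j then V else 0)" for i j
    using prod[of i j] diag[of i] by (cases "i = j"; simp)+
  have eq: "(norm ((1 / real n) *\<^sub>R (\<Sum>i<n. Z (s i)) - g))\<^sup>2 = (\<Sum>i<n. \<Sum>j<n. D (s i) \<bullet> D (s j)) / (real n)\<^sup>2" for s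
  proof -
    have "(1 / real n) *\<^sub>R (\<Sum>i<n. Z (s i)) - g = (1 / real n) *\<^sub>R (\<Sum>i<n. D (s i))"
      using n by (simp add: D_def sum_subtractf scaleR_diff_right sum_constant_scaleR)
    moreover have "(norm (\<Sum>i<n. D (s i)))\<^sup>2 = (\<Sum>i<n. \<Sum>j<n. D (s i) \<bullet> D (s j))"
      by (simp only: power2_norm_eq_inner inner_sum_left) (simp only: inner_sum_right)
    ultimately show ?thesis by (simp add: power_mult_distrib power_divide)
  qed
  show "integrable S (\<lambda>s. (norm ((1 / real n) *\<^sub>R (\<Sum>i<n. Z (s i)) - g))\<^sup>2)"
    unfolding eq by (intro integrable_divide Bochner_Integration.integrable_sum pair)
  have "(\<integral>s. (norm ((1 / real n) *\<^sub>R (\<Sum>i<n. Z (s i)) - g))\<^sup>2 \<partial>S)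
      = (\<Sum>i<n. \<Sum>j<n. \<integral>s. D (s i) \<bullet> D (s j) \<partial>S) / (real n)\<^sup>2"
    unfolding eq using pair(1) by simp
  also have "\<dots> \<le> (\<Sum>i<n. \<Sum>j<n. if i = j then V else 0) / (real n)\<^sup>2"
    by (intro divide_right_mono sum_mono pair) auto
  also have "\<dots> = V / n" using n by (simp add: power2_eq_square)
  finally show "(\<integral>s. (norm ((1 / real n) *\<^sub>R (\<Sum>i<n. Z (s i)) - g))\<^sup>2 \<partial>S) \<le> V / n" .
qed

section \<open>Sample average approximation\<close>

text \<open>On X a K-Lipschitz function is the infimum of f c d + K * dist x d over a countable
  dense set of points d. Each of these functions is measurable in (c, x) jointly because c and x
  occur separately.\<close>

lemma lipschitz_on_measurable_Pair:
  fixes f :: "'c \<Rightarrow> 'a::{second_countable_topology, metric_space} \<Rightarrow> real"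
  assumes lip: "\<And>c. K-lipschitz_on X (f c)" and meas: "\<And>x. x \<in> X \<Longrightarrow> (\<lambda>c. f c x) \<in> borel_measurable P"
  shows "(\<lambda>p. f (fst p) (snd p)) \<in> borel_measurable (P \<Otimes>\<^sub>M restrict_space borel X)"
proof -
  obtain D where D: "countable D" "D \<subseteq> X" "X \<subseteq> closure D" using separable by blast
  have K0: "K \<ge> 0" using lip by (auto simp: lipschitz_on_def)
  have dense: "f c x < a \<longleftrightarrow> (\<exists>d\<in>D. f c d + K * dist x d < a)" if x: "x \<in> X" for c x a
  proof
    assume less: "f c x < a"
    \<comment> \<open>Moving to d costs at most 2 * K * e; the extra 1 in the denominator makes the
      inequality strict and covers K = 0.\<close>
    define e where "e = (a - f c x) / (2 * K + 1)"
    have e: "e > 0" using less K0 by (simp add: e_def)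
    have "x \<in> closure D" using x D(3) by auto
    with e obtain d where d: "d \<in> D" "dist d x < e"
      unfolding closure_approachable by blast
    have "f c d \<le> f c x + K * dist x d"
      using lipschitz_onD[OF lip[of c] x subsetD[OF D(2) d(1)]] by (simp add: dist_real_def abs_le_iff)
    then have "f c d + K * dist x d \<le> f c x + 2 * K * dist d x" by (simp add: dist_commute)
    also have "\<dots> \<le> f c x + 2 * K * e" using d K0 by (intro add_mono mult_left_mono) auto
    also have "\<dots> < f c x + (2 * K + 1) * e" using e by (simp add: distrib_right)
    also have "\<dots> = a" using K0 by (simp add: e_def)
    finally show "\<exists>d\<in>D. f c d + K * dist x d < a" using d(1) by blast
  next
    assume "\<exists>d\<in>D. f c d + K * dist x d < a"
    then obtain d where d: "d \<in> D" "f c d + K * dist x d < a" by blast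
    then show "f c x < a"
      using lipschitz_onD[OF lip[of c] x subsetD[OF D(2) d(1)]] by (simp add: dist_real_def abs_le_iff)
  qed
  have "{p \<in> space (P \<Otimes>\<^sub>M restrict_space borel X). f (fst p) (snd p) < a}
      = {p \<in> space (P \<Otimes>\<^sub>M restrict_space borel X). \<exists>d\<in>D. f (fst p) d + K * dist (snd p) d < a}" for a
    using dense by (auto simp: space_pair_measure space_restrict_space)
  moreover have "{p \<in> space (P \<Otimes>\<^sub>M restrict_space borel X). \<exists>d\<in>D. f (fst p) d + K * dist (snd p) d < a}
      \<in> sets (P \<Otimes>\<^sub>M restrict_space borel X)" for a
  proof (intro sets.sets_Collect_countable_Ex' D(1))
    fix d assume "d \<in> D"
    then have [measurable]: "(\<lambda>c. f c d) \<in> borel_measurable P" using D(2) meas by auto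
    have [measurable]: "(\<lambda>x. x) \<in> restrict_space borel X \<rightarrow>\<^sub>M borel"
      by (rule measurable_restrict_space1) simp
    have [measurable]: "(\<lambda>p. dist (snd p) d) \<in> borel_measurable (P \<Otimes>\<^sub>M restrict_space borel X)"
      by (rule borel_measurable_dist) (auto intro: measurable_compose[OF measurable_snd])
    show "{p \<in> space (P \<Otimes>\<^sub>M restrict_space borel X). f (fst p) d + K * dist (snd p) d < a}
        \<in> sets (P \<Otimes>\<^sub>M restrict_space borel X)" by measurable
  qed
  ultimately show ?thesis by (subst borel_measurable_iff_less) simp
qed

lemma borel_measurable_fst_snd:
  fixes f :: "'w \<Rightarrow> 'a::second_countable_topology \<times> 'b::second_countable_topology"
  assumes "f \<in> borel_measurable M"
  shows "(\<lambda>w. fst (f w)) \<in> borel_measurable M" "(\<lambda>w. snd (f w)) \<in> borel_measurable M"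
  by (rule measurable_compose[OF assms], intro borel_measurable_continuous_onI continuous_intros)+

lemma (in sc_sc) continuous_on_pair: "continuous_on (X \<times> Y) (\<lambda>p. f (fst p) (snd p))"
proof -
  obtain K where K: "\<And>y. y \<in> Y \<Longrightarrow> K-lipschitz_on X (\<lambda>x. f x y)" using lip_x by blast
  obtain K' where K': "\<And>x. x \<in> X \<Longrightarrow> K'-lipschitz_on Y (f x)" using lip_y by blast
  have K0: "K \<ge> 0" "K' \<ge> 0" using K K' X Y by (auto simp: lipschitz_on_def)
  have "(K + K')-lipschitz_on (X \<times> Y) (\<lambda>p. f (fst p) (snd p))"
  proof (rule lipschitz_onI)
    fix p q assume pq: "p \<in> X \<times> Y" "q \<in> X \<times> Y"
    have "dist (f (fst p) (snd p)) (f (fst q) (snd q))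
        \<le> dist (f (fst p) (snd p)) (f (fst q) (snd p)) + dist (f (fst q) (snd p)) (f (fst q) (snd q))"
      by (rule dist_triangle)
    also have "\<dots> \<le> K * dist (fst p) (fst q) + K' * dist (snd p) (snd q)"
      using pq by (intro add_mono lipschitz_onD[OF K] lipschitz_onD[OF K']) auto
    also have "\<dots> \<le> K * dist p q + K' * dist p q"
      using K0 by (intro add_mono mult_left_mono dist_fst_le dist_snd_le)
    finally show "dist (f (fst p) (snd p)) (f (fst q) (snd q)) \<le> (K + K') * dist p q"
      by (simp add: distrib_right)
  qed (use K0 in auto)
  then show ?thesis by (rule lipschitz_on_continuous_on)
qed

lemma (in sc_sc) measurable_compose_pair:
  assumes "a \<in> borel_measurable M" "b \<in> borel_measurable M"
    and "\<And>w. w \<in> space M \<Longrightarrow> a w \<in> X" "\<And>w. w \<in> space M \<Longrightarrow> b w \<in> Y"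
  shows "(\<lambda>w. f (a w) (b w)) \<in> borel_measurable M"
proof -
  have "(\<lambda>w. (a w, b w)) \<in> M \<rightarrow>\<^sub>M restrict_space borel (X \<times> Y)"
    using assms by (intro measurable_restrict_space2 borel_measurable_Pair) auto
  from measurable_compose[OF this borel_measurable_continuous_on_restrict[OF continuous_on_pair]]
  show ?thesis by simp
qed

section \<open>Empirical and expected objectives\<close>

definition empirical :: "('c \<Rightarrow> 'a \<Rightarrow> 'b \<Rightarrow> real) \<Rightarrow> nat \<Rightarrow> (nat \<Rightarrow> 'c) \<Rightarrow> 'a \<Rightarrow> 'b \<Rightarrow> real" where
  "empirical \<Phi> n s x y = (\<Sum>i<n. \<Phi> (s i) x y) / real n"

lemma saa_objective_eq_prox: "saa_objective \<Phi> n lam 0 c 0 s = prox (empirical \<Phi> n s) lam c"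
  by (intro ext) (simp add: saa_objective_def prox_def empirical_def)

lemma strongly_convex_on_average:
  assumes "\<And>i. i < n \<Longrightarrow> strongly_convex_on \<mu> S (f i)" "n > 0"
  shows "strongly_convex_on \<mu> S (\<lambda>x. (\<Sum>i<n. f i x) / real n)"
  unfolding strongly_convex_on_def
proof (intro ballI)
  fix u v and t :: real assume "u \<in> S" "v \<in> S" "t \<in> {0..1}"
  then have "(\<Sum>i<n. f i (t *\<^sub>R u + (1 - t) *\<^sub>R v))
      \<le> (\<Sum>i<n. t * f i u + (1 - t) * f i v - \<mu> / 2 * t * (1 - t) * (norm (u - v))\<^sup>2)"
    using assms(1) by (intro sum_mono) (auto simp: strongly_convex_on_def)
  also have "\<dots> = t * (\<Sum>i<n. f i u) + (1 - t) * (\<Sum>i<n. f i v)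
      - real n * (\<mu> / 2 * t * (1 - t) * (norm (u - v))\<^sup>2)"
    by (simp add: sum_subtractf sum.distrib sum_distrib_left)
  finally have "(\<Sum>i<n. f i (t *\<^sub>R u + (1 - t) *\<^sub>R v)) / real n \<le> \<dots> / real n"
    by (intro divide_right_mono) auto
  also have "\<dots> = t * ((\<Sum>i<n. f i u) / real n) + (1 - t) * ((\<Sum>i<n. f i v) / real n)
      - \<mu> / 2 * t * (1 - t) * (norm (u - v))\<^sup>2"
    using assms(2) by (simp add: add_divide_distrib diff_divide_distrib)
  finally show "(\<Sum>i<n. f i (t *\<^sub>R u + (1 - t) *\<^sub>R v)) / real n
      \<le> t * ((\<Sum>i<n. f i u) / real n) + (1 - t) * ((\<Sum>i<n. f i v) / real n)
      - \<mu> / 2 * t * (1 - t) * (norm (u - v))\<^sup>2" .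
qed

lemma lipschitz_on_average:
  fixes f :: "nat \<Rightarrow> 'a::metric_space \<Rightarrow> real"
  assumes "\<And>i. i < n \<Longrightarrow> K-lipschitz_on S (f i)" "n > 0"
  shows "K-lipschitz_on S (\<lambda>x. (\<Sum>i<n. f i x) / real n)"
proof (rule lipschitz_onI)
  show "K \<ge> 0" using assms(1)[OF assms(2)] by (simp add: lipschitz_on_def)
  fix x y assume xy: "x \<in> S" "y \<in> S"
  have "\<bar>\<Sum>i<n. f i x - f i y\<bar> \<le> (\<Sum>i<n. K * dist x y)"
    using assms(1) xy by (intro order_trans[OF sum_abs] sum_mono) (auto simp: lipschitz_on_def dist_real_def)
  then show "dist ((\<Sum>i<n. f i x) / real n) ((\<Sum>i<n. f i y) / real n) \<le> K * dist x y"
    using assms(2) by (simp add: dist_real_def field_simps sum_subtractf flip: diff_divide_distrib)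
qed

lemma (in prob_space) strongly_convex_on_expectation:
  assumes "\<And>c. strongly_convex_on \<mu> S (f c)" "\<And>x. x \<in> S \<Longrightarrow> integrable M (\<lambda>c. f c x)" "convex S"
  shows "strongly_convex_on \<mu> S (\<lambda>x. \<integral>c. f c x \<partial>M)"
  unfolding strongly_convex_on_def
proof (intro ballI)
  fix u v and t :: real assume uv: "u \<in> S" "v \<in> S" "t \<in> {0..1}"
  have w: "t *\<^sub>R u + (1 - t) *\<^sub>R v \<in> S" using assms(3) uv by (intro convexD) auto
  have "(\<integral>c. f c (t *\<^sub>R u + (1 - t) *\<^sub>R v) \<partial>M)
      \<le> (\<integral>c. t * f c u + (1 - t) * f c v - \<mu> / 2 * t * (1 - t) * (norm (u - v))\<^sup>2 \<partial>M)"
    using assms(1,2) uv w by (intro integral_mono) (auto simp: strongly_convex_on_def)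
  also have "\<dots> = t * (\<integral>c. f c u \<partial>M) + (1 - t) * (\<integral>c. f c v \<partial>M) - \<mu> / 2 * t * (1 - t) * (norm (u - v))\<^sup>2"
    using assms(2) uv by (simp add: prob_space)
  finally show "(\<integral>c. f c (t *\<^sub>R u + (1 - t) *\<^sub>R v) \<partial>M) \<le> \<dots>" .
qed

lemma (in prob_space) lipschitz_on_expectation:
  fixes f :: "'a \<Rightarrow> 'b::metric_space \<Rightarrow> real"
  assumes "\<And>c. K-lipschitz_on S (f c)" "\<And>x. x \<in> S \<Longrightarrow> integrable M (\<lambda>c. f c x)"
  shows "K-lipschitz_on S (\<lambda>x. \<integral>c. f c x \<partial>M)"
proof (rule lipschitz_onI)
  show "K \<ge> 0" using assms(1) by (auto simp: lipschitz_on_def)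
  fix x y assume xy: "x \<in> S" "y \<in> S"
  have "\<bar>\<integral>c. f c x - f c y \<partial>M\<bar> \<le> (\<integral>c. \<bar>f c x - f c y\<bar> \<partial>M)" by (rule integral_abs_bound)
  also have "\<dots> \<le> (\<integral>c. K * dist x y \<partial>M)"
    using assms xy by (intro integral_mono) (auto simp: lipschitz_on_def dist_real_def)
  also have "\<dots> = K * dist x y" by (simp add: prob_space)
  finally show "dist (\<integral>c. f c x \<partial>M) (\<integral>c. f c y \<partial>M) \<le> K * dist x y"
    using assms(2) xy by (simp add: dist_real_def)
qed

text \<open>Write t for K * a + K' * b. Cauchy-Schwarz bounds t^2 by C times the weighted squares,
  and the hypothesis bounds those by r * t, so t cancels once. The outcome is linear in r, and this
  is the source of the rate 1 / n.\<close>

lemma weighted_displacement_bound: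
  fixes \<mu> \<nu> K K' a b r :: real
  assumes "\<mu> > 0" "\<nu> > 0" "a \<ge> 0" "b \<ge> 0" "K \<ge> 0" "K' \<ge> 0" "r \<ge> 0"
    and le: "\<mu> * a\<^sup>2 + \<nu> * b\<^sup>2 \<le> r * (K * a + K' * b)"
  shows "K * a + K' * b \<le> r * (K\<^sup>2 / \<mu> + K'\<^sup>2 / \<nu>)"
proof -
  define t C where "t = K * a + K' * b" and "C = K\<^sup>2 / \<mu> + K'\<^sup>2 / \<nu>"
  have C0: "C \<ge> 0" and t0: "t \<ge> 0" using assms by (auto simp: C_def t_def)
  have "0 \<le> (K * \<nu> * b - K' * \<mu> * a)\<^sup>2 / (\<mu> * \<nu>)" using assms by simp
  also have "\<dots> = C * (\<mu> * a\<^sup>2 + \<nu> * b\<^sup>2) - t\<^sup>2"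
    using assms(1,2) by (simp add: C_def t_def field_simps power2_eq_square)
  finally have "t\<^sup>2 \<le> C * (\<mu> * a\<^sup>2 + \<nu> * b\<^sup>2)" by simp
  also have "\<dots> \<le> C * (r * t)" using le C0 by (intro mult_left_mono) (auto simp: t_def)
  finally have "t * t \<le> t * (r * C)" by (simp add: power2_eq_square mult_ac)
  moreover have "0 \<le> r * C" using C0 assms by simp
  ultimately have "t \<le> r * C" using t0 by (cases "t = 0") auto
  then show ?thesis by (simp add: t_def C_def)
qed

text \<open>The conditions hold for every sample point, not just almost surely, so the empirical
  saddle point exists everywhere and is a function of the sample. The almost sure case reduces to
  this one by changing the objective on a null set.\<close>

locale stochastic_sc_sc =
  fixes P :: "'c measure" and X :: "'a::euclidean_space set" and Y :: "'b::euclidean_space set"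
    and \<Phi> :: "'c \<Rightarrow> 'a \<Rightarrow> 'b \<Rightarrow> real" and \<mu> \<nu> Kx Ky :: real
  assumes P: "prob_space P"
    and X: "compact X" "convex X" "X \<noteq> {}" and Y: "compact Y" "convex Y" "Y \<noteq> {}"
    and pos: "\<mu> > 0" "\<nu> > 0"
    and sc_x: "\<And>z y. y \<in> Y \<Longrightarrow> strongly_convex_on \<mu> X (\<lambda>x. \<Phi> z x y)"
    and sc_y: "\<And>z x. x \<in> X \<Longrightarrow> strongly_concave_on \<nu> Y (\<Phi> z x)"
    and lip_x: "\<And>z y. y \<in> Y \<Longrightarrow> Kx-lipschitz_on X (\<lambda>x. \<Phi> z x y)"
    and lip_y: "\<And>z x. x \<in> X \<Longrightarrow> Ky-lipschitz_on Y (\<Phi> z x)"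
    and integrable: "\<And>x y. x \<in> X \<Longrightarrow> y \<in> Y \<Longrightarrow> integrable P (\<lambda>z. \<Phi> z x y)"
begin

abbreviation "S \<equiv> Pi\<^sub>M UNIV (\<lambda>_::nat. P)"
abbreviation "\<Phi>E \<equiv> expected_objective P \<Phi>"

lemma K_nonneg: "Kx \<ge> 0" "Ky \<ge> 0"
  using lip_x lip_y X Y by (auto simp: lipschitz_on_def)

lemma sc_sc_empirical: "n > 0 \<Longrightarrow> sc_sc X Y \<mu> \<nu> (empirical \<Phi> n s)"
proof unfold_locales
  assume n: "n > 0"
  show "strongly_convex_on \<mu> X (\<lambda>x. empirical \<Phi> n s x y)" if "y \<in> Y" for y
    unfolding empirical_def using n that by (intro strongly_convex_on_average sc_x)
  show "strongly_concave_on \<nu> Y (empirical \<Phi> n s x)" if "x \<in> X" for x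
    using strongly_convex_on_average[of n \<nu> Y "\<lambda>i y. - \<Phi> (s i) x y"] sc_y[OF that] n
    by (simp add: strongly_concave_on_def empirical_def sum_negf)
  show "\<exists>K. \<forall>y\<in>Y. K-lipschitz_on X (\<lambda>x. empirical \<Phi> n s x y)"
    unfolding empirical_def using n by (intro exI[of _ Kx] ballI lipschitz_on_average lip_x)
  show "\<exists>K. \<forall>x\<in>X. K-lipschitz_on Y (empirical \<Phi> n s x)"
    unfolding empirical_def[abs_def] using n by (intro exI[of _ Ky] ballI lipschitz_on_average lip_y)
qed (use X Y pos in auto)

lemma sc_sc_expected: "sc_sc X Y \<mu> \<nu> \<Phi>E"
proof unfold_locales
  interpret prob_space P by (rule P)
  show "strongly_convex_on \<mu> X (\<lambda>x. \<Phi>E x y)" if "y \<in> Y" for y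
    unfolding expected_objective_def using that X by (intro strongly_convex_on_expectation sc_x integrable)
  show "strongly_concave_on \<nu> Y (\<Phi>E x)" if "x \<in> X" for x
    using strongly_convex_on_expectation[of \<nu> Y "\<lambda>z y. - \<Phi> z x y"] sc_y[OF that] integrable that Y
    by (simp add: strongly_concave_on_def expected_objective_def)
  show "\<exists>K. \<forall>y\<in>Y. K-lipschitz_on X (\<lambda>x. \<Phi>E x y)"
    unfolding expected_objective_def by (intro exI[of _ Kx] ballI lipschitz_on_expectation lip_x integrable)
  show "\<exists>K. \<forall>x\<in>X. K-lipschitz_on Y (\<Phi>E x)"
    unfolding expected_objective_def[abs_def] by (intro exI[of _ Ky] ballI lipschitz_on_expectation lip_y integrable)
qed (use X Y pos in auto)

text \<open>Centre and sample form one argument so that joint measurability can be stated. The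
  centre may be any point of the space, not only one of X.\<close>

definition saa_saddle :: "nat \<Rightarrow> real \<Rightarrow> 'a \<times> (nat \<Rightarrow> 'c) \<Rightarrow> 'a \<times> 'b" where
  "saa_saddle n lam p = sc_sc.saddle X Y (prox (empirical \<Phi> n (snd p)) lam (fst p))"

definition prox_saddle :: "real \<Rightarrow> 'a \<Rightarrow> 'a \<times> 'b" where
  "prox_saddle lam c = sc_sc.saddle X Y (prox \<Phi>E lam c)"

definition weak_gap :: "real \<Rightarrow> 'a \<Rightarrow> 'a \<times> 'b \<Rightarrow> real" where
  "weak_gap lam c z = prox \<Phi>E lam c (fst z) (snd (prox_saddle lam c))
     - prox \<Phi>E lam c (fst (prox_saddle lam c)) (snd z)"

context
  fixes lam :: real
  assumes lam: "lam \<ge> 0"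
begin

lemma prox_saddle: "saddle_point X Y (prox \<Phi>E lam c) (fst (prox_saddle lam c)) (snd (prox_saddle lam c))"
  unfolding prox_saddle_def by (rule sc_sc.saddle[OF sc_sc.prox[OF sc_sc_expected lam]])

lemma prox_saddle_in: "fst (prox_saddle lam c) \<in> X" "snd (prox_saddle lam c) \<in> Y"
  using prox_saddle by (auto simp: saddle_point_def)

lemma weak_gap_growth:
  assumes "fst z \<in> X" "snd z \<in> Y"
  shows "(\<mu> + lam) / 2 * (norm (fst z - fst (prox_saddle lam c)))\<^sup>2 \<le> weak_gap lam c z"
proof -
  have "0 \<le> \<nu> / 2 * (norm (snd z - snd (prox_saddle lam c)))\<^sup>2" using pos by simp
  then show ?thesis
    using sc_sc.saddle_growth[OF sc_sc.prox[OF sc_sc_expected lam] prox_saddle[of c] assms]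
    unfolding weak_gap_def by linarith
qed

lemma weak_gap_nonneg: "fst z \<in> X \<Longrightarrow> snd z \<in> Y \<Longrightarrow> 0 \<le> weak_gap lam c z"
  using order_trans[OF _ weak_gap_growth] pos lam by simp

lemma measurable_prox_saddle[measurable]: "prox_saddle lam \<in> borel_measurable borel"
proof (rule measurable_saddle_point[where f="prox \<Phi>E lam" and X=X and Y=Y])
  show "(\<lambda>c. prox \<Phi>E lam c x y) \<in> borel_measurable borel" for x y
    unfolding prox_def by measurable
qed (auto intro: sc_sc.prox[OF sc_sc_expected lam] prox_saddle)

context
  fixes n :: nat
  assumes n: "n > 0"
begin

lemma saa_saddle: "saddle_point X Y (prox (empirical \<Phi> n s) lam c) (fst (saa_saddle n lam (c, s))) (snd (saa_saddle n lam (c, s)))"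
  unfolding saa_saddle_def fst_conv snd_conv by (rule sc_sc.saddle[OF sc_sc.prox[OF sc_sc_empirical[OF n] lam]])

lemma saa_saddle_in: "fst (saa_saddle n lam p) \<in> X" "snd (saa_saddle n lam p) \<in> Y"
  using saa_saddle[of "snd p" "fst p"] by (auto simp: saddle_point_def)

text \<open>Uniqueness of the saddle point makes an SAA call deterministic; in the robust version
  only the extracted indices remain arbitrary.\<close>

lemma saa_eq: "saa X Y \<Phi> n lam 0 c 0 s = {saa_saddle n lam (c, s)}"
proof -
  have eq: "saa X Y \<Phi> n lam 0 c 0 s = {z. saddle_point X Y (prox (empirical \<Phi> n s) lam c) (fst z) (snd z)}"
    by (auto simp: saa_def saa_objective_eq_prox)
  have "z = saa_saddle n lam (c, s)" if "saddle_point X Y (prox (empirical \<Phi> n s) lam c) (fst z) (snd z)" for z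
    using sc_sc.saddle_eqI[OF sc_sc.prox[OF sc_sc_empirical[OF n] lam] that] by (simp add: saa_saddle_def)
  with saa_saddle[of s c] show ?thesis unfolding eq by blast
qed

lemma measurable_saa_saddle[measurable]: "saa_saddle n lam \<in> borel_measurable (borel \<Otimes>\<^sub>M S)"
proof (rule measurable_saddle_point[where f="\<lambda>p. prox (empirical \<Phi> n (snd p)) lam (fst p)" and X=X and Y=Y])
  fix x y assume xy: "x \<in> X" "y \<in> Y"
  have [measurable]: "(\<lambda>z. \<Phi> z x y) \<in> borel_measurable P" using integrable[OF xy] by simp
  show "(\<lambda>p. prox (empirical \<Phi> n (snd p)) lam (fst p) x y) \<in> borel_measurable (borel \<Otimes>\<^sub>M S)"
    unfolding prox_def empirical_def by measurable
next
  fix w show "saddle_point X Y (prox (empirical \<Phi> n (snd w)) lam (fst w)) (fst (saa_saddle n lam w)) (snd (saa_saddle n lam w))"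
    using saa_saddle[of "snd w" "fst w"] by simp
qed (auto intro: sc_sc.prox[OF sc_sc_empirical[OF n] lam])

lemma measurable_weak_gap_saa[measurable]:
  "(\<lambda>p. weak_gap lam (fst p) (saa_saddle n lam p)) \<in> borel_measurable (borel \<Otimes>\<^sub>M S)"
proof -
  note [measurable] = borel_measurable_fst_snd[OF measurable_saa_saddle]
  have "(\<lambda>p. prox_saddle lam (fst p)) \<in> borel_measurable (borel \<Otimes>\<^sub>M S)" by measurable
  note [measurable] = borel_measurable_fst_snd[OF this]
  have [measurable]: "(\<lambda>p. \<Phi>E (fst (saa_saddle n lam p)) (snd (prox_saddle lam (fst p)))) \<in> borel_measurable (borel \<Otimes>\<^sub>M S)"
    "(\<lambda>p. \<Phi>E (fst (prox_saddle lam (fst p))) (snd (saa_saddle n lam p))) \<in> borel_measurable (borel \<Otimes>\<^sub>M S)"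
    by (rule sc_sc.measurable_compose_pair[OF sc_sc_expected]; simp add: saa_saddle_in prox_saddle_in)+
  show ?thesis unfolding weak_gap_def prox_def by measurable
qed

text \<open>Growth of the old objective at the new saddle point is added to growth of the new
  objective at the old one. The proximal terms and all unchanged samples cancel, leaving two sample
  functions divided by n. Their Lipschitz bound is in terms of the displacement itself, which
  \<open>weighted_displacement_bound\<close> then solves for.\<close>

lemma saa_stability:
  fixes c :: 'a and s :: "nat \<Rightarrow> 'c" and d :: 'c
  assumes i: "i < n"
  defines "z \<equiv> saa_saddle n lam (c, s)" and "z' \<equiv> saa_saddle n lam (c, s(i := d))"
  shows "Kx * norm (fst z' - fst z) + Ky * norm (snd z' - snd z)
    \<le> 2 / real n * (Kx\<^sup>2 / (\<mu> + lam) + Ky\<^sup>2 / \<nu>)"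
proof -
  define f f' where "f = prox (empirical \<Phi> n s) lam c" and "f' = prox (empirical \<Phi> n (s(i := d))) lam c"
  obtain x y x' y' where z: "z = (x, y)" "z' = (x', y')" by (cases z, cases z') auto
  have in_XY: "x \<in> X" "y \<in> Y" "x' \<in> X" "y' \<in> Y"
    using saa_saddle_in[of "(c, s)"] saa_saddle_in[of "(c, s(i := d))"] z by (auto simp: z_def z'_def)
  define a b where "a = norm (x' - x)" and "b = norm (y' - y)"
  have "(\<mu> + lam) / 2 * a\<^sup>2 + \<nu> / 2 * b\<^sup>2 \<le> f x' y - f x y'"
    using sc_sc.saddle_growth[OF sc_sc.prox[OF sc_sc_empirical[OF n] lam] saa_saddle[of s c] in_XY(3,4)] z
    by (simp add: a_def b_def f_def z_def)
  moreover have "(\<mu> + lam) / 2 * a\<^sup>2 + \<nu> / 2 * b\<^sup>2 \<le> f' x y' - f' x' y"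
    using sc_sc.saddle_growth[OF sc_sc.prox[OF sc_sc_empirical[OF n] lam] saa_saddle[of "s(i := d)" c] in_XY(1,2)] z
    by (simp add: a_def b_def f'_def z'_def norm_minus_commute)
  moreover have diff: "f u v - f' u v = (\<Phi> (s i) u v - \<Phi> d u v) / real n" for u v
  proof -
    have "(\<Sum>k<n. \<Phi> (s k) u v) - (\<Sum>k<n. \<Phi> ((s(i := d)) k) u v)
        = (\<Sum>k<n. if k = i then \<Phi> (s i) u v - \<Phi> d u v else 0)"
      unfolding sum_subtractf[symmetric] by (intro sum.cong) auto
    also have "\<dots> = \<Phi> (s i) u v - \<Phi> d u v" using i by simp
    finally show ?thesis
      by (simp add: f_def f'_def prox_def empirical_def flip: diff_divide_distrib)
  qed
  \<comment> \<open>Both values are compared with the one at (x, y), so each player moves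
    once.\<close>
  moreover have "\<bar>\<Phi> e x' y - \<Phi> e x y'\<bar> \<le> Kx * a + Ky * b" for e
    using lipschitz_onD[OF lip_x[OF in_XY(2)] in_XY(3,1), of e] lipschitz_onD[OF lip_y[OF in_XY(1)] in_XY(4,2), of e]
    by (simp add: dist_real_def dist_norm a_def b_def)
  then have "(\<Phi> (s i) x' y - \<Phi> (s i) x y') - (\<Phi> d x' y - \<Phi> d x y') \<le> 2 * (Kx * a + Ky * b)"
    by (smt (verit, ccfv_SIG))
  then have "((\<Phi> (s i) x' y - \<Phi> (s i) x y') - (\<Phi> d x' y - \<Phi> d x y')) / real n \<le> 2 * (Kx * a + Ky * b) / real n"
    by (intro divide_right_mono) auto
  moreover have "(f x' y - f x y') + (f' x y' - f' x' y) = ((\<Phi> (s i) x' y - \<Phi> (s i) x y') - (\<Phi> d x' y - \<Phi> d x y')) / real n"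
    using diff[of x' y] diff[of x y'] by (simp add: diff_divide_distrib)
  moreover have "(\<mu> + lam) * a\<^sup>2 + \<nu> * b\<^sup>2
      = ((\<mu> + lam) / 2 * a\<^sup>2 + \<nu> / 2 * b\<^sup>2) + ((\<mu> + lam) / 2 * a\<^sup>2 + \<nu> / 2 * b\<^sup>2)"
    by (simp add: field_simps)
  ultimately have "(\<mu> + lam) * a\<^sup>2 + \<nu> * b\<^sup>2 \<le> 2 * (Kx * a + Ky * b) / real n" by linarith
  then have "(\<mu> + lam) * a\<^sup>2 + \<nu> * b\<^sup>2 \<le> 2 / real n * (Kx * a + Ky * b)" by simp
  from weighted_displacement_bound[OF _ _ _ _ K_nonneg _ this]
  show ?thesis using pos lam by (simp add: z a_def b_def)
qed

text \<open>Since (u, v) does not depend on the sample, \<psi> is one fixed test function and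
  \<open>uniform_stability\<close> applies to it. The proximal part R involves no sample point and
  is carried along outside the average.\<close>

lemma saa_expected_weak_gap:
  "integrable S (\<lambda>s. weak_gap lam c (saa_saddle n lam (c, s)))"
  "(\<integral>s. weak_gap lam c (saa_saddle n lam (c, s)) \<partial>S) \<le> 2 / real n * (Kx\<^sup>2 / (\<mu> + lam) + Ky\<^sup>2 / \<nu>)"
proof -
  interpret P: prob_space P by (rule P)
  interpret S: prob_space S using P by (intro prob_space_PiM)
  interpret E: sc_sc X Y \<mu> \<nu> \<Phi>E by (rule sc_sc_expected)
  define u v where "u = fst (prox_saddle lam c)" and "v = snd (prox_saddle lam c)"
  have uv: "u \<in> X" "v \<in> Y" using prox_saddle_in by (auto simp: u_def v_def)
  \<comment> \<open>Bounds and joint measurability of \<psi> are available only on X \<times> Y,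
    hence the restricted target space.\<close>
  define N where "N = restrict_space (borel :: ('a \<times> 'b) measure) (X \<times> Y)"
  define z where "z s = saa_saddle n lam (c, s)" for s
  have zXY: "fst (z s) \<in> X" "snd (z s) \<in> Y" for s using saa_saddle_in by (auto simp: z_def)
  have zb[measurable]: "z \<in> borel_measurable S" unfolding z_def[abs_def] by measurable
  note [measurable] = borel_measurable_fst_snd[OF zb]
  have z_meas[measurable]: "z \<in> S \<rightarrow>\<^sub>M N"
    unfolding N_def using zb by (rule measurable_restrict_space2[rotated]) (auto simp: mem_Times_iff zXY)
  have spaceN: "space N = X \<times> Y" by (simp add: N_def space_restrict_space)
  define \<psi> where "\<psi> e w = \<Phi> e (fst w) v - \<Phi> e u (snd w)" for e w
  define R where "R w = lam / 2 * (norm (fst w - c))\<^sup>2 - lam / 2 * (norm (u - c))\<^sup>2" for w :: "'a \<times> 'b"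
  obtain BX BY where BXY: "\<And>x x'. x \<in> X \<Longrightarrow> x' \<in> X \<Longrightarrow> dist x x' \<le> BX" "\<And>y y'. y \<in> Y \<Longrightarrow> y' \<in> Y \<Longrightarrow> dist y y' \<le> BY"
    using compact_imp_bounded[OF X(1)] compact_imp_bounded[OF Y(1)] by (metis bounded_two_points)
  define B where "B = Kx * BX + Ky * BY"
  have \<psi>_bound: "\<bar>\<psi> e w\<bar> \<le> B" if w: "w \<in> space N" for e w
  proof -
    have w: "fst w \<in> X" "snd w \<in> Y" using w by (auto simp: spaceN)
    have "\<bar>\<psi> e w\<bar> \<le> Kx * dist (fst w) u + Ky * dist v (snd w)"
      using lipschitz_onD[OF lip_x[OF uv(2)] w(1) uv(1), of e] lipschitz_onD[OF lip_y[OF uv(1)] uv(2) w(2), of e]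
      by (simp add: \<psi>_def dist_real_def)
    also have "\<dots> \<le> B" unfolding B_def using K_nonneg uv w by (intro add_mono mult_left_mono BXY)
    finally show ?thesis .
  qed
  have \<psi>_meas: "(\<lambda>(e, w). \<psi> e w) \<in> borel_measurable (P \<Otimes>\<^sub>M N)"
  proof -
    have "(\<lambda>w. fst w) \<in> N \<rightarrow>\<^sub>M restrict_space borel X" "(\<lambda>w. snd w) \<in> N \<rightarrow>\<^sub>M restrict_space borel Y"
      unfolding N_def by (rule measurable_restrict_space3, rule borel_measurable_fst_snd, simp, force)+
    then have pair: "(\<lambda>p. (fst p, fst (snd p))) \<in> P \<Otimes>\<^sub>M N \<rightarrow>\<^sub>M P \<Otimes>\<^sub>M restrict_space borel X"
      "(\<lambda>p. (fst p, snd (snd p))) \<in> P \<Otimes>\<^sub>M N \<rightarrow>\<^sub>M P \<Otimes>\<^sub>M restrict_space borel Y"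
      by measurable
    have "(\<lambda>p. \<Phi> (fst p) (snd p) v) \<in> borel_measurable (P \<Otimes>\<^sub>M restrict_space borel X)"
      "(\<lambda>p. \<Phi> (fst p) u (snd p)) \<in> borel_measurable (P \<Otimes>\<^sub>M restrict_space borel Y)"
      using uv integrable lip_x lip_y
      by (auto intro!: lipschitz_on_measurable_Pair[where f="\<lambda>e x. \<Phi> e x v"] lipschitz_on_measurable_Pair[where f="\<lambda>e. \<Phi> e u"])
    from measurable_compose[OF pair(1) this(1)] measurable_compose[OF pair(2) this(2)]
    have "(\<lambda>p. \<Phi> (fst p) (fst (snd p)) v) \<in> borel_measurable (P \<Otimes>\<^sub>M N)"
      "(\<lambda>p. \<Phi> (fst p) u (snd (snd p))) \<in> borel_measurable (P \<Otimes>\<^sub>M N)"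
      by simp_all
    then show ?thesis unfolding \<psi>_def split_beta by measurable
  qed
  define \<beta> where "\<beta> = 2 / real n * (Kx\<^sup>2 / (\<mu> + lam) + Ky\<^sup>2 / \<nu>)"
  have stable: "\<psi> (s i) (z (s(i := d))) \<le> \<psi> (s i) (z s) + \<beta>" if i: "i < n" for d s i
  proof -
    let ?z = "z s" and ?z' = "z (s(i := d))"
    have "\<psi> (s i) ?z' - \<psi> (s i) ?z \<le> Kx * norm (fst ?z' - fst ?z) + Ky * norm (snd ?z' - snd ?z)"
      using lipschitz_onD[OF lip_x[OF uv(2)] zXY(1) zXY(1), of "s i" "s(i := d)" s]
        lipschitz_onD[OF lip_y[OF uv(1)] zXY(2) zXY(2), of "s i" "s(i := d)" s]
      by (simp add: \<psi>_def dist_real_def dist_norm)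
    also have "\<dots> \<le> \<beta>" using saa_stability[OF i] by (simp add: z_def \<beta>_def)
    finally show ?thesis by simp
  qed
  have gen: "(\<integral>s. (\<integral>e. \<psi> e (z s) \<partial>P) \<partial>S) \<le> (\<integral>s. (\<Sum>i<n. \<psi> (s i) (z s)) / n \<partial>S) + \<beta>"
    by (rule uniform_stability[OF P \<psi>_meas z_meas \<psi>_bound _ n]) (auto simp: stable)
  have gap_eq: "weak_gap lam c (z s) = (\<integral>e. \<psi> e (z s) \<partial>P) + R (z s)" for s
    using integrable zXY uv
    by (simp add: weak_gap_def prox_def \<psi>_def R_def expected_objective_def flip: u_def v_def)
  \<comment> \<open>The empirical saddle point has nonpositive empirical gap against every fixed
    pair, in particular against (u, v), so only the stability term \<beta> survives.\<close>
  have emp: "(\<Sum>i<n. \<psi> (s i) (z s)) / n + R (z s) \<le> 0" for s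
  proof -
    have "(\<Sum>i<n. \<psi> (s i) (z s)) / n + R (z s)
        = prox (empirical \<Phi> n s) lam c (fst (z s)) v - prox (empirical \<Phi> n s) lam c u (snd (z s))"
      by (simp add: \<psi>_def R_def prox_def empirical_def sum_subtractf diff_divide_distrib)
    then show ?thesis
      using saa_saddle[of s c] uv unfolding saddle_point_def z_def by fastforce
  qed
  have "bounded ((\<lambda>x. x - c) ` X)"
    using X(1) by (intro compact_imp_bounded compact_continuous_image continuous_intros) auto
  then obtain r where r: "\<And>x. x \<in> X \<Longrightarrow> norm (x - c) \<le> r" unfolding bounded_iff by auto
  have R_int: "integrable S (\<lambda>s. R (z s))"
  proof (rule S.integrable_const_bound)
    have "\<bar>R (z s)\<bar> \<le> lam / 2 * r\<^sup>2 + lam / 2 * r\<^sup>2" for s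
    proof -
      have "lam / 2 * (norm (fst (z s) - c))\<^sup>2 \<le> lam / 2 * r\<^sup>2" "lam / 2 * (norm (u - c))\<^sup>2 \<le> lam / 2 * r\<^sup>2"
        using r[OF zXY(1)] r[OF uv(1)] lam by (auto intro!: mult_left_mono power_mono)
      moreover have "0 \<le> lam / 2 * (norm (fst (z s) - c))\<^sup>2" "0 \<le> lam / 2 * (norm (u - c))\<^sup>2"
        using lam by auto
      ultimately show ?thesis unfolding R_def by linarith
    qed
    then show "AE s in S. norm (R (z s)) \<le> lam / 2 * r\<^sup>2 + lam / 2 * r\<^sup>2" by simp
    show "(\<lambda>s. R (z s)) \<in> borel_measurable S" unfolding R_def by measurable
  qed
  have \<psi>_comp[measurable]: "(\<lambda>s. \<psi> (s i) (z s)) \<in> borel_measurable S" for i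
    using measurable_compose[OF measurable_Pair[of "\<lambda>s. s i" S P, OF _ z_meas] \<psi>_meas] by simp
  have zN: "z s \<in> space N" for s using zXY by (simp add: spaceN mem_Times_iff)
  have \<psi>_int: "integrable S (\<lambda>s. (\<Sum>i<n. \<psi> (s i) (z s)) / n)"
    by (intro integrable_divide Bochner_Integration.integrable_sum S.integrable_const_bound[of _ B])
      (auto simp: \<psi>_bound zN)
  have gap_meas[measurable]: "(\<lambda>s. weak_gap lam c (z s)) \<in> borel_measurable S"
    using measurable_compose[OF measurable_Pair1'[of c borel S] measurable_weak_gap_saa] by (simp add: z_def)
  have "\<bar>\<integral>e. \<psi> e (z s) \<partial>P\<bar> \<le> B" for s
  proof -
    have int: "integrable P (\<lambda>e. \<psi> e (z s))" unfolding \<psi>_def using integrable zXY uv by auto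
    have "(\<integral>e. \<psi> e (z s) \<partial>P) \<le> B" "- B \<le> (\<integral>e. \<psi> e (z s) \<partial>P)"
      using \<psi>_bound[OF zN, of _ s]
      by (auto intro!: P.integral_le_const[OF int] P.integral_ge_const[OF int] AE_I2 simp: abs_le_iff minus_le_iff)
    then show ?thesis by simp
  qed
  moreover
  have "(\<lambda>s. \<integral>e. \<psi> e (z s) \<partial>P) \<in> borel_measurable S"
    using borel_measurable_diff[OF gap_meas borel_measurable_integrable[OF R_int]] by (simp add: gap_eq)
  ultimately have E_int: "integrable S (\<lambda>s. \<integral>e. \<psi> e (z s) \<partial>P)"
    by (intro S.integrable_const_bound[of _ B]) auto
  show "integrable S (\<lambda>s. weak_gap lam c (saa_saddle n lam (c, s)))"
    unfolding z_def[symmetric] gap_eq using E_int R_int by simp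
  have "(\<integral>s. weak_gap lam c (saa_saddle n lam (c, s)) \<partial>S) = (\<integral>s. (\<integral>e. \<psi> e (z s) \<partial>P) \<partial>S) + (\<integral>s. R (z s) \<partial>S)"
    unfolding z_def[symmetric] gap_eq using E_int R_int by simp
  also have "\<dots> \<le> (\<integral>s. (\<Sum>i<n. \<psi> (s i) (z s)) / n + R (z s) \<partial>S) + \<beta>"
    using gen \<psi>_int R_int by simp
  also have "\<dots> \<le> (\<integral>s. 0 \<partial>S) + \<beta>"
    using \<psi>_int R_int emp by (intro add_mono integral_mono) auto
  finally show "(\<integral>s. weak_gap lam c (saa_saddle n lam (c, s)) \<partial>S) \<le> 2 / real n * (Kx\<^sup>2 / (\<mu> + lam) + Ky\<^sup>2 / \<nu>)"
    by (simp add: \<beta>_def)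
qed

end

end

end

section \<open>The rounds of BoostSAA-C\<close>

lemma sample_size:
  assumes "e > 0" "(C::real) > 0"
  shows "0 < nat \<lceil>2 / e * C\<rceil>" "2 / real (nat \<lceil>2 / e * C\<rceil>) * C \<le> e"
proof -
  have pos: "2 / e * C > 0" using assms by simp
  then show n: "0 < nat \<lceil>2 / e * C\<rceil>" by simp
  define N where "N = nat \<lceil>2 / e * C\<rceil>"
  have "2 / e * C \<le> real N" "0 < N" using n unfolding N_def by linarith+
  then have "2 / real N * C \<le> e" using assms by (simp add: field_simps)
  then show "2 / real (nat \<lceil>2 / e * C\<rceil>) * C \<le> e" by (simp only: N_def)
qed

lemma majority_complement:
  assumes "\<not> real m / 2 \<le> real (card {j. j < m \<and> A j})" "\<And>j. j < m \<Longrightarrow> \<not> A j \<Longrightarrow> Q j"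
  shows "real m / 2 < real (card {j. j < m \<and> Q j})"
proof -
  have "{..<m} = {j. j < m \<and> A j} \<union> {j. j < m \<and> \<not> A j}" by auto
  then have "m \<le> card {j. j < m \<and> A j} + card {j. j < m \<and> \<not> A j}"
    using card_Un_le[of "{j. j < m \<and> A j}" "{j. j < m \<and> \<not> A j}"] by (metis card_lessThan)
  moreover have "card {j. j < m \<and> \<not> A j} \<le> card {j. j < m \<and> Q j}"
    using assms(2) by (intro card_mono) auto
  ultimately show ?thesis using assms(1) by linarith
qed

lemma fresh_samples_space:
  assumes "fresh_samples M F P \<xi>" "\<omega> \<in> space M"
  shows "\<xi> r i \<omega> \<in> space P"
proof -
  have "\<xi> r i \<in> F (Suc r) \<rightarrow>\<^sub>M P" "space (F (Suc r)) = space M"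
    using assms(1) unfolding fresh_samples_def filtration_def by blast+
  then show ?thesis using assms(2) by (auto dest: measurable_space)
qed

text \<open>The sample size makes the expected squared error of one average at most d^2 / 3, so
  Markov's inequality for that square gives failure probability 1/3. The evaluation point is known
  before round r and hence independent of the gradient batch.\<close>

lemma gradient_round:
  fixes G :: "'c \<Rightarrow> 'a::euclidean_space \<Rightarrow> 'b::euclidean_space \<Rightarrow> 'v::euclidean_space"
  assumes M: "prob_space M" and P: "prob_space P" and fresh: "fresh_samples M F P \<xi>" and m: "m > 0"
    and xG: "xG \<in> F r \<rightarrow>\<^sub>M restrict_space borel X" and yG: "yG \<in> F r \<rightarrow>\<^sub>M restrict_space borel Y"
    and G: "(\<lambda>(z, x, y). G z x y) \<in> borel_measurable (P \<Otimes>\<^sub>M restrict_space borel X \<Otimes>\<^sub>M restrict_space borel Y)"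
    and mean: "\<And>x y. x \<in> X \<Longrightarrow> y \<in> Y \<Longrightarrow> has_bochner_integral P (\<lambda>z. G z x y) (g x y)"
    and var: "\<And>x y. x \<in> X \<Longrightarrow> y \<in> Y \<Longrightarrow>
       (\<integral>\<^sup>+z. ennreal ((norm (G z x y - g x y))\<^sup>2) \<partial>P) \<le> ennreal (\<sigma>\<^sup>2)"
    and pos: "\<sigma> > 0" "d > 0"
  obtains A where "A \<in> sets M" "measure M A \<le> exp (- real m / 18)"
    "\<And>\<omega> v. \<omega> \<in> space M \<Longrightarrow> \<omega> \<notin> A \<Longrightarrow> xG \<omega> \<in> X \<Longrightarrow> yG \<omega> \<in> Y \<Longrightarrow>
       v \<in> gradient G \<sigma> d m (xG \<omega>) (yG \<omega>) (\<lambda>j k. \<xi> r (b, j, k) \<omega>) \<Longrightarrow>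
       dist v (g (xG \<omega>) (yG \<omega>)) \<le> 3 * d"
proof -
  let ?S = "Pi\<^sub>M UNIV (\<lambda>_::nat. P)"
  define N where "N = restrict_space (borel :: 'a measure) X \<Otimes>\<^sub>M restrict_space (borel :: 'b measure) Y"
  interpret P: prob_space P by (rule P)
  define n where "n = nat \<lceil>3 * \<sigma>\<^sup>2 / d\<^sup>2\<rceil>"
  have "3 * \<sigma>\<^sup>2 / d\<^sup>2 > 0" using pos by simp
  then have n: "n > 0" and n_ge: "3 * \<sigma>\<^sup>2 / d\<^sup>2 \<le> real n" unfolding n_def by (simp, linarith)
  define avg where "avg x y s = (1 / real n) *\<^sub>R (\<Sum>i<n. G (s i) x y)" for x y and s :: "nat \<Rightarrow> 'c"
  have G'[measurable]: "(\<lambda>p. G (fst p) (fst (snd p)) (snd (snd p))) \<in> borel_measurable (P \<Otimes>\<^sub>M N)"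
    using G by (simp add: case_prod_unfold N_def)
  have G_raw: "(\<lambda>x. G (a x) (fst (w x)) (snd (w x))) \<in> borel_measurable L"
    if "a \<in> L \<rightarrow>\<^sub>M P" "w \<in> L \<rightarrow>\<^sub>M N" for a w and L :: "'l measure"
    using measurable_compose[OF measurable_Pair[OF that] G'] by simp
  have space_N: "space N = X \<times> Y" by (simp add: N_def space_pair_measure space_restrict_space)
  \<comment> \<open>The mean g inherits measurability from G, being its integral over the
    sample.\<close>
  have "(\<lambda>w. \<integral>z. G z (fst w) (snd w) \<partial>P) \<in> borel_measurable N"
    by (rule P.borel_measurable_lebesgue_integral) (unfold case_prod_unfold, rule G_raw, auto)
  moreover have "(\<integral>z. G z (fst w) (snd w) \<partial>P) = g (fst w) (snd w)" if "w \<in> space N" for w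
    using mean[of "fst w" "snd w"] that by (auto simp: space_N has_bochner_integral_iff)
  ultimately have g[measurable]: "(\<lambda>w. g (fst w) (snd w)) \<in> borel_measurable N"
    by (simp cong: measurable_cong)
  define B where "B = {p \<in> space (N \<Otimes>\<^sub>M ?S). d\<^sup>2 \<le> (norm (avg (fst (fst p)) (snd (fst p)) (snd p) - g (fst (fst p)) (snd (fst p))))\<^sup>2}"
  have avg_meas: "(\<lambda>p. avg (fst (fst p)) (snd (fst p)) (snd p)) \<in> borel_measurable (N \<Otimes>\<^sub>M ?S)"
    unfolding avg_def by (intro borel_measurable_scaleR borel_measurable_const borel_measurable_sum G_raw) measurable
  have B: "B \<in> sets (N \<Otimes>\<^sub>M ?S)"
    unfolding B_def using avg_meas measurable_compose[OF measurable_fst g]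
    by (intro borel_measurable_le borel_measurable_const borel_measurable_power borel_measurable_norm borel_measurable_diff) auto
  have fail: "measure ?S (Pair w -` B) \<le> 1 / 3" if w: "w \<in> space N" for w
  proof -
    obtain x y where xy: "w = (x, y)" "x \<in> X" "y \<in> Y" using w by (auto simp: space_N)
    note var_avg = sample_mean_variance[OF P mean[OF xy(2,3)] var[OF xy(2,3)] _ n, folded avg_def]
    have "measure ?S {s \<in> space ?S. d\<^sup>2 \<le> (norm (avg x y s - g x y))\<^sup>2} \<le> (\<integral>s. (norm (avg x y s - g x y))\<^sup>2 \<partial>?S) / d\<^sup>2"
      using pos var_avg(1) by (intro integral_Markov_inequality_measure[where A="{}"]) auto
    also have "\<dots> \<le> \<sigma>\<^sup>2 / n / d\<^sup>2"
      using var_avg(2) by (intro divide_right_mono) auto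
    also have "\<dots> \<le> 1 / 3" using n n_ge pos by (simp add: field_simps)
    also have "{s \<in> space ?S. d\<^sup>2 \<le> (norm (avg x y s - g x y))\<^sup>2} = Pair w -` B"
      using w by (auto simp: B_def xy space_pair_measure)
    finally show ?thesis .
  qed
  define W where "W \<omega> = (xG \<omega>, yG \<omega>)" for \<omega>
  have W: "W \<in> F r \<rightarrow>\<^sub>M N" unfolding W_def N_def using xG yG by measurable
  define A where "A = {\<omega> \<in> space M. real m / 2 \<le> real (card {j. j < m \<and> (W \<omega>, \<lambda>k. \<xi> r (b, j, k) \<omega>) \<in> B})}"
  show ?thesis
  proof (rule that)
    show "A \<in> sets M" "measure M A \<le> exp (- real m / 18)"
      unfolding A_def by (rule fresh_samples_majority[OF M P fresh W B m fail]; assumption)+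
    fix \<omega> v assume \<omega>: "\<omega> \<in> space M" "\<omega> \<notin> A" "xG \<omega> \<in> X" "yG \<omega> \<in> Y"
      and v: "v \<in> gradient G \<sigma> d m (xG \<omega>) (yG \<omega>) (\<lambda>j k. \<xi> r (b, j, k) \<omega>)"
    define h where "h j = avg (xG \<omega>) (yG \<omega>) (\<lambda>k. \<xi> r (b, j, k) \<omega>)" for j
    obtain k where k: "k \<in> extract_idx m dist h" "v = h k"
      using v by (auto simp: gradient_def Let_def n_def[symmetric] h_def[abs_def] avg_def)
    have "\<not> real m / 2 \<le> real (card {j. j < m \<and> (W \<omega>, \<lambda>k. \<xi> r (b, j, k) \<omega>) \<in> B})"
      using \<omega> by (simp add: A_def)
    then have "real m / 2 < real (card {j. j < m \<and> dist (h j) (g (xG \<omega>) (yG \<omega>)) \<le> d})"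
    proof (rule majority_complement)
      fix j assume "(W \<omega>, \<lambda>k. \<xi> r (b, j, k) \<omega>) \<notin> B"
      moreover have "(W \<omega>, \<lambda>k. \<xi> r (b, j, k) \<omega>) \<in> space (N \<Otimes>\<^sub>M ?S)"
        using \<omega> fresh_samples_space[OF fresh] by (auto simp: space_pair_measure space_N W_def space_PiM)
      ultimately have "(norm (h j - g (xG \<omega>) (yG \<omega>)))\<^sup>2 < d\<^sup>2"
        by (auto simp: B_def W_def h_def)
      then show "dist (h j) (g (xG \<omega>) (yG \<omega>)) \<le> d"
        using pos power_less_imp_less_base[of "norm (h j - g (xG \<omega>) (yG \<omega>))" 2 d] by (simp add: dist_norm)
    qed
    then show "dist v (g (xG \<omega>) (yG \<omega>)) \<le> 3 * d"
      unfolding k(2) by (rule extract_idx_dist[OF k(1)])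
  qed
qed

section \<open>One round of SAA calls, and the composition of all rounds for one player\<close>

context stochastic_sc_sc begin

text \<open>The weak gap is nonnegative with expectation at most e, so by Markov it reaches 3 * e
  with probability at most 1/3, for every fixed centre. The random centre W is known before the
  round, and \<open>fresh_samples_majority\<close> handles the rest.\<close>

lemma saa_round:
  assumes M: "prob_space M" and fresh: "fresh_samples M F P \<xi>" and m: "m > 0"
    and W: "W \<in> borel_measurable (F r)" and lam: "lam \<ge> 0" and n: "n > 0" and e: "e > 0"
    and size: "2 / real n * (Kx\<^sup>2 / (\<mu> + lam) + Ky\<^sup>2 / \<nu>) \<le> e"
  obtains A where "A \<in> sets M" "measure M A \<le> exp (- real m / 18)"
    "\<And>\<omega>. \<omega> \<in> space M \<Longrightarrow> \<omega> \<notin> A \<Longrightarrow> real m / 2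
       < real (card {j. j < m \<and> weak_gap lam (W \<omega>) (saa_saddle n lam (W \<omega>, \<lambda>k. \<xi> r (b, j, k) \<omega>)) \<le> 3 * e})"
proof -
  define B where "B = {p \<in> space (borel \<Otimes>\<^sub>M S). 3 * e \<le> weak_gap lam (fst p) (saa_saddle n lam p)}"
  have B: "B \<in> sets (borel \<Otimes>\<^sub>M S)"
    unfolding B_def by (intro borel_measurable_le borel_measurable_const measurable_weak_gap_saa lam n)
  have fail: "measure S (Pair c -` B) \<le> 1 / 3" for c
  proof -
    let ?g = "\<lambda>s. weak_gap lam c (saa_saddle n lam (c, s))"
    have "measure S {s \<in> space S. 3 * e \<le> ?g s} \<le> (\<integral>s. ?g s \<partial>S) / (3 * e)"
      using e weak_gap_nonneg[OF lam saa_saddle_in[OF lam n]]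
      by (intro integral_Markov_inequality_measure[where A="{}"] saa_expected_weak_gap(1) lam n) auto
    also have "\<dots> \<le> e / (3 * e)"
      using e saa_expected_weak_gap(2)[OF lam n, of c] size by (intro divide_right_mono) auto
    also have "\<dots> = 1 / 3" using e by simp
    also have "{s \<in> space S. 3 * e \<le> ?g s} = Pair c -` B" by (auto simp: B_def space_pair_measure)
    finally show ?thesis .
  qed
  define A where "A = {\<omega> \<in> space M. real m / 2 \<le> real (card {j. j < m \<and> (W \<omega>, \<lambda>k. \<xi> r (b, j, k) \<omega>) \<in> B})}"
  show ?thesis
  proof (rule that)
    show "A \<in> sets M" "measure M A \<le> exp (- real m / 18)"
      unfolding A_def by (rule fresh_samples_majority[OF M P fresh W B m fail])+
    fix \<omega> assume \<omega>: "\<omega> \<in> space M" "\<omega> \<notin> A"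
    then have "\<not> real m / 2 \<le> real (card {j. j < m \<and> (W \<omega>, \<lambda>k. \<xi> r (b, j, k) \<omega>) \<in> B})"
      by (simp add: A_def)
    then show "real m / 2
       < real (card {j. j < m \<and> weak_gap lam (W \<omega>) (saa_saddle n lam (W \<omega>, \<lambda>k. \<xi> r (b, j, k) \<omega>)) \<le> 3 * e})"
    proof (rule majority_complement)
      fix j assume "(W \<omega>, \<lambda>k. \<xi> r (b, j, k) \<omega>) \<notin> B"
      then show "weak_gap lam (W \<omega>) (saa_saddle n lam (W \<omega>, \<lambda>k. \<xi> r (b, j, k) \<omega>)) \<le> 3 * e"
        using \<omega> fresh_samples_space[OF fresh] by (auto simp: B_def space_pair_measure space_PiM)
    qed
  qed
qed

lemma robust_saa_close:
  assumes lam: "lam \<ge> 0" and n: "n > 0"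
    and maj: "real m / 2 < real (card {j. j < m \<and> weak_gap lam c (saa_saddle n lam (c, s j)) \<le> 3 * e})"
    and x: "x \<in> fst ` robust_saa X Y \<Phi> n m lam 0 c 0 s"
  shows "(\<mu> + lam) / 2 * (norm (x - fst (prox_saddle lam c)))\<^sup>2 \<le> 27 * e"
proof -
  from x obtain xh yh k where "\<forall>j<m. (xh j, yh j) \<in> saa X Y \<Phi> n lam 0 c 0 (s j)"
    and k: "k \<in> extract_idx m dist xh" "x = xh k"
    unfolding robust_saa_def by force
  then have xh: "(xh j, yh j) \<in> saa X Y \<Phi> n lam 0 c 0 (s j)" if "j < m" for j using that by blast
  let ?u = "fst (prox_saddle lam c)"
  define r where "r = sqrt (6 * e / (\<mu> + lam))"
  have pos': "\<mu> + lam > 0" using pos lam by simp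
  have good: "dist (xh j) ?u \<le> r \<and> 0 \<le> e" if j: "j < m" "weak_gap lam c (saa_saddle n lam (c, s j)) \<le> 3 * e" for j
  proof -
    have eq: "saa_saddle n lam (c, s j) = (xh j, yh j)" using xh[OF j(1)] by (simp add: saa_eq[OF lam n])
    have in_XY: "fst (xh j, yh j) \<in> X" "snd (xh j, yh j) \<in> Y"
      using saa_saddle_in[OF lam n, of "(c, s j)"] by (simp_all add: eq)
    have "(\<mu> + lam) / 2 * (norm (xh j - ?u))\<^sup>2 \<le> 3 * e"
      using weak_gap_growth[OF lam in_XY, of c] j(2) by (simp add: eq)
    then have "(norm (xh j - ?u))\<^sup>2 \<le> 6 * e / (\<mu> + lam)" using pos' by (simp add: pos_le_divide_eq mult.commute)
    moreover have "0 \<le> e" using weak_gap_nonneg[OF lam in_XY, of c] j(2) by (simp add: eq)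
    ultimately show ?thesis by (auto simp: r_def dist_norm intro: real_le_rsqrt)
  qed
  have "card {j. j < m \<and> weak_gap lam c (saa_saddle n lam (c, s j)) \<le> 3 * e} \<le> card {j. j < m \<and> dist (xh j) ?u \<le> r}"
    using good by (intro card_mono) auto
  then have "dist x ?u \<le> 3 * r" unfolding k(2) using maj by (intro extract_idx_dist[OF k(1)]) linarith
  then have "(norm (x - ?u))\<^sup>2 \<le> (3 * r)\<^sup>2" by (intro power_mono) (auto simp: dist_norm)
  \<comment> \<open>A majority contains at least one good index, and its nonnegative weak gap forces
    the sign of e. The sign is needed to square the root in r back.\<close>
  also have "e \<ge> 0"
  proof -
    have "{j. j < m \<and> weak_gap lam c (saa_saddle n lam (c, s j)) \<le> 3 * e} \<noteq> {}"
      using maj by (metis card.empty divide_less_0_iff not_numeral_less_zero of_nat_0 of_nat_less_0_iff)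
    then show ?thesis using good by auto
  qed
  then have "(3 * r)\<^sup>2 = 54 * e / (\<mu> + lam)" using pos' by (simp add: r_def power_mult_distrib)
  finally have "(norm (x - ?u))\<^sup>2 \<le> 54 * e / (\<mu> + lam)" .
  then show ?thesis using pos' by (simp add: field_simps)
qed

text \<open>The proximal term shifts both \<mu> and Lx by lam. It depends on x alone, so Lxy and
  \<nu> stay. The calls run with accuracy e / 3 because the Markov threshold multiplies it by 3, and
  the good indices then have gap at most e.\<close>

lemma function_gap_x_bound:
  assumes lam: "lam \<ge> 0" and L: "Lx > 0" "Lxy > 0" and K: "Kx > 0" "Ky > 0" and e: "e > 0"
    and grad: "\<And>x y. x \<in> X \<Longrightarrow> y \<in> Y \<Longrightarrow> has_gradient_within (\<lambda>x'. \<Phi>E x' y) (gx x y) x X"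
    and smooth_xx: "\<And>x1 x2 y. x1 \<in> X \<Longrightarrow> x2 \<in> X \<Longrightarrow> y \<in> Y \<Longrightarrow> norm (gx x1 y - gx x2 y) \<le> Lx * norm (x1 - x2)"
    and smooth_xy: "\<And>x y1 y2. x \<in> X \<Longrightarrow> y1 \<in> Y \<Longrightarrow> y2 \<in> Y \<Longrightarrow> norm (gx x y1 - gx x y2) \<le> Lxy * norm (y1 - y2)"
    and maj: "real m / 2 < real (card {j. j < m \<and>
       weak_gap lam c (saa_saddle (nat \<lceil>2 / (e / 3) * (Kx\<^sup>2 / (\<mu> + lam) + Ky\<^sup>2 / \<nu>)\<rceil>) lam (c, s j)) \<le> 3 * (e / 3)})"
    and gradient: "\<And>v. v \<in> gradient Gx (2 * Kx) ((Lx + lam) * sqrt (e / (\<mu> + lam))) m xG yG sG \<Longrightarrow>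
       dist v (gx xG yG) \<le> 3 * ((Lx + lam) * sqrt (e / (\<mu> + lam)))"
    and x: "x \<in> function_gap_x X Y \<Phi> Gx \<mu> \<nu> Lx Kx Ky lam c e m s sG xG yG"
    and y: "y \<in> Y"
  shows "prox \<Phi>E lam c x y - prox \<Phi>E lam c (fst (prox_saddle lam c)) (snd (prox_saddle lam c))
    \<le> gap_const Lx Lxy \<mu> \<nu> lam * e"
proof -
  define n where "n = nat \<lceil>2 / (e / 3) * (Kx\<^sup>2 / (\<mu> + lam) + Ky\<^sup>2 / \<nu>)\<rceil>"
  have n: "n > 0" unfolding n_def by (rule sample_size(1)) (use e K pos lam in \<open>auto intro!: add_pos_pos\<close>)
  from x obtain xh yh k1 k2 g k3 where x_eq: "x = xh k3"
    and xh: "\<And>j. j < m \<Longrightarrow> (xh j, yh j) \<in> weak_saa_x X Y \<Phi> \<mu> \<nu> Kx Ky lam c (e / 3) (s j)"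
    and k1: "k1 \<in> extract_idx m dist xh" "xG = xh k1"
    and k2: "k2 \<in> extract_idx m dist yh" "yG = yh k2"
    and g: "g \<in> gradient Gx (2 * Kx) ((Lx + lam) * sqrt (e / (\<mu> + lam))) m xG yG sG"
    and k3: "k3 \<in> extract_idx m dist xh"
      "k3 \<in> extract_idx m (\<lambda>x1 x2. \<bar>(g + lam *\<^sub>R (xG - c)) \<bullet> (x1 - x2)\<bar>) xh"
    unfolding function_gap_x_def Let_def by blast
  have eq: "saa_saddle n lam (c, s j) = (xh j, yh j)" if "j < m" for j
    using xh[OF that, unfolded weak_saa_x_def, folded n_def, unfolded saa_eq[OF lam n]] by simp
  interpret R: sc_sc X Y "\<mu> + lam" \<nu> "prox \<Phi>E lam c" by (rule sc_sc.prox[OF sc_sc_expected lam])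
  let ?u = "fst (prox_saddle lam c)" and ?v = "snd (prox_saddle lam c)"
  let ?g = "\<lambda>x y. gx x y + lam *\<^sub>R (x - c)"
  have "prox \<Phi>E lam c (xh k3) y - prox \<Phi>E lam c ?u ?v
    \<le> (3 + (18 * sqrt 2 + 45) * ((Lx + lam) / (\<mu> + lam)) + 36 * Lxy / sqrt ((\<mu> + lam) * \<nu>)
        + 9 * Lxy\<^sup>2 / ((\<mu> + lam) * \<nu>)) * e"
  proof (rule R.function_gap_bound[where g="?g" and w="g + lam *\<^sub>R (xG - c)" and yh=yh and m=m])
    show "saddle_point X Y (prox \<Phi>E lam c) ?u ?v" by (rule prox_saddle[OF lam])
    show "has_gradient_within (\<lambda>x. prox \<Phi>E lam c x y) (?g x y) x X" if "x \<in> X" "y \<in> Y" for x y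
      by (intro has_gradient_within_prox grad that)
    show "norm (?g x1 y - ?g x2 y) \<le> (Lx + lam) * norm (x1 - x2)" if "x1 \<in> X" "x2 \<in> X" "y \<in> Y" for x1 x2 y
    proof -
      have eq: "?g x1 y - ?g x2 y = (gx x1 y - gx x2 y) + lam *\<^sub>R (x1 - x2)" by (simp add: algebra_simps)
      show ?thesis
        unfolding eq using norm_triangle_ineq[of "gx x1 y - gx x2 y" "lam *\<^sub>R (x1 - x2)"] smooth_xx[OF that] lam
        by (simp add: distrib_right)
    qed
    show "norm (?g x y1 - ?g x y2) \<le> Lxy * norm (y1 - y2)" if "x \<in> X" "y1 \<in> Y" "y2 \<in> Y" for x y1 y2
      using smooth_xy[OF that] by simp
    show "xh j \<in> X" "yh j \<in> Y" if "j < m" for j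
      using saa_saddle_in[OF lam n, of "(c, s j)"] by (simp_all add: eq[OF that])
    have "{j. j < m \<and> weak_gap lam c (saa_saddle n lam (c, s j)) \<le> 3 * (e / 3)}
        = {j. j < m \<and> prox \<Phi>E lam c (xh j) ?v - prox \<Phi>E lam c ?u (yh j) \<le> e}"
      using eq by (auto simp: weak_gap_def)
    then show "real m / 2 < real (card {j. j < m \<and> prox \<Phi>E lam c (xh j) ?v - prox \<Phi>E lam c ?u (yh j) \<le> e})"
      using maj unfolding n_def[symmetric] by simp
    \<comment> \<open>The same vector is added to the estimate and to the exact gradient, so the
      error is that of the raw estimate.\<close>
    show "dist (g + lam *\<^sub>R (xG - c)) (?g (xh k1) (yh k2)) \<le> 3 * ((Lx + lam) * sqrt (e / (\<mu> + lam)))"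
      using gradient[OF g] by (simp add: dist_norm flip: k1(2) k2(2))
  qed (use L lam e k1(1) k2(1) k3 y in auto)
  then show ?thesis by (simp add: x_eq gap_const_def)
qed

text \<open>The result is measured against the saddle value of the original objective, which is
  common to both players: the other player's bound, for the negated objective, adds up with this
  one. The flag b selects the samples of the player under consideration.\<close>

lemma boost_one_sided:
  fixes xc :: "nat \<Rightarrow> 'w \<Rightarrow> 'a" and p \<delta> :: real and T :: nat and b :: bool
  assumes M: "prob_space M" and fresh: "fresh_samples M F P \<xi>"
    and L: "Lx > 0" "Lxy > 0" and K: "Kx > 0" "Ky > 0" and \<delta>: "\<delta> > 0" and p: "0 < p" "p < 1"
    and grad: "\<And>x y. x \<in> X \<Longrightarrow> y \<in> Y \<Longrightarrow> has_gradient_within (\<lambda>x'. \<Phi>E x' y) (gx x y) x X"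
    and smooth_xx: "\<And>x1 x2 y. x1 \<in> X \<Longrightarrow> x2 \<in> X \<Longrightarrow> y \<in> Y \<Longrightarrow> norm (gx x1 y - gx x2 y) \<le> Lx * norm (x1 - x2)"
    and smooth_xy: "\<And>x y1 y2. x \<in> X \<Longrightarrow> y1 \<in> Y \<Longrightarrow> y2 \<in> Y \<Longrightarrow> norm (gx x y1 - gx x y2) \<le> Lxy * norm (y1 - y2)"
    and Gx: "(\<lambda>(z, x, y). Gx z x y) \<in> borel_measurable (P \<Otimes>\<^sub>M restrict_space borel X \<Otimes>\<^sub>M restrict_space borel Y)"
    and mean: "\<And>x y. x \<in> X \<Longrightarrow> y \<in> Y \<Longrightarrow> has_bochner_integral P (\<lambda>z. Gx z x y) (gx x y)"
    and var: "\<And>x y. x \<in> X \<Longrightarrow> y \<in> Y \<Longrightarrow>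
       (\<integral>\<^sup>+z. ennreal ((norm (Gx z x y - gx x y))\<^sup>2) \<partial>P) \<le> ennreal (4 * Kx\<^sup>2)"
    and lam: "\<And>i. lam i = \<mu> * 2 ^ i"
    and xc: "\<And>i. i \<le> T \<Longrightarrow> xc i \<in> F (Suc i) \<rightarrow>\<^sub>M restrict_space borel X"
    and robust: "\<And>i. i \<le> T \<Longrightarrow> AE \<omega> in M. xc i \<omega> \<in> fst `
       robust_saa X Y \<Phi> (nat \<lceil>54 / \<delta> * (Kx\<^sup>2 / (\<mu> + prev 0 lam i) + Ky\<^sup>2 / \<nu>)\<rceil>) (boost_reps p T)
         (prev 0 lam i) 0 (prev 0 (\<lambda>k. xc k \<omega>) i) 0 (\<lambda>j k. \<xi> i (b, j, k) \<omega>)"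
    and xG: "xG \<in> F (T + 2) \<rightarrow>\<^sub>M restrict_space borel X" and yG: "yG \<in> F (T + 2) \<rightarrow>\<^sub>M restrict_space borel Y"
    and gap: "AE \<omega> in M. xc (T + 1) \<omega> \<in>
       function_gap_x X Y \<Phi> Gx \<mu> \<nu> Lx Kx Ky (lam T) (xc T \<omega>) (\<delta> / gap_const Lx Lxy \<mu> \<nu> (lam T)) (boost_reps p T)
         (\<lambda>j k. \<xi> (T + 1) (b, j, k) \<omega>) (\<lambda>j k. \<xi> (T + 2) (b, j, k) \<omega>) (xG \<omega>) (yG \<omega>)"
    and saddle: "saddle_point X Y \<Phi>E u v"
  obtains A where "A \<in> sets M" "measure M A \<le> p / 2"
    "AE \<omega> in M. \<omega> \<notin> A \<longrightarrow> (\<forall>y\<in>Y. \<Phi>E (xc (T + 1) \<omega>) y \<le> \<Phi>E u v + \<delta> * (2 + 2 * real T))"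
proof -
  interpret M: prob_space M by (rule M)
  define m where "m = boost_reps p T"
  define q where "q = exp (- real m / 18)"
  have reps: "18 * ln ((2 * real T + 6) / p) \<le> real m"
    unfolding m_def boost_reps_def Let_def by (auto intro: order_trans[OF real_nat_ceiling_ge])
  have "1 < (2 * real T + 6) / p" using p by (simp add: field_simps)
  then have "0 < ln ((2 * real T + 6) / p)" by (rule ln_gt_zero)
  with reps have m: "m > 0" by (cases m) auto
  have "ln ((2 * real T + 6) / p) \<le> real m / 18" using reps by simp
  then have "(2 * real T + 6) / p \<le> exp (real m / 18)"
    using \<open>1 < (2 * real T + 6) / p\<close> by (simp add: ln_ge_iff[symmetric] flip: ln_le_cancel_iff)
  \<comment> \<open>The factor 18 in the number of repetitions cancels the Hoeffding exponent m /
    18.\<close>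
  then have q: "q \<le> p / (2 * real T + 6)"
    using p by (simp add: q_def exp_minus field_simps)
  define Mx where "Mx = gap_const Lx Lxy \<mu> \<nu> (lam T)"
  have lam_pos: "lam i > 0" for i using pos by (simp add: lam)
  have lam_nonneg: "prev 0 lam i \<ge> 0" for i
    using lam_pos less_imp_le by (auto simp: prev_def split: nat.split)
  have Mx: "Mx > 0"
    unfolding Mx_def gap_const_def using L pos lam_pos[of T]
    by (intro add_pos_nonneg add_nonneg_nonneg mult_nonneg_nonneg divide_nonneg_nonneg) auto
  \<comment> \<open>The target for the expected weak gap: \<delta> / 27 where only the distance to u
    matters, and a third of \<delta> / Mx in the final round, where Markov's factor 3 is undone.
    Then 2 / e i is 54 / \<delta> for the centres, as in the procedure.\<close>
  define e where "e i = (if i \<le> T then \<delta> / 27 else \<delta> / Mx / 3)" for i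
  define C where "C i = Kx\<^sup>2 / (\<mu> + prev 0 lam i) + Ky\<^sup>2 / \<nu>" for i
  define n where "n i = nat \<lceil>2 / e i * C i\<rceil>" for i
  have e: "e i > 0" for i using \<delta> Mx by (simp add: e_def)
  have C: "C i > 0" for i
    unfolding C_def using K pos lam_nonneg[of i] by (intro add_pos_pos divide_pos_pos add_pos_nonneg) auto
  have n: "n i > 0" "2 / real (n i) * C i \<le> e i" for i
    unfolding n_def by (rule sample_size[OF e C])+
  define W where "W i \<omega> = prev 0 (\<lambda>k. xc k \<omega>) i" for i \<omega>
  \<comment> \<open>The centre used in round i was computed in round i - 1, hence is known before
    the samples of round i are drawn. Round 0 has the constant centre 0.\<close>
  have W: "W i \<in> borel_measurable (F i)" if "i \<le> T + 1" for i
  proof (cases i)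
    case (Suc k)
    then show ?thesis
      using xc[of k] that by (simp add: W_def[abs_def] prev_def measurable_restrict_space2_iff)
  qed (simp add: W_def[abs_def] prev_def)
  define Good where "Good i A \<longleftrightarrow> A \<in> sets M \<and> measure M A \<le> q \<and> (\<forall>\<omega>\<in>space M. \<omega> \<notin> A \<longrightarrow>
      real m / 2 < real (card {j. j < m \<and> weak_gap (prev 0 lam i) (W i \<omega>)
        (saa_saddle (n i) (prev 0 lam i) (W i \<omega>, \<lambda>k. \<xi> i (b, j, k) \<omega>)) \<le> 3 * e i}))" for i A
  have "\<exists>A. Good i A" if "i \<le> T + 1" for i
    by (rule saa_round[OF M fresh m W[OF that] lam_nonneg n(1) e n(2)[unfolded C_def], where b=b])
      (auto simp: q_def Good_def)
  then have "\<forall>i\<in>{..T + 1}. \<exists>A. Good i A" by simp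
  from bchoice[OF this] obtain A where Good: "\<And>i. i \<le> T + 1 \<Longrightarrow> Good i (A i)" by auto
  then have A: "\<And>i. i \<le> T + 1 \<Longrightarrow> A i \<in> sets M" "\<And>i. i \<le> T + 1 \<Longrightarrow> measure M (A i) \<le> q"
    by (simp_all add: Good_def)
  have maj: "i \<le> T + 1 \<Longrightarrow> \<omega> \<in> space M \<Longrightarrow> \<omega> \<notin> A i \<Longrightarrow>
      real m / 2 < real (card {j. j < m \<and> weak_gap (prev 0 lam i) (W i \<omega>)
        (saa_saddle (n i) (prev 0 lam i) (W i \<omega>, \<lambda>k. \<xi> i (b, j, k) \<omega>)) \<le> 3 * e i})" for i \<omega>
    using Good by (simp add: Good_def)
  define d where "d = (Lx + lam T) * sqrt (\<delta> / Mx / (\<mu> + lam T))"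
  have d: "d > 0" using L lam_pos[of T] \<delta> Mx pos by (simp add: d_def)
  have var': "(\<integral>\<^sup>+z. ennreal ((norm (Gx z x y - gx x y))\<^sup>2) \<partial>P) \<le> ennreal ((2 * Kx)\<^sup>2)" if "x \<in> X" "y \<in> Y" for x y
    using var[OF that] by (simp add: power_mult_distrib)
  have "2 * Kx > 0" using K by simp
  from gradient_round[OF M P fresh m xG yG Gx mean var' this d, where b=b] obtain AG where AG: "AG \<in> sets M" "measure M AG \<le> q"
    and grad_close: "\<And>\<omega> w. \<omega> \<in> space M \<Longrightarrow> \<omega> \<notin> AG \<Longrightarrow> xG \<omega> \<in> X \<Longrightarrow> yG \<omega> \<in> Y \<Longrightarrow>
       w \<in> gradient Gx (2 * Kx) d m (xG \<omega>) (yG \<omega>) (\<lambda>j k. \<xi> (T + 2) (b, j, k) \<omega>) \<Longrightarrow>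
       dist w (gx (xG \<omega>) (yG \<omega>)) \<le> 3 * d"
    unfolding q_def by blast
  show ?thesis
  proof (rule that)
    show "(\<Union>i\<le>T + 1. A i) \<union> AG \<in> sets M" using A AG by auto
    have "measure M ((\<Union>i\<le>T + 1. A i) \<union> AG) \<le> measure M (\<Union>i\<le>T + 1. A i) + measure M AG"
      using A AG by (intro measure_Un_le) auto
    also have "\<dots> \<le> (\<Sum>i\<le>T + 1. measure M (A i)) + measure M AG"
      using A by (intro add_right_mono M.finite_measure_subadditive_finite) auto
    also have "\<dots> \<le> (\<Sum>i\<le>T + 1. q) + q"
      using A AG by (intro add_mono sum_mono) auto
    \<comment> \<open>\<open>T + 2\<close> batches of SAA calls and one batch of gradient estimates\<close>
    also have "\<dots> = (real T + 3) * q" by (simp add: algebra_simps)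
    also have "\<dots> \<le> (real T + 3) * (p / (2 * real T + 6))" using q by (intro mult_left_mono) auto
    also have "\<dots> = p / 2" by (simp add: field_simps)
    finally show "measure M ((\<Union>i\<le>T + 1. A i) \<union> AG) \<le> p / 2" .
    have "AE \<omega> in M. \<forall>i\<in>{..T}. xc i \<omega> \<in> fst `
       robust_saa X Y \<Phi> (n i) m (prev 0 lam i) 0 (W i \<omega>) 0 (\<lambda>j k. \<xi> i (b, j, k) \<omega>)"
      using robust by (intro AE_finite_allI) (auto simp: n_def e_def C_def W_def m_def)
    with gap AE_space show "AE \<omega> in M. \<omega> \<notin> (\<Union>i\<le>T + 1. A i) \<union> AG \<longrightarrow>
        (\<forall>y\<in>Y. \<Phi>E (xc (T + 1) \<omega>) y \<le> \<Phi>E u v + \<delta> * (2 + 2 * real T))"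
    proof eventually_elim
      case (elim \<omega>)
      show ?case
      proof (intro impI ballI)
        fix y assume good: "\<omega> \<notin> (\<Union>i\<le>T + 1. A i) \<union> AG" and y: "y \<in> Y"
        define z where "z i = prox_saddle (prev 0 lam i) (W i \<omega>)" for i
        have z: "saddle_point X Y (prox \<Phi>E (prev 0 lam i) (prev 0 (\<lambda>k. xc k \<omega>) i)) (fst (z i)) (snd (z i))" for i
          using prox_saddle[OF lam_nonneg] by (simp add: z_def W_def)
        have close: "(\<mu> + prev 0 lam i) / 2 * (norm (xc i \<omega> - fst (z i)))\<^sup>2 \<le> \<delta>" if "i \<le> T" for i
        proof -
          have "(\<mu> + prev 0 lam i) / 2 * (norm (xc i \<omega> - fst (z i)))\<^sup>2 \<le> 27 * e i"
            unfolding z_def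
            by (rule robust_saa_close[OF lam_nonneg n(1) maj[of i \<omega>]]) (use elim good that in auto)
          then show ?thesis using that by (simp add: e_def)
        qed
        have boost: "prox \<Phi>E (lam T) (xc T \<omega>) (fst (z (T + 1))) (snd (z (T + 1)))
            \<le> \<Phi>E (fst (z 0)) (snd (z 0)) + \<delta> * (1 + 2 * real T)"
          using \<delta> pos close by (intro prox_boost[where c="\<lambda>k. xc k \<omega>" and u="\<lambda>i. fst (z i)" and v="\<lambda>i. snd (z i)", OF z _ _ lam]) auto
        have T1: "prev 0 lam (T + 1) = lam T" "W (T + 1) \<omega> = xc T \<omega>" by (simp_all add: prev_def W_def)
        have "xG \<omega> \<in> X" "yG \<omega> \<in> Y"
        proof -
          have "space (F (T + 2)) = space M" using fresh by (auto simp: fresh_samples_def filtration_def)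
          then show "xG \<omega> \<in> X" "yG \<omega> \<in> Y"
            using measurable_space[OF xG, of \<omega>] measurable_space[OF yG, of \<omega>] elim by (auto simp: space_restrict_space)
        qed
        note G = grad_close[OF _ _ this, unfolded d_def]
        have "prox \<Phi>E (lam T) (xc T \<omega>) (xc (T + 1) \<omega>) y
            - prox \<Phi>E (lam T) (xc T \<omega>) (fst (prox_saddle (lam T) (xc T \<omega>))) (snd (prox_saddle (lam T) (xc T \<omega>)))
            \<le> gap_const Lx Lxy \<mu> \<nu> (lam T) * (\<delta> / Mx)"
        proof (rule function_gap_x_bound[OF _ L K _ grad smooth_xx smooth_xy _ G])
          show "real m / 2 < real (card {j. j < m \<and> weak_gap (lam T) (xc T \<omega>)
              (saa_saddle (nat \<lceil>2 / (\<delta> / Mx / 3) * (Kx\<^sup>2 / (\<mu> + lam T) + Ky\<^sup>2 / \<nu>)\<rceil>) (lam T)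
                (xc T \<omega>, \<lambda>k. \<xi> (T + 1) (b, j, k) \<omega>)) \<le> 3 * (\<delta> / Mx / 3)})"
            using maj[of "T + 1" \<omega>] good elim by (simp add: n_def e_def C_def T1[simplified])
        qed (use elim good y \<delta> Mx lam_pos[of T] in \<open>auto simp: m_def Mx_def\<close>)
        also have "gap_const Lx Lxy \<mu> \<nu> (lam T) * (\<delta> / Mx) = \<delta>" using Mx by (simp add: Mx_def)
        finally have "prox \<Phi>E (lam T) (xc T \<omega>) (xc (T + 1) \<omega>) y \<le> \<Phi>E (fst (z 0)) (snd (z 0)) + \<delta> * (2 + 2 * real T)"
          using boost by (simp add: z_def T1[simplified] algebra_simps)
        \<comment> \<open>The bound concerns the regularised objective; dropping its nonnegative
          proximal term only lowers the left-hand side.\<close>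
        moreover have "\<Phi>E (xc (T + 1) \<omega>) y \<le> prox \<Phi>E (lam T) (xc T \<omega>) (xc (T + 1) \<omega>) y"
          using lam_pos[of T] by (simp add: prox_def)
        \<comment> \<open>Round 0 has proximal weight 0, so its saddle point is that of the original
          objective.\<close>
        moreover have "z 0 = (u, v)"
          using sc_sc.saddle_eqI[OF sc_sc_expected saddle]
          by (simp add: z_def prox_saddle_def prev_def W_def prox_def[abs_def])
        ultimately show "\<Phi>E (xc (T + 1) \<omega>) y \<le> \<Phi>E u v + \<delta> * (2 + 2 * real T)" by simp
      qed
    qed
  qed
qed

end

section \<open>Exchanging the two players\<close>

lemma saddle_point_swap: "saddle_point Y X (\<lambda>y x. - f x y) y x \<longleftrightarrow> saddle_point X Y f x y"
  by (auto simp: saddle_point_def)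

lemma saa_swap: "(y, x) \<in> saa Y X (\<lambda>z y x. - \<Phi> z x y) n lam 0 c 0 s \<longleftrightarrow> (x, y) \<in> saa X Y \<Phi> n 0 lam 0 c s"
proof -
  have "saa_objective (\<lambda>z y x. - \<Phi> z x y) n lam 0 c 0 s = (\<lambda>y x. - saa_objective \<Phi> n 0 lam 0 c s x y)"
    by (intro ext) (simp add: saa_objective_def sum_negf)
  then show ?thesis by (simp add: saa_def saddle_point_swap)
qed

lemma robust_saa_swap:
  "snd ` robust_saa X Y \<Phi> n m 0 lam 0 c s \<subseteq> fst ` robust_saa Y X (\<lambda>z y x. - \<Phi> z x y) n m lam 0 c 0 s"
  unfolding robust_saa_def saa_swap[symmetric, of _ _ X Y \<Phi>] by force

text \<open>Extract sees only the pairwise distances of the first m points, so it is invariant under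
  isometries; the case in use is negation of all gradient averages.\<close>

lemma extract_idx_cong:
  assumes "\<And>j k. j < m \<Longrightarrow> k < m \<Longrightarrow> \<rho> (z j) (z k) = \<rho>' (z' j) (z' k)"
  shows "extract_idx m \<rho> z = extract_idx m \<rho>' z'"
proof -
  have r: "extract_radius m \<rho> z j = extract_radius m \<rho>' z' j" if "j < m" for j
    using assms[OF that] by (simp add: extract_radius_def cong: conj_cong)
  then have map: "map (extract_radius m \<rho> z) [0..<m] = map (extract_radius m \<rho>' z') [0..<m]" by simp
  show ?thesis unfolding extract_idx_def Let_def map using r by auto
qed

lemma gradient_swap:
  "v \<in> gradient G \<sigma> d m x y s \<Longrightarrow> - v \<in> gradient (\<lambda>z y x. - G z x y) \<sigma> d m y x s"
proof -
  assume "v \<in> gradient G \<sigma> d m x y s"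
  then obtain k where k: "k \<in> extract_idx m dist (\<lambda>j. (1 / real (nat \<lceil>3 * \<sigma>\<^sup>2 / d\<^sup>2\<rceil>)) *\<^sub>R (\<Sum>i<nat \<lceil>3 * \<sigma>\<^sup>2 / d\<^sup>2\<rceil>. G (s j i) x y))"
    and v: "v = (1 / real (nat \<lceil>3 * \<sigma>\<^sup>2 / d\<^sup>2\<rceil>)) *\<^sub>R (\<Sum>i<nat \<lceil>3 * \<sigma>\<^sup>2 / d\<^sup>2\<rceil>. G (s k i) x y)"
    unfolding gradient_def Let_def by blast
  have "k \<in> extract_idx m dist (\<lambda>j. (1 / real (nat \<lceil>3 * \<sigma>\<^sup>2 / d\<^sup>2\<rceil>)) *\<^sub>R (\<Sum>i<nat \<lceil>3 * \<sigma>\<^sup>2 / d\<^sup>2\<rceil>. - G (s j i) x y))"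
    using k by (subst extract_idx_cong) (auto simp: sum_negf dist_minus)
  then show ?thesis
    unfolding gradient_def Let_def v by (auto simp: sum_negf intro!: exI[of _ k])
qed

text \<open>Negating the objective negates the gradient estimate, so
  \<open>- g + lam *\<^sub>R (yG - c)\<close> replaces \<open>g - lam *\<^sub>R (yG - c)\<close>.
  These differ by a sign, which the absolute value in the pseudometric does not see.\<close>

lemma function_gap_swap:
  "function_gap_y X Y \<Phi> Gy \<mu>x \<mu>y Ly Kx Ky lam c e m s sG xG yG
    \<subseteq> function_gap_x Y X (\<lambda>z y x. - \<Phi> z x y) (\<lambda>z y x. - Gy z x y) \<mu>y \<mu>x Ly Ky Kx lam c e m s sG yG xG"
proof
  fix y assume "y \<in> function_gap_y X Y \<Phi> Gy \<mu>x \<mu>y Ly Kx Ky lam c e m s sG xG yG"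
  then obtain xh yh k1 k2 g k3 where y: "y = yh k3"
    and xh: "\<forall>j<m. (xh j, yh j) \<in> weak_saa_y X Y \<Phi> \<mu>x \<mu>y Kx Ky lam c (e / 3) (s j)"
    and k1: "k1 \<in> extract_idx m dist xh" "xG = xh k1"
    and k2: "k2 \<in> extract_idx m dist yh" "yG = yh k2"
    and g: "g \<in> gradient Gy (2 * Ky) ((Ly + lam) * sqrt (e / (\<mu>y + lam))) m xG yG sG"
    and k3: "k3 \<in> extract_idx m dist yh" "k3 \<in> extract_idx m (\<lambda>y1 y2. \<bar>(g - lam *\<^sub>R (yG - c)) \<bullet> (y1 - y2)\<bar>) yh"
    unfolding function_gap_y_def Let_def by blast
  have "(yh j, xh j) \<in> weak_saa_x Y X (\<lambda>z y x. - \<Phi> z x y) \<mu>y \<mu>x Ky Kx lam c (e / 3) (s j)" if "j < m" for j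
    using xh[rule_format, OF that] by (simp add: weak_saa_x_def weak_saa_y_def saa_swap add.commute)
  moreover have "k3 \<in> extract_idx m (\<lambda>y1 y2. \<bar>(- g + lam *\<^sub>R (yG - c)) \<bullet> (y1 - y2)\<bar>) yh"
  proof -
    have "- g + lam *\<^sub>R (yG - c) = - (g - lam *\<^sub>R (yG - c))" by simp
    then show ?thesis using k3(2) by (simp only: inner_minus_left abs_minus_cancel)
  qed
  ultimately show "y \<in> function_gap_x Y X (\<lambda>z y x. - \<Phi> z x y) (\<lambda>z y x. - Gy z x y) \<mu>y \<mu>x Ly Ky Kx lam c e m s sG yG xG"
    unfolding function_gap_x_def Let_def using k1 k2 k3(1) gradient_swap[OF g] y by blast
qed

lemma (in stochastic_sc_sc) swap: "stochastic_sc_sc P Y X (\<lambda>z y x. - \<Phi> z x y) \<nu> \<mu> Ky Kx"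
  by (rule stochastic_sc_sc.intro)
    (use P X Y pos sc_x sc_y lip_x lip_y integrable in \<open>auto simp: strongly_concave_on_def intro: lipschitz_on_minus\<close>)

lemma saa_cong:
  "(\<And>i. \<Phi> (s i) = \<Phi>' (s i)) \<Longrightarrow> saa X Y \<Phi> n lx ly cx cy s = saa X Y \<Phi>' n lx ly cx cy s"
  by (simp add: saa_def saa_objective_def[abs_def])

section \<open>Measurability of the duality gap\<close>

lemma (in sc_sc) continuous_on_SUP: "continuous_on X (\<lambda>x. SUP y\<in>Y. f x y)"
proof -
  obtain K where K: "\<And>y. y \<in> Y \<Longrightarrow> K-lipschitz_on X (\<lambda>x. f x y)" using lip_x by blast
  have bdd: "bdd_above (f x ` Y)" if "x \<in> X" for x
    using lip_y that Y(1)
    by (auto intro!: bounded_imp_bdd_above compact_imp_bounded compact_continuous_image lipschitz_on_continuous_on)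
  have le: "(SUP y\<in>Y. f x y) \<le> (SUP y\<in>Y. f x' y) + K * dist x x'" if x: "x \<in> X" "x' \<in> X" for x x'
  proof (rule cSUP_least[OF Y(3)])
    fix y assume y: "y \<in> Y"
    have "f x y \<le> f x' y + K * dist x x'"
      using lipschitz_onD[OF K[OF y] x] by (simp add: dist_real_def)
    also have "f x' y \<le> (SUP y\<in>Y. f x' y)" using bdd x y by (intro cSUP_upper) auto
    finally show "f x y \<le> (SUP y\<in>Y. f x' y) + K * dist x x'" by simp
  qed
  have "K-lipschitz_on X (\<lambda>x. SUP y\<in>Y. f x y)"
  proof (rule lipschitz_onI)
    show "dist (SUP y\<in>Y. f x y) (SUP y\<in>Y. f x' y) \<le> K * dist x x'" if "x \<in> X" "x' \<in> X" for x x'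
      using le[OF that] le[OF that(2,1)] by (simp add: dist_real_def dist_commute abs_le_iff)
    show "K \<ge> 0" using K Y by (auto simp: lipschitz_on_def)
  qed
  then show ?thesis by (rule lipschitz_on_continuous_on)
qed

text \<open>The event of the guarantee must lie in the \<sigma>-algebra, since
  \<open>measure\<close> is 0 outside it. The supremum is Lipschitz in x and, by exchanging the
  players, the infimum is continuous in y.\<close>

lemma (in sc_sc) measurable_duality_gap:
  assumes "a \<in> M \<rightarrow>\<^sub>M restrict_space borel X" "b \<in> M \<rightarrow>\<^sub>M restrict_space borel Y"
  shows "(\<lambda>w. duality_gap X Y f (a w) (b w)) \<in> borel_measurable M"
proof -
  interpret S: sc_sc Y X \<nu> \<mu> "\<lambda>y x. - f x y" by (rule swap)
  have "(INF x\<in>X. f x y) = - (SUP x\<in>X. - f x y)" for y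
    by (simp add: Inf_real_def image_comp)
  then show ?thesis
    using measurable_compose[OF assms(1) borel_measurable_continuous_on_restrict[OF continuous_on_SUP]]
      measurable_compose[OF assms(2) borel_measurable_continuous_on_restrict[OF S.continuous_on_SUP]]
    by (simp add: duality_gap_def)
qed

lemma duality_gap_cong:
  assumes "\<And>x y. x \<in> X \<Longrightarrow> y \<in> Y \<Longrightarrow> f x y = f' x y" "x \<in> X" "y \<in> Y"
  shows "duality_gap X Y f x y = duality_gap X Y f' x y"
  unfolding duality_gap_def using assms by (simp cong: SUP_cong INF_cong)

lemma duality_gap_le:
  assumes "X \<noteq> {}" "Y \<noteq> {}" "\<And>y'. y' \<in> Y \<Longrightarrow> f x y' \<le> v + d" "\<And>x'. x' \<in> X \<Longrightarrow> v - d \<le> f x' y"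
  shows "duality_gap X Y f x y \<le> 2 * d"
  using cSUP_least[OF assms(2), of "f x" "v + d"] cINF_greatest[OF assms(1), of "v - d" "\<lambda>x'. f x' y"] assms(3,4)
  by (force simp: duality_gap_def)

section \<open>The guarantee\<close>

theorem corollary3:
  fixes P :: "'c measure" and M :: "'w measure" and F :: "nat \<Rightarrow> 'w measure"
    and X :: "'a::euclidean_space set" and Y :: "'b::euclidean_space set"
    and \<Phi> :: "'c \<Rightarrow> 'a \<Rightarrow> 'b \<Rightarrow> real"
    and Gx :: "'c \<Rightarrow> 'a \<Rightarrow> 'b \<Rightarrow> 'a" and Gy :: "'c \<Rightarrow> 'a \<Rightarrow> 'b \<Rightarrow> 'b"
    and gx :: "'a \<Rightarrow> 'b \<Rightarrow> 'a" and gy :: "'a \<Rightarrow> 'b \<Rightarrow> 'b"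
    and \<mu>x \<mu>y Lx Ly Lxy Kx Ky \<epsilon> p \<delta> :: real and T :: nat
    and lamx lamy :: "nat \<Rightarrow> real"
    and \<xi> :: "nat \<Rightarrow> bool \<times> nat \<times> nat \<Rightarrow> 'w \<Rightarrow> 'c"
    and xc :: "nat \<Rightarrow> 'w \<Rightarrow> 'a" and yc :: "nat \<Rightarrow> 'w \<Rightarrow> 'b"
  assumes X: "compact X" "convex X" "X \<noteq> {}" and Y: "compact Y" "convex Y" "Y \<noteq> {}"
    and P: "prob_space P"
    and integrable: "\<And>x y. x \<in> X \<Longrightarrow> y \<in> Y \<Longrightarrow> integrable P (\<lambda>z. \<Phi> z x y)"
    and sc_pos: "\<mu>x > 0" "\<mu>y > 0"
    and sc_x: "AE z in P. \<forall>y\<in>Y. strongly_convex_on \<mu>x X (\<lambda>x. \<Phi> z x y)"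
    and sc_y: "AE z in P. \<forall>x\<in>X. strongly_concave_on \<mu>y Y (\<lambda>y. \<Phi> z x y)"
    and gx: "\<And>x y. x \<in> X \<Longrightarrow> y \<in> Y \<Longrightarrow>
               has_gradient_within (\<lambda>x'. expected_objective P \<Phi> x' y) (gx x y) x X"
    and gy: "\<And>x y. x \<in> X \<Longrightarrow> y \<in> Y \<Longrightarrow>
               has_gradient_within (\<lambda>y'. expected_objective P \<Phi> x y') (gy x y) y Y"
    and smooth_pos: "Lx > 0" "Ly > 0" "Lxy > 0"
    and smooth_xx: "\<And>x1 x2 y1. x1 \<in> X \<Longrightarrow> x2 \<in> X \<Longrightarrow> y1 \<in> Y \<Longrightarrow>
               norm (gx x1 y1 - gx x2 y1) \<le> Lx * norm (x1 - x2)"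
    and smooth_yy: "\<And>x1 y1 y2. x1 \<in> X \<Longrightarrow> y1 \<in> Y \<Longrightarrow> y2 \<in> Y \<Longrightarrow>
               norm (gy x1 y1 - gy x1 y2) \<le> Ly * norm (y1 - y2)"
    and smooth_xy: "\<And>x1 y1 y2. x1 \<in> X \<Longrightarrow> y1 \<in> Y \<Longrightarrow> y2 \<in> Y \<Longrightarrow>
               norm (gx x1 y1 - gx x1 y2) \<le> Lxy * norm (y1 - y2)"
    and smooth_yx: "\<And>x1 x2 y1. x1 \<in> X \<Longrightarrow> x2 \<in> X \<Longrightarrow> y1 \<in> Y \<Longrightarrow>
               norm (gy x1 y1 - gy x2 y1) \<le> Lxy * norm (x1 - x2)"
    and lip_pos: "Kx > 0" "Ky > 0"
    and lip_x: "AE z in P. \<forall>y\<in>Y. Kx-lipschitz_on X (\<lambda>x. \<Phi> z x y)"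
    and lip_y: "AE z in P. \<forall>x\<in>X. Ky-lipschitz_on Y (\<lambda>y. \<Phi> z x y)"
    and Gx: "AE z in P. \<forall>x\<in>X. \<forall>y\<in>Y. has_gradient_within (\<lambda>x'. \<Phi> z x' y) (Gx z x y) x X"
    and Gy: "AE z in P. \<forall>x\<in>X. \<forall>y\<in>Y. has_gradient_within (\<lambda>y'. \<Phi> z x y') (Gy z x y) y Y"
    and meas_Gx: "(\<lambda>(z, x, y). Gx z x y)
               \<in> borel_measurable (P \<Otimes>\<^sub>M restrict_space borel X \<Otimes>\<^sub>M restrict_space borel Y)"
    and meas_Gy: "(\<lambda>(z, x, y). Gy z x y)
               \<in> borel_measurable (P \<Otimes>\<^sub>M restrict_space borel X \<Otimes>\<^sub>M restrict_space borel Y)"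
    and unbiased_x: "\<And>x y. x \<in> X \<Longrightarrow> y \<in> Y \<Longrightarrow> has_bochner_integral P (\<lambda>z. Gx z x y) (gx x y)"
    and unbiased_y: "\<And>x y. x \<in> X \<Longrightarrow> y \<in> Y \<Longrightarrow> has_bochner_integral P (\<lambda>z. Gy z x y) (gy x y)"
    and var_x: "\<And>x y. x \<in> X \<Longrightarrow> y \<in> Y \<Longrightarrow>
               (\<integral>\<^sup>+z. ennreal ((norm (Gx z x y - gx x y))\<^sup>2) \<partial>P) \<le> ennreal (4 * Kx\<^sup>2)"
    and var_y: "\<And>x y. x \<in> X \<Longrightarrow> y \<in> Y \<Longrightarrow>
               (\<integral>\<^sup>+z. ennreal ((norm (Gy z x y - gy x y))\<^sup>2) \<partial>P) \<le> ennreal (4 * Ky\<^sup>2)"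
    and eps: "\<epsilon> > 0" and p: "0 < p" "p < 1"
    and T: "T = nat \<lceil>log 2 (max (max (Lx / \<mu>x) (Ly / \<mu>y)) (Lxy\<^sup>2 / (\<mu>x * \<mu>y)))\<rceil>"
    and \<delta>: "\<delta> = \<epsilon> / (4 + 4 * real T)"
    and lamx: "\<And>i. lamx i = \<mu>x * 2 ^ i" and lamy: "\<And>i. lamy i = \<mu>y * 2 ^ i"
    and M: "prob_space M" and samples: "fresh_samples M F P \<xi>"
    and run: "boost_saa_c M F \<xi> X Y \<Phi> Gx Gy \<mu>x \<mu>y Lx Ly Lxy Kx Ky lamx lamy \<delta> p T xc yc"
  shows "measure M {\<omega> \<in> space M.
           duality_gap X Y (expected_objective P \<Phi>) (xc (T + 1) \<omega>) (yc (T + 1) \<omega>) \<le> \<epsilon>} \<ge> 1 - p"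
proof -
  interpret P: prob_space P by (rule P)
  interpret M: prob_space M by (rule M)
  define m where "m = boost_reps p T"
  have "AE z in P. (\<forall>y\<in>Y. strongly_convex_on \<mu>x X (\<lambda>x. \<Phi> z x y)) \<and> (\<forall>x\<in>X. strongly_concave_on \<mu>y Y (\<Phi> z x))
      \<and> (\<forall>y\<in>Y. Kx-lipschitz_on X (\<lambda>x. \<Phi> z x y)) \<and> (\<forall>x\<in>X. Ky-lipschitz_on Y (\<Phi> z x))"
    using sc_x sc_y lip_x lip_y by eventually_elim blast
  from AE_E3[OF this] obtain N where N: "N \<in> null_sets P"
    and nice: "\<And>z. z \<in> space P - N \<Longrightarrow> (\<forall>y\<in>Y. strongly_convex_on \<mu>x X (\<lambda>x. \<Phi> z x y))
      \<and> (\<forall>x\<in>X. strongly_concave_on \<mu>y Y (\<Phi> z x))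
      \<and> (\<forall>y\<in>Y. Kx-lipschitz_on X (\<lambda>x. \<Phi> z x y)) \<and> (\<forall>x\<in>X. Ky-lipschitz_on Y (\<Phi> z x))"
    by blast
  \<comment> \<open>A probability space is not a null set, so there is a well-behaved point z0 to
    supply the replacement objective.\<close>
  have "space P - N \<noteq> {}"
  proof
    assume "space P - N = {}"
    then have "space P = N" using sets.sets_into_space[of N P] N by auto
    then show False using N P.emeasure_space_1 by auto
  qed
  then obtain z0 where z0: "z0 \<in> space P - N" by blast
  \<comment> \<open>Redefining the objective on a null set makes the assumptions hold for every sample.\<close>
  define \<Psi> where "\<Psi> z = (if z \<in> space P - N then \<Phi> z else \<Phi> z0)" for z
  have \<Psi>_AE: "AE z in P. \<Psi> z x y = \<Phi> z x y" for x y
    using AE_not_in[OF N] AE_space by eventually_elim (simp add: \<Psi>_def)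
  have \<Psi>_meas: "(\<lambda>z. \<Psi> z x y) \<in> borel_measurable P" if "x \<in> X" "y \<in> Y" for x y
  proof -
    have [measurable]: "N \<in> sets P" "(\<lambda>z. \<Phi> z x y) \<in> borel_measurable P" using N integrable[OF that] by auto
    have "(\<lambda>z. if z \<in> space P - N then \<Phi> z x y else \<Phi> z0 x y) \<in> borel_measurable P" by measurable
    then show ?thesis by (simp add: \<Psi>_def if_distrib[of "\<lambda>h. h x y"] cong: if_cong)
  qed
  have \<Psi>_int: "integrable P (\<lambda>z. \<Psi> z x y)" if "x \<in> X" "y \<in> Y" for x y
    using integrable_cong_AE[OF \<Psi>_meas[OF that] borel_measurable_integrable[OF integrable[OF that]] \<Psi>_AE] integrable[OF that]
    by simp
  have E_eq: "expected_objective P \<Psi> x y = expected_objective P \<Phi> x y" if "x \<in> X" "y \<in> Y" for x y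
    unfolding expected_objective_def
    by (rule integral_cong_AE[OF \<Psi>_meas[OF that] borel_measurable_integrable[OF integrable[OF that]] \<Psi>_AE])
  interpret A: stochastic_sc_sc P X Y \<Psi> \<mu>x \<mu>y Kx Ky
    by unfold_locales (use X Y P sc_pos \<Psi>_int nice z0 in \<open>auto simp: \<Psi>_def\<close>)
  interpret B: stochastic_sc_sc P Y X "\<lambda>z y x. - \<Psi> z x y" \<mu>y \<mu>x Ky Kx by (rule A.swap)
  have E_swap: "expected_objective P (\<lambda>z y x. - \<Psi> z x y) = (\<lambda>y x. - expected_objective P \<Psi> x y)"
    by (intro ext) (simp add: expected_objective_def)
  interpret E: sc_sc X Y \<mu>x \<mu>y "expected_objective P \<Psi>" by (rule A.sc_sc_expected)
  obtain u v where saddle: "saddle_point X Y (expected_objective P \<Psi>) u v" using E.saddle_exists by blast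
  have \<delta>_pos: "\<delta> > 0" using eps by (simp add: \<delta>)
  \<comment> \<open>The index set of the samples is countable, so almost surely none of them falls
    into N. A run for \<Phi> is then also a run for \<Psi>.\<close>
  have good: "AE \<omega> in M. \<forall>r i. \<xi> r i \<omega> \<in> space P - N"
  proof -
    have "AE \<omega> in M. \<xi> r i \<omega> \<in> space P - N" for r i
    proof -
      have "space (F (Suc r)) = space M" "sets (F (Suc r)) \<subseteq> sets M" "\<xi> r i \<in> F (Suc r) \<rightarrow>\<^sub>M P"
        and d: "distr M P (\<xi> r i) = P"
        using samples unfolding fresh_samples_def filtration_def by blast+
      then have \<xi>: "\<xi> r i \<in> M \<rightarrow>\<^sub>M P" by (auto simp: measurable_def)
      have "AE z in distr M P (\<xi> r i). z \<in> space P - N"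
        unfolding d using AE_not_in[OF N] AE_space by eventually_elim simp
      from AE_distrD[OF \<xi> this] show ?thesis .
    qed
    then show ?thesis by (simp add: AE_all_countable)
  qed
  have \<Psi>_good: "\<Psi> z = \<Phi> z" if "z \<in> space P - N" for z using that by (simp add: \<Psi>_def)
  note run' = run[unfolded boost_saa_c_def Let_def, folded m_def]
  from run' obtain xG yG where xG: "xG \<in> F (T + 2) \<rightarrow>\<^sub>M restrict_space borel X" "yG \<in> F (T + 2) \<rightarrow>\<^sub>M restrict_space borel Y"
    and gap_x: "AE \<omega> in M. xc (T + 1) \<omega> \<in>
              function_gap_x X Y \<Phi> Gx \<mu>x \<mu>y Lx Kx Ky (lamx T) (xc T \<omega>) (\<delta> / gap_const Lx Lxy \<mu>x \<mu>y (lamx T)) m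
                (\<lambda>j k. \<xi> (T + 1) (True, j, k) \<omega>) (\<lambda>j k. \<xi> (T + 2) (True, j, k) \<omega>) (xG \<omega>) (yG \<omega>)"
    by blast
  from run' obtain xG' yG' where xG': "xG' \<in> F (T + 2) \<rightarrow>\<^sub>M restrict_space borel X" "yG' \<in> F (T + 2) \<rightarrow>\<^sub>M restrict_space borel Y"
    and gap_y: "AE \<omega> in M. yc (T + 1) \<omega> \<in>
              function_gap_y X Y \<Phi> Gy \<mu>x \<mu>y Ly Kx Ky (lamy T) (yc T \<omega>) (\<delta> / gap_const Ly Lxy \<mu>y \<mu>x (lamy T)) m
                (\<lambda>j k. \<xi> (T + 1) (False, j, k) \<omega>) (\<lambda>j k. \<xi> (T + 2) (False, j, k) \<omega>) (xG' \<omega>) (yG' \<omega>)"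
    by blast
  have xc: "xc i \<in> F (Suc i) \<rightarrow>\<^sub>M restrict_space borel X"
    and robust_x: "AE \<omega> in M. xc i \<omega> \<in> fst ` robust_saa X Y \<Phi> (nat \<lceil>54 / \<delta> * (Kx\<^sup>2 / (\<mu>x + prev 0 lamx i) + Ky\<^sup>2 / \<mu>y)\<rceil>) m
        (prev 0 lamx i) 0 (prev 0 (\<lambda>k. xc k \<omega>) i) 0 (\<lambda>j k. \<xi> i (True, j, k) \<omega>)"
    and yc: "yc i \<in> F (Suc i) \<rightarrow>\<^sub>M restrict_space borel Y"
    and robust_y: "AE \<omega> in M. yc i \<omega> \<in> snd ` robust_saa X Y \<Phi> (nat \<lceil>54 / \<delta> * (Kx\<^sup>2 / \<mu>x + Ky\<^sup>2 / (\<mu>y + prev 0 lamy i))\<rceil>) m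
        0 (prev 0 lamy i) 0 (prev 0 (\<lambda>k. yc k \<omega>) i) (\<lambda>j k. \<xi> i (False, j, k) \<omega>)"
    if "i \<le> T" for i
    using run' that by blast+
  have xT: "xc (T + 1) \<in> M \<rightarrow>\<^sub>M restrict_space borel X" and yT: "yc (T + 1) \<in> M \<rightarrow>\<^sub>M restrict_space borel Y"
    using run' by blast+

  have x_side: "\<exists>A. A \<in> sets M \<and> measure M A \<le> p / 2 \<and>
    (AE \<omega> in M. \<omega> \<notin> A \<longrightarrow> (\<forall>y\<in>Y. expected_objective P \<Psi> (xc (T + 1) \<omega>) y
       \<le> expected_objective P \<Psi> u v + \<delta> * (2 + 2 * real T)))"
  proof (rule A.boost_one_sided[OF M samples smooth_pos(1,3) lip_pos \<delta>_pos p _ smooth_xx smooth_xy meas_Gx unbiased_x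
        var_x lamx xc _ xG _ saddle])
    show "has_gradient_within (\<lambda>x'. expected_objective P \<Psi> x' y) (gx x y) x X" if "x \<in> X" "y \<in> Y" for x y
      using gx[OF that] E_eq that unfolding has_gradient_within_def by (auto intro: has_derivative_transform)
    show "AE \<omega> in M. xc i \<omega> \<in> fst ` robust_saa X Y \<Psi> (nat \<lceil>54 / \<delta> * (Kx\<^sup>2 / (\<mu>x + prev 0 lamx i) + Ky\<^sup>2 / \<mu>y)\<rceil>) (boost_reps p T)
        (prev 0 lamx i) 0 (prev 0 (\<lambda>k. xc k \<omega>) i) 0 (\<lambda>j k. \<xi> i (True, j, k) \<omega>)" if "i \<le> T" for i
      using robust_x[OF that] good
    proof eventually_elim
      case (elim \<omega>)
      then show ?case
        by (simp add: robust_saa_def m_def \<Psi>_good saa_cong[where \<Phi>=\<Psi> and \<Phi>'=\<Phi>])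
    qed
    show "AE \<omega> in M. xc (T + 1) \<omega> \<in>
       function_gap_x X Y \<Psi> Gx \<mu>x \<mu>y Lx Kx Ky (lamx T) (xc T \<omega>) (\<delta> / gap_const Lx Lxy \<mu>x \<mu>y (lamx T)) (boost_reps p T)
         (\<lambda>j k. \<xi> (T + 1) (True, j, k) \<omega>) (\<lambda>j k. \<xi> (T + 2) (True, j, k) \<omega>) (xG \<omega>) (yG \<omega>)"
      using gap_x good
    proof eventually_elim
      case (elim \<omega>)
      then show ?case
        by (simp add: function_gap_x_def weak_saa_x_def m_def \<Psi>_good saa_cong[where \<Phi>=\<Psi> and \<Phi>'=\<Phi>])
    qed
  qed (assumption | (rule exI, (rule conjI, assumption)+, assumption))+

  have y_side: "\<exists>A. A \<in> sets M \<and> measure M A \<le> p / 2 \<and>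
    (AE \<omega> in M. \<omega> \<notin> A \<longrightarrow> (\<forall>x\<in>X. - expected_objective P \<Psi> x (yc (T + 1) \<omega>)
       \<le> - expected_objective P \<Psi> u v + \<delta> * (2 + 2 * real T)))"
  \<comment> \<open>In the exchanged game the saddle point is (v, u), the intermediate point appears
    in the order (yG', xG'), and the samples carry the flag \<open>False\<close>.\<close>
  proof (rule B.boost_one_sided[where \<xi>=\<xi> and Gx="\<lambda>z y x. - Gy z x y" and gx="\<lambda>y x. - gy x y" and xc=yc and b=False
        and lam=lamy and Lx=Ly and Lxy=Lxy and xG=yG' and yG=xG' and u=v and v=u, unfolded E_swap,
        OF M samples smooth_pos(2,3) lip_pos(2,1) \<delta>_pos p _ _ _ _ _ _ lamy yc _ xG'(2,1)])
    show "has_gradient_within (\<lambda>y'. - expected_objective P \<Psi> x y') (- gy x y) y Y" if "y \<in> Y" "x \<in> X" for y x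
      using has_derivative_minus[OF gy[OF that(2,1), unfolded has_gradient_within_def]] E_eq that
      unfolding has_gradient_within_def inner_minus_left by (auto intro: has_derivative_transform)
    show "norm (- gy x y1 - - gy x y2) \<le> Ly * norm (y1 - y2)" if "y1 \<in> Y" "y2 \<in> Y" "x \<in> X" for y1 y2 x
      using smooth_yy[OF that(3,1,2)] by (simp add: norm_minus_commute)
    show "norm (- gy x1 y - - gy x2 y) \<le> Lxy * norm (x1 - x2)" if "y \<in> Y" "x1 \<in> X" "x2 \<in> X" for y x1 x2
      using smooth_yx[OF that(2,3,1)] by (simp add: norm_minus_commute)
    have "(\<lambda>p. (fst p, snd (snd p), fst (snd p)))
        \<in> P \<Otimes>\<^sub>M restrict_space borel Y \<Otimes>\<^sub>M restrict_space borel X \<rightarrow>\<^sub>M P \<Otimes>\<^sub>M restrict_space borel X \<Otimes>\<^sub>M restrict_space borel Y"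
      by measurable
    from measurable_compose[OF this meas_Gy]
    show "(\<lambda>(z, y, x). - Gy z x y) \<in> borel_measurable (P \<Otimes>\<^sub>M restrict_space borel Y \<Otimes>\<^sub>M restrict_space borel X)"
      by (simp add: case_prod_unfold)
    show "has_bochner_integral P (\<lambda>z. - Gy z x y) (- gy x y)" if "y \<in> Y" "x \<in> X" for y x
      using unbiased_y[OF that(2,1)] by (rule has_bochner_integral_minus)
    show "(\<integral>\<^sup>+z. ennreal ((norm (- Gy z x y - - gy x y))\<^sup>2) \<partial>P) \<le> ennreal (4 * Ky\<^sup>2)" if "y \<in> Y" "x \<in> X" for y x
      using var_y[OF that(2,1)] by (simp add: norm_minus_commute)
    show "AE \<omega> in M. yc i \<omega> \<in> fst ` robust_saa Y X (\<lambda>z y x. - \<Psi> z x y)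
        (nat \<lceil>54 / \<delta> * (Ky\<^sup>2 / (\<mu>y + prev 0 lamy i) + Kx\<^sup>2 / \<mu>x)\<rceil>) (boost_reps p T)
        (prev 0 lamy i) 0 (prev 0 (\<lambda>k. yc k \<omega>) i) 0 (\<lambda>j k. \<xi> i (False, j, k) \<omega>)" if "i \<le> T" for i
      using robust_y[OF that] good
    proof eventually_elim
      case (elim \<omega>)
      then have "yc i \<omega> \<in> snd ` robust_saa X Y \<Psi> (nat \<lceil>54 / \<delta> * (Ky\<^sup>2 / (\<mu>y + prev 0 lamy i) + Kx\<^sup>2 / \<mu>x)\<rceil>) m
          0 (prev 0 lamy i) 0 (prev 0 (\<lambda>k. yc k \<omega>) i) (\<lambda>j k. \<xi> i (False, j, k) \<omega>)"
        by (simp add: robust_saa_def \<Psi>_good saa_cong[where \<Phi>=\<Psi> and \<Phi>'=\<Phi>] add.commute)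
      then show ?case unfolding m_def by (rule subsetD[OF robust_saa_swap])
    qed
    show "AE \<omega> in M. yc (T + 1) \<omega> \<in>
       function_gap_x Y X (\<lambda>z y x. - \<Psi> z x y) (\<lambda>z y x. - Gy z x y) \<mu>y \<mu>x Ly Ky Kx (lamy T) (yc T \<omega>)
         (\<delta> / gap_const Ly Lxy \<mu>y \<mu>x (lamy T)) (boost_reps p T)
         (\<lambda>j k. \<xi> (T + 1) (False, j, k) \<omega>) (\<lambda>j k. \<xi> (T + 2) (False, j, k) \<omega>) (yG' \<omega>) (xG' \<omega>)"
      using gap_y good
    proof eventually_elim
      case (elim \<omega>)
      then have "yc (T + 1) \<omega> \<in> function_gap_y X Y \<Psi> Gy \<mu>x \<mu>y Ly Kx Ky (lamy T) (yc T \<omega>)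
          (\<delta> / gap_const Ly Lxy \<mu>y \<mu>x (lamy T)) m
          (\<lambda>j k. \<xi> (T + 1) (False, j, k) \<omega>) (\<lambda>j k. \<xi> (T + 2) (False, j, k) \<omega>) (xG' \<omega>) (yG' \<omega>)"
        by (simp add: function_gap_y_def weak_saa_y_def \<Psi>_good saa_cong[where \<Phi>=\<Psi> and \<Phi>'=\<Phi>])
      then show ?case unfolding m_def by (rule subsetD[OF function_gap_swap])
    qed
    show "saddle_point Y X (\<lambda>y x. - expected_objective P \<Psi> x y) v u"
      using saddle by (simp add: saddle_point_swap)
  qed (assumption | (rule exI, (rule conjI, assumption)+, assumption))+

  from x_side y_side obtain A B where A: "A \<in> sets M" "measure M A \<le> p / 2" and B: "B \<in> sets M" "measure M B \<le> p / 2"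
    and A_ok: "AE \<omega> in M. \<omega> \<notin> A \<longrightarrow> (\<forall>y\<in>Y. expected_objective P \<Psi> (xc (T + 1) \<omega>) y
       \<le> expected_objective P \<Psi> u v + \<delta> * (2 + 2 * real T))"
    and B_ok: "AE \<omega> in M. \<omega> \<notin> B \<longrightarrow> (\<forall>x\<in>X. - expected_objective P \<Psi> x (yc (T + 1) \<omega>)
       \<le> - expected_objective P \<Psi> u v + \<delta> * (2 + 2 * real T))"
    by blast
  have gap_eq: "duality_gap X Y (expected_objective P \<Phi>) (xc (T + 1) \<omega>) (yc (T + 1) \<omega>)
      = duality_gap X Y (expected_objective P \<Psi>) (xc (T + 1) \<omega>) (yc (T + 1) \<omega>)" if "\<omega> \<in> space M" for \<omega>
    using measurable_space[OF xT that] measurable_space[OF yT that] E_eq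
    by (intro duality_gap_cong) (auto simp: space_restrict_space)
  define G where "G = {\<omega> \<in> space M. duality_gap X Y (expected_objective P \<Phi>) (xc (T + 1) \<omega>) (yc (T + 1) \<omega>) \<le> \<epsilon>}"
  have "G = {\<omega> \<in> space M. duality_gap X Y (expected_objective P \<Psi>) (xc (T + 1) \<omega>) (yc (T + 1) \<omega>) \<le> \<epsilon>}"
    unfolding G_def using gap_eq by auto
  also have "\<dots> \<in> sets M"
    using E.measurable_duality_gap[OF xT yT] by (intro borel_measurable_le borel_measurable_const)
  finally have G: "G \<in> sets M" .
  have "1 - p \<le> 1 - (measure M A + measure M B)" using A B by simp
  also have "\<dots> \<le> 1 - measure M (A \<union> B)" using measure_Un_le[OF A(1) B(1)] by simp
  also have "\<dots> = measure M (space M - (A \<union> B))" using A B by (subst M.prob_compl) auto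
  also have "\<dots> \<le> measure M G"
  proof (rule M.finite_measure_mono_AE[OF _ G])
    show "AE \<omega> in M. \<omega> \<in> space M - (A \<union> B) \<longrightarrow> \<omega> \<in> G"
      using A_ok B_ok
    proof eventually_elim
      case (elim \<omega>)
      show ?case
      proof
        assume \<omega>: "\<omega> \<in> space M - (A \<union> B)"
        have "duality_gap X Y (expected_objective P \<Psi>) (xc (T + 1) \<omega>) (yc (T + 1) \<omega>) \<le> 2 * (\<delta> * (2 + 2 * real T))"
        proof (rule duality_gap_le[OF X(3) Y(3)])
          show "expected_objective P \<Psi> (xc (T + 1) \<omega>) y \<le> expected_objective P \<Psi> u v + \<delta> * (2 + 2 * real T)" if "y \<in> Y" for y
            using elim \<omega> that by blast
          have "- expected_objective P \<Psi> x (yc (T + 1) \<omega>) \<le> - expected_objective P \<Psi> u v + \<delta> * (2 + 2 * real T)" if "x \<in> X" for x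
            using elim \<omega> that by blast
          then show "expected_objective P \<Psi> u v - \<delta> * (2 + 2 * real T) \<le> expected_objective P \<Psi> x (yc (T + 1) \<omega>)" if "x \<in> X" for x
            using that by force
        qed
        \<comment> \<open>The factor 2 counts the two players; the total loss 4 * \<delta> * (T + 1)
          explains the denominator of \<delta>.\<close>
        also have "2 * (\<delta> * (2 + 2 * real T)) = \<epsilon>" by (simp add: \<delta> field_simps)
        finally show "\<omega> \<in> G" using \<omega> gap_eq[of \<omega>] by (simp add: G_def)
      qed
    qed
  qed
  finally show ?thesis unfolding G_def .
qed

end
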